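(* Let $g_0$ be the standard round metric on the unit sphere $S^2$, let $p_1=S$ and $p_2=N$ be the south and north pole, and let $0<\alpha_1<\alpha_2<+\infty$. Let $\rho>0$. If the equation $$-\Delta_{g_0}u=\rho\left(\frac{e^{2u}}{\int_{S^2}e^{2u}\,dV_{g_0}}-\frac{1}{|S^2|}\right)-2\pi\sum_{j=1}^2\alpha_j\left(\delta_{p_j}-\frac1{|S^2|}\right)\quad\text{on }S^2$$ admits a solution, then $$\text{either}\quad 0<\rho<4\pi(1+\alpha_1)\qquad\text{or}\qquad 4\pi(1+\alpha_2)<\rho<+\infty .$$
   Context: $|S^2|=4\pi$ is the area of $(S^2,g_0)$. The equation is understood in the sense of distributions: with $G_p$ the Green's function ($-\Delta_{g_0}G_p=\delta_p-\frac1{|S^2|}$, $\int_{S^2} G_p\,dV_{g_0}=0$), a solution is a function $u$ such that $u+2\pi\sum_j\alpha_jG_{p_j}\in H^1(S^2)$ and the equation holds in the distributional sense. *)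

theory Defs
  imports "HOL-Analysis.Analysis"
begin

text \<open>
  The unit sphere carries the metric induced from Euclidean space. Functions and tangent fields on
  the sphere are functions on \<open>real ^ 3\<close> of which only the values on the sphere matter.
\<close>

definition S2 :: "(real ^ 3) set" where
  "S2 = sphere 0 1"

definition north_pole :: "real ^ 3" where
  "north_pole = vector [0, 0, 1]"

definition south_pole :: "real ^ 3" where
  "south_pole = vector [0, 0, -1]"

definition sph_coord :: "real \<times> real \<Rightarrow> real ^ 3" where
  "sph_coord = (\<lambda>(\<theta>, \<phi>). vector [sin \<theta> * cos \<phi>, sin \<theta> * sin \<phi>, cos \<theta>])"

text \<open>
  In spherical coordinates the round metric is \<open>d\<theta>\<^sup>2 + sin\<^sup>2 \<theta> d\<phi>\<^sup>2\<close>, so its volume element is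
  \<open>sin \<theta> d\<theta> d\<phi>\<close>; the coordinates miss only a half great circle, which has measure zero.
  The measure space is the sphere itself with its Borel sets.
\<close>

definition dV :: "(real ^ 3) measure" where
  "dV = distr
     (density (restrict_space lborel ({0<..<pi} \<times> {0<..<2 * pi})) (\<lambda>(\<theta>, \<phi>). ennreal (sin \<theta>)))
     (restrict_space borel S2) sph_coord"

definition area_S2 :: real where
  "area_S2 = measure dV S2"

text \<open>
  \<open>C_k k f\<close> says that \<open>f\<close> is of class \<open>C\<^sup>k\<close> on \<open>real ^ 3\<close>. Smooth functions on the sphere
  are the restrictions of smooth functions on the ambient space.
\<close>

primrec C_k :: "nat \<Rightarrow> (real ^ 3 \<Rightarrow> real) \<Rightarrow> bool" where
  "C_k 0 f \<longleftrightarrow> continuous_on UNIV f"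
| "C_k (Suc k) f \<longleftrightarrow> (\<forall>x. f differentiable (at x)) \<and>
     (\<forall>i. C_k k (\<lambda>x. frechet_derivative f (at x) (axis i 1)))"

definition smooth_S2 :: "(real ^ 3 \<Rightarrow> real) set" where
  "smooth_S2 = {f. \<exists>F. (\<forall>k. C_k k F) \<and> (\<forall>x\<in>S2. f x = F x)}"

text \<open>
  The derivative of \<open>f\<close> at \<open>x\<close> within the sphere is determined exactly on the tangent space
  \<open>{v. v \<bullet> x = 0}\<close>; the gradient is the tangent vector that represents it there.
\<close>

definition grad_S2 :: "(real ^ 3 \<Rightarrow> real) \<Rightarrow> real ^ 3 \<Rightarrow> real ^ 3" where
  "grad_S2 f x = (THE w. w \<bullet> x = 0 \<and> (f has_derivative (\<lambda>v. w \<bullet> v)) (at x within S2))"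

text \<open>
  The Levi-Civita derivative of a tangent field \<open>X\<close> is the tangential part of its derivative
  \<open>D\<close>, so the divergence is the trace of \<open>D\<close> over the tangent plane, that is \<open>D e\<^sub>1 \<bullet> e\<^sub>1 + D e\<^sub>2 \<bullet> e\<^sub>2\<close>
  for an orthonormal basis of that plane. If the undetermined normal value is fixed as \<open>D x = 0\<close>,
  this equals the trace of \<open>D\<close> on the ambient space.
\<close>

definition div_S2 :: "(real ^ 3 \<Rightarrow> real ^ 3) \<Rightarrow> real ^ 3 \<Rightarrow> real" where
  "div_S2 X x = (THE d. \<exists>D. (X has_derivative D) (at x within S2) \<and> D x = 0 \<and>
     d = (\<Sum>b\<in>Basis. D b \<bullet> b))"

definition laplacian_S2 :: "(real ^ 3 \<Rightarrow> real) \<Rightarrow> real ^ 3 \<Rightarrow> real" where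
  "laplacian_S2 f = div_S2 (grad_S2 f)"

text \<open>\<open>H\<^sup>1\<close> is the completion, inside \<open>L\<^sup>2\<close>, of the smooth functions in the \<open>H\<^sup>1\<close> norm.\<close>

definition H1_norm :: "(real ^ 3 \<Rightarrow> real) \<Rightarrow> real" where
  "H1_norm f = sqrt ((\<integral>x. (f x)\<^sup>2 \<partial>dV) + (\<integral>x. (norm (grad_S2 f x))\<^sup>2 \<partial>dV))"

definition H1_S2 :: "(real ^ 3 \<Rightarrow> real) set" where
  "H1_S2 = {f. f \<in> borel_measurable dV \<and> integrable dV (\<lambda>x. (f x)\<^sup>2) \<and>
     (\<exists>\<phi>. (\<forall>n::nat. \<phi> n \<in> smooth_S2) \<and>
        (\<lambda>n. \<integral>x. (\<phi> n x - f x)\<^sup>2 \<partial>dV) \<longlonglongrightarrow> 0 \<and>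
        (\<forall>\<epsilon>>0. \<exists>N. \<forall>m\<ge>N. \<forall>n\<ge>N. H1_norm (\<lambda>x. \<phi> m x - \<phi> n x) < \<epsilon>))}"

text \<open>Distributions are represented by their action on \<open>smooth_S2\<close>.\<close>

type_synonym dist_S2 = "(real ^ 3 \<Rightarrow> real) \<Rightarrow> real"

definition dist_of :: "(real ^ 3 \<Rightarrow> real) \<Rightarrow> dist_S2" where
  "dist_of f = (\<lambda>\<phi>. \<integral>x. f x * \<phi> x \<partial>dV)"

definition dirac :: "real ^ 3 \<Rightarrow> dist_S2" where
  "dirac p = (\<lambda>\<phi>. \<phi> p)"

definition dist_laplacian :: "dist_S2 \<Rightarrow> dist_S2" where
  "dist_laplacian T = (\<lambda>\<phi>. T (laplacian_S2 \<phi>))"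

definition is_green :: "real ^ 3 \<Rightarrow> (real ^ 3 \<Rightarrow> real) \<Rightarrow> bool" where
  "is_green p G \<longleftrightarrow> integrable dV G \<and> (\<integral>x. G x \<partial>dV) = 0 \<and>
     (\<forall>\<phi>\<in>smooth_S2. - dist_laplacian (dist_of G) \<phi>
        = dirac p \<phi> - dist_of (\<lambda>_. 1 / area_S2) \<phi>)"

text \<open>The conditions determine \<open>G\<close> only up to a null set, hence \<open>SOME\<close>.\<close>

definition green :: "real ^ 3 \<Rightarrow> real ^ 3 \<Rightarrow> real" where
  "green p = (SOME G. is_green p G)"

text \<open>
  The integrability conditions are what make both sides of the equation distributions.
\<close>

definition liouville_solution ::
  "real \<Rightarrow> nat \<Rightarrow> (nat \<Rightarrow> real ^ 3) \<Rightarrow> (nat \<Rightarrow> real) \<Rightarrow> (real ^ 3 \<Rightarrow> real) \<Rightarrow> bool" where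
  "liouville_solution \<rho> m p \<alpha> u \<longleftrightarrow>
     integrable dV u \<and> integrable dV (\<lambda>x. exp (2 * u x)) \<and>
     (\<lambda>x. u x + 2 * pi * (\<Sum>j=1..m. \<alpha> j * green (p j) x)) \<in> H1_S2 \<and>
     (\<forall>\<phi>\<in>smooth_S2. - dist_laplacian (dist_of u) \<phi>
        = \<rho> * dist_of (\<lambda>x. exp (2 * u x) / (\<integral>y. exp (2 * u y) \<partial>dV) - 1 / area_S2) \<phi>
          - 2 * pi * (\<Sum>j=1..m. \<alpha> j * (dirac (p j) \<phi> - dist_of (\<lambda>_. 1 / area_S2) \<phi>)))"

end

theory Submission
  imports Defs
begin

text \<open>
  Let \<open>W = e\<^bsup>2u\<^esup> / \<integral>e\<^bsup>2u\<^esup>\<close>. Testing the equation with the smoothed kernels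
  \<open>ln (1 + \<epsilon> - x \<bullet> y)\<close>, whose Laplacians form a Poisson-type approximate identity, and letting
  \<open>\<epsilon> \<rightarrow> 0\<close> represents \<open>u\<close> almost everywhere as the logarithmic potential of \<open>W\<close> plus the two
  explicit singular terms. The argument of Brezis and Merle then gives \<open>W \<in> L\<^sup>2\<close>.

  Let \<open>\<Phi>\<^sub>T\<close> be the flow of the conformal field \<open>grad x\<^sub>3\<close>. Changing variables in \<open>\<integral>e\<^bsup>2u\<^esup>\<close> and using
  \<open>e\<^sup>b \<ge> 1 + b\<close> shows \<open>\<integral>W (2 (u \<circ> \<Phi>\<^sub>T - u) + ln Jac \<Phi>\<^sub>T) \<le> 0\<close>. After symmetrisation in the two
  variables of the potential only a second difference of the logarithmic kernel along the flow
  remains, which is \<open>O(T\<^bsup>3/2\<^esup>)\<close>. Since \<open>T\<close> may have either sign, the first-order terms cancel: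
  \<open>\<alpha>\<^sub>1 - \<alpha>\<^sub>2 + (\<rho> / 2\<pi> - \<alpha>\<^sub>1 - \<alpha>\<^sub>2 - 2) \<integral>W x\<^sub>3 = 0\<close>, a Kazdan-Warner identity that needs no regularity
  of \<open>u\<close>. The claim follows from \<open>\<bar>\<integral>W x\<^sub>3\<bar> < 1\<close>.
\<close>

section \<open>Smooth functions and the Laplacian on the sphere\<close>

text \<open>The classical proof multiplies the equation by the derivative of \<open>u\<close> along
  \<open>grad x\<^sub>3\<close> and integrates by parts, which demands control of the gradient of
  \<open>u\<close> up to the two poles. Nothing is differentiated here. The flow fixes both poles
  and the singular terms transform explicitly under it, so no cut-off near the poles is needed.
  \<open>W \<in> L\<^sup>2\<close> serves two purposes: it bounds the potential at every point, in
  particular at the moved points, and it makes the double integral of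
  \<open>W x * W y * (1 - x \<bullet> y) powr (- (3/4))\<close> finite. Symmetrisation spares a
  derivative of the potential: exchanging \<open>x\<close> and \<open>y\<close> reverses the
  first-order variation of the kernel, except for an explicit term \<open>ln (1 + T * x $ 3)\<close>
  of the same form as those produced by the Jacobian and by the poles.\<close>

lemma C_k_SucI:
  fixes f :: "real ^ 3 \<Rightarrow> real"
  assumes "\<And>x. (f has_derivative f' x) (at x)" "\<And>i. C_k k (\<lambda>x. f' x (axis i 1))"
  shows "C_k (Suc k) f"
proof -
  have "frechet_derivative f (at x) = f' x" for x
    using frechet_derivative_at[OF assms(1)] by simp
  then show ?thesis using assms by (auto simp: differentiable_def)
qed

lemma C_k_SucD:
  assumes "C_k (Suc k) f"
  shows "(f has_derivative frechet_derivative f (at x)) (at x)"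
    and "C_k k (\<lambda>x. frechet_derivative f (at x) (axis i 1))"
  using assms by (simp_all add: frechet_derivative_works[symmetric])

lemma C_k_Suc_imp: "C_k (Suc k) f \<Longrightarrow> C_k k f"
proof (induction k arbitrary: f)
  case 0
  then show ?case
    by (simp add: continuous_at_imp_continuous_on differentiable_imp_continuous_within)
next
  case (Suc k)
  then have "f differentiable (at x)" "C_k k (\<lambda>x. frechet_derivative f (at x) (axis i 1))" for x i
    using Suc.IH[OF C_k_SucD(2)[OF Suc.prems]] by (simp_all only: C_k.simps(2))
  then show ?case by (simp only: C_k.simps(2)) blast
qed

lemma C_k_const: "C_k k (\<lambda>x. c)"
proof (induction k arbitrary: c)
  case (Suc k)
  show ?case by (rule C_k_SucI[where f' = "\<lambda>x h. 0"]) (auto simp: Suc)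
qed simp

lemma C_k_nth: "C_k k (\<lambda>x. x $ i)"
proof (cases k)
  case (Suc n)
  show ?thesis unfolding Suc
    by (rule C_k_SucI[where f' = "\<lambda>x h. h $ i"]) (auto intro!: C_k_const bounded_linear_imp_has_derivative bounded_linear_vec_nth)
qed (simp add: continuous_on_component)

lemma C_k_add: "C_k k f \<Longrightarrow> C_k k g \<Longrightarrow> C_k k (\<lambda>x. f x + g x)"
proof (induction k arbitrary: f g)
  case (Suc k)
  show ?case
    by (rule C_k_SucI, rule has_derivative_add[OF C_k_SucD(1)[OF Suc.prems(1)]
          C_k_SucD(1)[OF Suc.prems(2)]])
      (intro Suc.IH C_k_SucD(2)[OF Suc.prems(1)] C_k_SucD(2)[OF Suc.prems(2)])
qed (simp add: continuous_on_add)

lemma C_k_mult: "C_k k f \<Longrightarrow> C_k k g \<Longrightarrow> C_k k (\<lambda>x. f x * g x)"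
proof (induction k arbitrary: f g)
  case (Suc k)
  show ?case
    by (rule C_k_SucI, rule has_derivative_mult[OF C_k_SucD(1)[OF Suc.prems(1)]
          C_k_SucD(1)[OF Suc.prems(2)]])
      (intro C_k_add Suc.IH C_k_SucD(2)[OF Suc.prems(1)] C_k_SucD(2)[OF Suc.prems(2)]
        C_k_Suc_imp[OF Suc.prems(1)] C_k_Suc_imp[OF Suc.prems(2)])
qed (simp add: continuous_on_mult)

lemma C_k_inverse:
  assumes "\<And>x. f x \<noteq> 0"
  shows "C_k k f \<Longrightarrow> C_k k (\<lambda>x. inverse (f x))"
proof (induction k)
  case 0
  then show ?case by (simp add: assms continuous_on_inverse)
next
  case (Suc k)
  have *: "C_k k (\<lambda>x. inverse (f x))" using Suc C_k_Suc_imp by blast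
  have "((\<lambda>x. inverse (f x)) has_derivative
      (\<lambda>h. (- 1) * (inverse (f x) * frechet_derivative f (at x) h * inverse (f x)))) (at x)" for x
    using Deriv.has_derivative_inverse[OF assms C_k_SucD(1)[OF Suc.prems]] by simp
  then show ?case
    by (rule C_k_SucI) (intro C_k_mult C_k_const * C_k_SucD(2)[OF Suc.prems])
qed

lemma C_k_ln:
  assumes "\<And>x. f x > 0" "C_k k f"
  shows "C_k k (\<lambda>x. ln (f x))"
proof (cases k)
  case 0
  then show ?thesis using assms by (auto intro!: continuous_on_ln simp: less_imp_neq[symmetric])
next
  case (Suc n)
  note f = assms(2)[unfolded Suc]
  have nz: "f x \<noteq> 0" for x using assms(1)[of x] by simp
  have "((\<lambda>x. ln (f x)) has_derivative
      (\<lambda>h. frechet_derivative f (at x) h * inverse (f x))) (at x)" for x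
    by (rule has_derivative_ln[OF assms(1) C_k_SucD(1)[OF f]])
  then show ?thesis unfolding Suc
    by (rule C_k_SucI) (intro C_k_mult C_k_inverse nz C_k_SucD(2)[OF f] C_k_Suc_imp[OF f])
qed

text \<open>At \<open>\<epsilon> = 0\<close> this is, up to an additive constant,
  \<open>- 4 * pi\<close> times the Green's function with pole \<open>y\<close>; the shift by
  \<open>\<epsilon>\<close> makes it an admissible test function.\<close>

definition log_kernel :: "real \<Rightarrow> real ^ 3 \<Rightarrow> real ^ 3 \<Rightarrow> real" where
  "log_kernel \<epsilon> y x = ln (1 + \<epsilon> - x \<bullet> y)"

lemma in_S2: "x \<in> S2 \<longleftrightarrow> x \<bullet> x = 1"
  by (simp add: S2_def norm_eq_1)

text \<open>On the sphere \<open>1 - x \<bullet> y = |x - y|\<^sup>2 / 2\<close>, which extends the kernel smoothly to the whole space.\<close>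

lemma log_kernel_smooth:
  assumes "\<epsilon> > 0" "y \<in> S2"
  shows "log_kernel \<epsilon> y \<in> smooth_S2"
proof -
  define q where "q = (\<lambda>x :: real ^ 3. \<epsilon> + 1 / 2 * ((x $ 1 + (- y $ 1)) * (x $ 1 + (- y $ 1))
    + (x $ 2 + (- y $ 2)) * (x $ 2 + (- y $ 2)) + (x $ 3 + (- y $ 3)) * (x $ 3 + (- y $ 3))))"
  have "q x > 0" for x
    using assms(1) unfolding q_def
    by (intro add_pos_nonneg mult_nonneg_nonneg add_nonneg_nonneg zero_le_square) auto
  moreover have "C_k k q" for k
    unfolding q_def by (intro C_k_add C_k_mult C_k_const C_k_nth)
  ultimately have "C_k k (\<lambda>x. ln (q x))" for k
    by (rule C_k_ln)
  moreover have "log_kernel \<epsilon> y x = ln (q x)" if "x \<in> S2" for x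
    using that assms(2) unfolding log_kernel_def q_def in_S2
    by (intro arg_cong[of _ _ ln]) (simp add: inner_vec_def sum_3 algebra_simps)
  ultimately show ?thesis unfolding smooth_S2_def by (auto intro!: exI[of _ "\<lambda>x. ln (q x)"])
qed

section \<open>Derivatives within the sphere; formulas for gradient and divergence\<close>

lemma has_derivative_S2_unique:
  fixes g :: "real ^ 3 \<Rightarrow> 'b::real_normed_vector"
  assumes A: "(g has_derivative A) (at x within S2)" and B: "(g has_derivative B) (at x within S2)"
    and x: "x \<in> S2" and v: "v \<bullet> x = 0"
  shows "A v = B v"
proof -
  have lA: "linear A" and lB: "linear B" using A B has_derivative_linear by blast+
  have unit: "A w = B w" if w: "w \<bullet> x = 0" "w \<bullet> w = 1" for w
  proof -
    \<comment> \<open>Great circle through \<open>x\<close> with velocity \<open>w\<close>: it stays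
      in the sphere, so composing with it yields an ordinary derivative on the line, which is
      unique.\<close>
    define c where "c = (\<lambda>s::real. cos s *\<^sub>R x + sin s *\<^sub>R w)"
    have cS: "c s \<in> S2" for s
      using x w unfolding c_def in_S2
      by (simp add: inner_left_distrib inner_right_distrib inner_commute[of x w]
          flip: power2_eq_square)
    have c0: "c 0 = x" by (simp add: c_def)
    have dc: "(c has_derivative (\<lambda>h. h *\<^sub>R w)) (at 0)"
      unfolding c_def by (auto intro!: derivative_eq_intros simp: fun_eq_iff)
    have comp: "((g \<circ> c) has_derivative (\<lambda>h. h *\<^sub>R L w)) (at 0)"
      if "(g has_derivative L) (at x within S2)" for L
    proof -
      have "(g has_derivative L) (at (c 0) within range c)"
        using that cS c0 by (auto intro: has_derivative_subset)
      from diff_chain_within[OF dc this] have "((g \<circ> c) has_derivative L \<circ> (\<lambda>h. h *\<^sub>R w)) (at 0)" .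
      moreover have "L \<circ> (\<lambda>h. h *\<^sub>R w) = (\<lambda>h. h *\<^sub>R L w)"
        using has_derivative_linear[OF that] by (auto simp: linear_cmul)
      ultimately show ?thesis by simp
    qed
    have "(\<lambda>h. h *\<^sub>R A w) = (\<lambda>h. h *\<^sub>R B w)"
      using has_derivative_unique[OF comp[OF A] comp[OF B]] .
    from fun_cong[OF this, of 1] show ?thesis by simp
  qed
  show ?thesis
  proof (cases "v = 0")
    case True then show ?thesis using lA lB by (simp add: linear_0)
  next
    case False
    have "A (v /\<^sub>R norm v) = B (v /\<^sub>R norm v)"
      using False v by (intro unit) (auto simp: dot_square_norm power2_eq_square)
    then show ?thesis using False lA lB by (simp add: linear_cmul)
  qed
qed

text \<open>On the sphere \<open>1 - z \<bullet> x\<close> is half the squared distance of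
  \<open>z\<close> and \<open>x\<close>, hence of second order at \<open>x\<close>. The ambient
  formula gives it a normal derivative as well, and this ambiguity is used to correct the normal
  part of other derivatives.\<close>

lemma normal_derivative_S2:
  assumes x: "x \<in> S2"
  shows "((\<lambda>z. c * (1 - (z \<bullet> x))) has_derivative (\<lambda>v. 0)) (at x within S2)"
proof -
  have "((\<lambda>z. c * ((z - x) \<bullet> (z - x) / 2)) has_derivative (\<lambda>v. 0)) (at x within S2)"
    by (auto intro!: derivative_eq_intros)
  moreover have "c * (1 - z \<bullet> x) = c * ((z - x) \<bullet> (z - x) / 2)" if "z \<in> S2" for z
    using that x by (simp add: in_S2 inner_diff_left inner_diff_right inner_commute[of x z])
  ultimately show ?thesis
    by (rule has_derivative_transform[OF x, rotated])
qed

lemma grad_S2_eqI: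
  assumes x: "x \<in> S2" and f: "(f has_derivative (\<lambda>v. w \<bullet> v)) (at x within S2)"
  shows "grad_S2 f x = w - (w \<bullet> x) *\<^sub>R x"
proof -
  have xx: "x \<bullet> x = 1" using x by (simp add: in_S2)
  let ?w = "w - (w \<bullet> x) *\<^sub>R x"
  \<comment> \<open>The subtracted bracket is the constant \<open>w \<bullet> x\<close>; split this
    way, its derivative within the sphere comes out as
    \<open>(w \<bullet> x) * (v \<bullet> x)\<close>, exactly the normal part of
    \<open>w\<close>.\<close>
  have 1: "((\<lambda>z. f z - ((w \<bullet> x) * (1 - z \<bullet> x) + (w \<bullet> x) * (z \<bullet> x))) has_derivative 
       (\<lambda>v. w \<bullet> v - (0 + (w \<bullet> x) * (v \<bullet> x)))) (at x within S2)"
    by (intro has_derivative_diff f has_derivative_add normal_derivative_S2 x)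
      (auto intro!: derivative_eq_intros)
  have "((\<lambda>z. f z - (w \<bullet> x)) has_derivative (\<lambda>v. ?w \<bullet> v)) (at x within S2)"
  proof (rule has_derivative_eq_rhs)
    show "((\<lambda>z. f z - (w \<bullet> x)) has_derivative
        (\<lambda>v. w \<bullet> v - (0 + (w \<bullet> x) * (v \<bullet> x)))) (at x within S2)"
      using 1 by (simp add: ring_distribs)
  qed (auto simp: fun_eq_iff inner_diff_left inner_commute[of x])
  from has_derivative_add_const[OF this, of "w \<bullet> x"]
  have d: "(f has_derivative (\<lambda>v. ?w \<bullet> v)) (at x within S2)" by (simp only: diff_add_cancel)
  show ?thesis unfolding grad_S2_def
  proof (rule the_equality)
    show "?w \<bullet> x = 0 \<and> (f has_derivative (\<bullet>) ?w) (at x within S2)"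
      by (intro conjI d) (simp add: inner_diff_left xx)
    fix w' assume w': "w' \<bullet> x = 0 \<and> (f has_derivative (\<bullet>) w') (at x within S2)"
    then have "(w' - ?w) \<bullet> x = 0" by (simp add: inner_diff_left xx)
    from has_derivative_S2_unique[OF conjunct2[OF w'] d x this]
    have "(w' - ?w) \<bullet> (w' - ?w) = 0" by (simp add: inner_diff_left)
    then show "w' = ?w" by simp
  qed
qed

text \<open>\<open>D\<close> may have any value at \<open>x\<close>, while the definition asks for a
  derivative that kills \<open>x\<close>. Replacing \<open>D v\<close> by
  \<open>D v - (v \<bullet> x) *\<^sub>R D x\<close> achieves this and lowers the trace by
  \<open>D x \<bullet> x\<close>.\<close>

lemma div_S2_eqI:
  assumes x: "x \<in> S2" and X: "(X has_derivative D) (at x within S2)"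
  shows "div_S2 X x = (\<Sum>b\<in>Basis. D b \<bullet> b) - D x \<bullet> x"
proof -
  have xx: "x \<bullet> x = 1" using x by (simp add: in_S2)
  have lD: "linear D" using X has_derivative_linear by blast
  define E where "E = (\<lambda>v. D v - (v \<bullet> x) *\<^sub>R D x)"
  have "((\<lambda>z. (1 - z \<bullet> x) *\<^sub>R D x) has_derivative (\<lambda>v. 0 *\<^sub>R D x)) (at x within S2)"
    using normal_derivative_S2[OF x, of 1] by (intro has_derivative_scaleR_left) simp
  moreover have "((\<lambda>z. (z \<bullet> x) *\<^sub>R D x) has_derivative (\<lambda>v. (v \<bullet> x) *\<^sub>R D x)) (at x within S2)"
    by (auto intro!: derivative_eq_intros)
  ultimately have "((\<lambda>z. X z - ((1 - z \<bullet> x) *\<^sub>R D x + (z \<bullet> x) *\<^sub>R D x)) has_derivative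
      (\<lambda>v. D v - (0 *\<^sub>R D x + (v \<bullet> x) *\<^sub>R D x))) (at x within S2)"
    by (intro has_derivative_diff X has_derivative_add)
  then have "((\<lambda>z. X z - D x) has_derivative E) (at x within S2)"
    by (simp add: E_def algebra_simps)
  from has_derivative_add_const[OF this, of "D x"]
  have E: "(X has_derivative E) (at x within S2)" by simp
  have Ex: "E x = 0" by (simp add: E_def xx)
  have lE: "linear E" using E has_derivative_linear by blast
  have "D x \<bullet> x = (\<Sum>b\<in>Basis. (x \<bullet> b) * (D x \<bullet> b))"
    by (simp add: euclidean_inner[of "D x" x] mult.commute)
  then have tr: "(\<Sum>b\<in>Basis. E b \<bullet> b) = (\<Sum>b\<in>Basis. D b \<bullet> b) - D x \<bullet> x"
    by (simp add: E_def inner_diff_left sum_subtractf inner_commute[of x])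
  show ?thesis unfolding div_S2_def tr[symmetric]
  proof (rule the_equality)
    show "\<exists>D. (X has_derivative D) (at x within S2) \<and> D x = 0 \<and> (\<Sum>b\<in>Basis. E b \<bullet> b) = (\<Sum>b\<in>Basis. D b \<bullet> b)"
      using E Ex by blast
    fix d assume "\<exists>D. (X has_derivative D) (at x within S2) \<and> D x = 0 \<and> d = (\<Sum>b\<in>Basis. D b \<bullet> b)"
    then obtain F where F: "(X has_derivative F) (at x within S2)" "F x = 0" "d = (\<Sum>b\<in>Basis. F b \<bullet> b)"
      by blast
    have lF: "linear F" using F has_derivative_linear by blast
    have "F v = E v" for v
    proof -
      have "F (v - (v \<bullet> x) *\<^sub>R x) = E (v - (v \<bullet> x) *\<^sub>R x)"
        by (rule has_derivative_S2_unique[OF F(1) E x]) (simp add: inner_diff_left xx)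
      then show ?thesis using lE lF Ex F(2) by (simp add: linear_diff linear_cmul)
    qed
    then show "d = (\<Sum>b\<in>Basis. E b \<bullet> b)" using F(3) by simp
  qed
qed

lemma inner_S2_le: "x \<in> S2 \<Longrightarrow> y \<in> S2 \<Longrightarrow> \<bar>x \<bullet> y\<bar> \<le> 1"
  using Cauchy_Schwarz_ineq2[of x y] by (simp add: S2_def)

text \<open>The right-hand side is \<open>4 * pi * poisson \<epsilon> (x \<bullet> y) - 1\<close>
  with the kernel \<open>poisson\<close> defined below: a smoothed form of the distributional
  Laplacian of \<open>ln (1 - x \<bullet> y)\<close>, which is \<open>4 * pi\<close> times the Dirac
  mass at \<open>y\<close> minus 1.\<close>

lemma laplacian_log_kernel:
  assumes e: "\<epsilon> > 0" and y: "y \<in> S2" and x: "x \<in> S2"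
  shows "laplacian_S2 (log_kernel \<epsilon> y) x = \<epsilon> * (2 + \<epsilon>) / (1 + \<epsilon> - x \<bullet> y)\<^sup>2 - 1"
proof -
  have pos: "1 + \<epsilon> - z \<bullet> y > 0" if "z \<in> S2" for z
    using inner_S2_le[OF that y] e by linarith
  define s where "s = 1 + \<epsilon> - x \<bullet> y"
  have s: "s > 0" using pos[OF x] by (simp add: s_def)
  have gr: "grad_S2 (log_kernel \<epsilon> y) z = (- 1 / (1 + \<epsilon> - z \<bullet> y)) *\<^sub>R (y - (z \<bullet> y) *\<^sub>R z)"
    if z: "z \<in> S2" for z
  proof -
    have "(log_kernel \<epsilon> y has_derivative (\<lambda>v. ((- 1 / (1 + \<epsilon> - z \<bullet> y)) *\<^sub>R y) \<bullet> v)) (at z within S2)"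
      unfolding log_kernel_def using pos[OF z]
      by (auto intro!: derivative_eq_intros simp: inner_commute[of y] divide_simps)
    from grad_S2_eqI[OF z this] show ?thesis
      by (simp add: inner_commute[of y] scaleR_diff_right)
  qed
  define D where "D = (\<lambda>v. (- (v \<bullet> y) / s\<^sup>2) *\<^sub>R (y - (x \<bullet> y) *\<^sub>R x)
      + (- 1 / s) *\<^sub>R (- ((v \<bullet> y) *\<^sub>R x + (x \<bullet> y) *\<^sub>R v)))"
  have "((\<lambda>z. - 1 / (1 + \<epsilon> - z \<bullet> y)) has_derivative (\<lambda>v. - (v \<bullet> y) / s\<^sup>2)) (at x within S2)"
    using pos[OF x] unfolding s_def
    by (auto intro!: derivative_eq_intros simp: power2_eq_square divide_simps)
  moreover have "((\<lambda>z. y - (z \<bullet> y) *\<^sub>R z) has_derivative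
      (\<lambda>v. - ((v \<bullet> y) *\<^sub>R x + (x \<bullet> y) *\<^sub>R v))) (at x within S2)"
    by (auto intro!: derivative_eq_intros)
  ultimately have "((\<lambda>z. (- 1 / (1 + \<epsilon> - z \<bullet> y)) *\<^sub>R (y - (z \<bullet> y) *\<^sub>R z)) has_derivative
      (\<lambda>v. (- 1 / (1 + \<epsilon> - x \<bullet> y)) *\<^sub>R (- ((v \<bullet> y) *\<^sub>R x + (x \<bullet> y) *\<^sub>R v))
        + (- (v \<bullet> y) / s\<^sup>2) *\<^sub>R (y - (x \<bullet> y) *\<^sub>R x))) (at x within S2)"
    by (rule has_derivative_scaleR)
  then have "((\<lambda>z. (- 1 / (1 + \<epsilon> - z \<bullet> y)) *\<^sub>R (y - (z \<bullet> y) *\<^sub>R z)) has_derivative D) (at x within S2)"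
    unfolding D_def s_def by (simp only: add.commute)
  then have D: "(grad_S2 (log_kernel \<epsilon> y) has_derivative D) (at x within S2)"
    by (rule has_derivative_transform[OF x, rotated]) (simp add: gr)
  have xx: "x \<bullet> x = 1" "y \<bullet> y = 1" using x y by (auto simp: in_S2)
  define t where "t = x \<bullet> y"
  have yy: "(\<Sum>b\<in>Basis. (b \<bullet> y) * (y \<bullet> b)) = 1" "(\<Sum>b\<in>Basis. (b \<bullet> y) * (x \<bullet> b)) = t"
    using xx euclidean_inner[of y y] euclidean_inner[of x y] by (simp_all add: inner_commute mult.commute t_def)
  have "D b \<bullet> b = - (1 / s\<^sup>2) * ((b \<bullet> y) * (y \<bullet> b)) + (t / s\<^sup>2 + 1 / s) * ((b \<bullet> y) * (x \<bullet> b)) + t / s * (b \<bullet> b)" for b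
    by (simp add: D_def inner_add_left inner_diff_left t_def algebra_simps add_divide_distrib)
  then have "(\<Sum>b\<in>Basis. D b \<bullet> b) = - (1 / s\<^sup>2) * (\<Sum>b\<in>Basis. (b \<bullet> y) * (y \<bullet> b))
      + (t / s\<^sup>2 + 1 / s) * (\<Sum>b\<in>Basis. (b \<bullet> y) * (x \<bullet> b)) + t / s * (\<Sum>b\<in>(Basis::(real^3) set). (b \<bullet> b))"
    by (simp only: sum.distrib sum_distrib_left)
  also have "\<dots> = - (1 / s\<^sup>2) + (t / s\<^sup>2 + 1 / s) * t + 3 * t / s" by (simp add: yy)
  finally have tr: "(\<Sum>b\<in>Basis. D b \<bullet> b) = - (1 / s\<^sup>2) + (t / s\<^sup>2 + 1 / s) * t + 3 * t / s" .
  have Dx: "D x \<bullet> x = 2 * t / s"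
    using s unfolding D_def
    by (simp only: inner_add_left inner_diff_left inner_minus_left inner_scaleR_left xx
        inner_commute[of y x] t_def) simp
  have "laplacian_S2 (log_kernel \<epsilon> y) x = - (1 / s\<^sup>2) + (t / s\<^sup>2 + 1 / s) * t + 3 * t / s - 2 * t / s"
    unfolding laplacian_S2_def div_S2_eqI[OF x D] tr Dx ..
  also have "\<dots> = \<epsilon> * (2 + \<epsilon>) / s\<^sup>2 - 1"
  proof -
    \<comment> \<open>Over \<open>s\<^sup>2\<close> the numerator is
      \<open>t\<^sup>2 - 1 + 2 * t * s = (t + s)\<^sup>2 - s\<^sup>2 - 1\<close>, and
      \<open>t + s = 1 + \<epsilon>\<close>.\<close>
    have t: "t = 1 + \<epsilon> - s" by (simp add: s_def t_def)
    show ?thesis unfolding t using s by (simp add: field_simps power2_eq_square)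
  qed
  finally show ?thesis by (simp add: s_def)
qed

section \<open>Integration over the sphere\<close>

text \<open>The functions \<open>max 0 (1 - n * infdist x C)\<close> decrease to the indicator of a
  closed set \<open>C\<close>, and the closed sets form an intersection-stable generator. The case
  \<open>C = {}\<close> is separate because \<open>infdist x {} = 0\<close>.\<close>

lemma measure_eqI_continuous:
  fixes M N :: "'a::metric_space measure"
  assumes sets: "sets M = sets borel" "sets N = sets borel"
    and fin: "finite_measure M" "finite_measure N"
    and eq: "\<And>\<eta>::'a \<Rightarrow> real. continuous_on UNIV \<eta> \<Longrightarrow> (\<And>x. 0 \<le> \<eta> x \<and> \<eta> x \<le> 1)
      \<Longrightarrow> (\<integral>x. \<eta> x \<partial>M) = (\<integral>x. \<eta> x \<partial>N)"
  shows "M = N"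
proof -
  interpret M: finite_measure M by fact
  interpret N: finite_measure N by fact
  have closed_eq: "emeasure M C = emeasure N C" if C: "closed C" for C :: "'a set"
  proof (cases "C = {}")
    case False
    define \<eta> where "\<eta> n x = max 0 (1 - real n * infdist x C)" for n x
    have c: "continuous_on UNIV (\<eta> n)" for n
      unfolding \<eta>_def by (intro continuous_intros)
    have b: "0 \<le> \<eta> n x \<and> \<eta> n x \<le> 1" for n x
      unfolding \<eta>_def by (auto simp: infdist_nonneg)
    have lim: "(\<lambda>n. \<eta> n x) \<longlonglongrightarrow> indicator C x" for x
    proof (cases "x \<in> C")
      case True
      then show ?thesis by (simp add: \<eta>_def)
    next
      case x: False
      then have pos: "infdist x C > 0"
        using C False in_closed_iff_infdist_zero[of C x] infdist_nonneg[of x C] by auto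
      have "eventually (\<lambda>n. 0 = \<eta> n x) sequentially"
      proof -
        obtain m :: nat where m: "1 / infdist x C < m" using reals_Archimedean2 by blast
        have "\<eta> n x = 0" if "n \<ge> m" for n
        proof -
          have "1 / infdist x C < real n" using m that by linarith
          then show ?thesis using pos by (simp add: \<eta>_def field_simps)
        qed
        then show ?thesis unfolding eventually_sequentially by metis
      qed
      then have "(\<lambda>n. \<eta> n x) \<longlonglongrightarrow> 0"
        by (rule Lim_transform_eventually[OF tendsto_const])
      then show ?thesis using x by simp
    qed
    have conv: "(\<lambda>n. \<integral>x. \<eta> n x \<partial>K) \<longlonglongrightarrow> measure K C"
      if K: "sets K = sets borel" "finite_measure K" for K
    proof -
      interpret K: finite_measure K by fact
      have [measurable]: "\<eta> n \<in> borel_measurable K" for n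
        using borel_measurable_continuous_onI[OF c] unfolding measurable_cong_sets[OF K(1) refl] .
      have Cs: "C \<in> sets K" using C K(1) by simp
      have "(\<lambda>n. \<integral>x. \<eta> n x \<partial>K) \<longlonglongrightarrow> (\<integral>x. indicator C x \<partial>K)"
        by (rule integral_dominated_convergence[where w = "\<lambda>_. 1"])
          (use Cs b lim in \<open>auto\<close>)
      then show ?thesis using Cs sets.sets_into_space[OF Cs] by (simp add: Int_absorb2)
    qed
    have "measure M C = measure N C"
      using conv[OF sets(1) fin(1)] conv[OF sets(2) fin(2)] eq[OF c b]
      by (intro LIMSEQ_unique[where X = "\<lambda>n. \<integral>x. \<eta> n x \<partial>M"]) auto
    then show ?thesis by (simp add: M.emeasure_eq_measure N.emeasure_eq_measure)
  qed simp
  show ?thesis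
  proof (rule measure_eqI_generator_eq[where E = "{C. closed C}" and \<Omega> = UNIV and A = "\<lambda>_. UNIV"])
    show "Int_stable {C :: 'a set. closed C}" by (auto simp: Int_stable_def closed_Int)
    show "sets M = sigma_sets UNIV {C. closed C}" "sets N = sigma_sets UNIV {C. closed C}"
      unfolding sets borel_eq_closed by simp_all
  qed (auto simp: closed_eq)
qed

section \<open>Spherical coordinates and the area measure\<close>

lemma sph_coord_nth:
  "sph_coord (\<theta>, \<phi>) $ 1 = sin \<theta> * cos \<phi>" "sph_coord (\<theta>, \<phi>) $ 2 = sin \<theta> * sin \<phi>"
  "sph_coord (\<theta>, \<phi>) $ 3 = cos \<theta>"
  by (simp_all add: sph_coord_def)

lemma sph_coord_nth':
  "sph_coord p $ 1 = sin (fst p) * cos (snd p)" "sph_coord p $ 2 = sin (fst p) * sin (snd p)"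
  "sph_coord p $ 3 = cos (fst p)"
  by (cases p; simp add: sph_coord_nth)+

lemma in_S2_nth: "x \<in> S2 \<longleftrightarrow> (x $ 1)\<^sup>2 + (x $ 2)\<^sup>2 + (x $ 3)\<^sup>2 = 1"
  by (simp add: in_S2 inner_vec_def sum_3 power2_eq_square)

lemma sph_coord_S2: "sph_coord p \<in> S2"
proof (cases p)
  case (Pair \<theta> \<phi>)
  have "(sin \<theta> * cos \<phi>)\<^sup>2 + (sin \<theta> * sin \<phi>)\<^sup>2 + (cos \<theta>)\<^sup>2 = (sin \<theta>)\<^sup>2 * ((cos \<phi>)\<^sup>2 + (sin \<phi>)\<^sup>2) + (cos \<theta>)\<^sup>2"
    by (simp only: power_mult_distrib distrib_left)
  also have "\<dots> = 1" by simp
  finally show ?thesis unfolding Pair in_S2_nth sph_coord_nth .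
qed

lemma continuous_sph_coord: "continuous_on A sph_coord"
proof -
  show ?thesis
    unfolding continuous_on_componentwise[of A sph_coord]
  proof
    fix b :: "real ^ 3" assume "b \<in> Basis"
    then obtain i where b: "b = axis i 1" by (auto simp: Basis_vec_def)
    have "continuous_on A (\<lambda>p. sph_coord p $ j)" for j
    proof -
      have "j = 1 \<or> j = 2 \<or> j = 3" using exhaust_3 by blast
      then show ?thesis
        by (elim disjE; simp add: sph_coord_nth'; intro continuous_intros)
    qed
    then show "continuous_on A (\<lambda>p. sph_coord p \<bullet> b)" by (simp add: b inner_axis)
  qed
qed

lemma sets_dV [measurable_cong]: "sets dV = sets (restrict_space borel S2)"
  and space_dV [simp]: "space dV = S2"
  by (simp_all add: dV_def space_restrict_space)

lemma measurable_ident_dV [measurable]: "(\<lambda>x. x) \<in> borel_measurable dV"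
  unfolding measurable_cong_sets[OF sets_dV refl] by (rule measurable_restrict_space1) simp

lemma measurable_dV [measurable (raw)]:
  "f \<in> measurable borel M \<Longrightarrow> f \<in> measurable dV M"
  using measurable_compose[OF measurable_ident_dV] .

abbreviation coord_box :: "(real \<times> real) set" where
  "coord_box \<equiv> {0<..<pi} \<times> {0<..<2 * pi}"

lemma coord_box_sets [measurable]: "coord_box \<in> sets borel"
  by (intro borel_open open_Times) auto

lemma measurable_sph_coord [measurable]: "sph_coord \<in> borel \<rightarrow>\<^sub>M restrict_space borel S2"
  by (rule measurable_restrict_space2)
    (auto intro: borel_measurable_continuous_onI continuous_sph_coord sph_coord_S2)

lemma measurable_comp_sph_coord [measurable (raw)]:
  "F \<in> borel_measurable dV \<Longrightarrow> (\<lambda>p. F (sph_coord p)) \<in> borel_measurable borel"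
  unfolding measurable_cong_sets[OF sets_dV refl] by (rule measurable_compose[OF measurable_sph_coord])

lemma measurable_sph_coord' [measurable]:
  "sph_coord \<in> density (restrict_space lborel coord_box) w \<rightarrow>\<^sub>M restrict_space borel S2"
  by (subst measurable_cong_sets[OF sets_density refl], rule measurable_restrict_space1) simp

lemma measurable_sin_fst [measurable]:
  "(\<lambda>p::real \<times> real. ennreal (sin (fst p))) \<in> borel_measurable borel"
  by (intro measurable_compose[OF _ measurable_ennreal] borel_measurable_continuous_onI continuous_intros)

lemma nn_integral_dV_box:
  assumes F[measurable]: "F \<in> borel_measurable dV"
  shows "(\<integral>\<^sup>+x. F x \<partial>dV) = (\<integral>\<^sup>+p. ennreal (sin (fst p)) * F (sph_coord p) * indicator coord_box p \<partial>lborel)"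
proof -
  have [measurable]: "F \<in> borel_measurable (restrict_space borel S2)"
    using F unfolding measurable_cong_sets[OF sets_dV refl] .
  have "(\<integral>\<^sup>+x. F x \<partial>dV) = (\<integral>\<^sup>+p. ennreal (sin (fst p)) * F (sph_coord p) \<partial>restrict_space lborel coord_box)"
    unfolding dV_def case_prod_beta
    by (subst nn_integral_distr, measurable, subst nn_integral_density)
      (auto intro!: measurable_restrict_space1)
  also have "\<dots> = (\<integral>\<^sup>+p. ennreal (sin (fst p)) * F (sph_coord p) * indicator coord_box p \<partial>lborel)"
    by (rule nn_integral_restrict_space) simp
  finally show ?thesis .
qed

lemma nn_integral_dV:
  assumes F[measurable]: "F \<in> borel_measurable dV"
  shows "(\<integral>\<^sup>+x. F x \<partial>dV) = (\<integral>\<^sup>+\<phi>. (\<integral>\<^sup>+\<theta>. ennreal (sin \<theta>) * F (sph_coord (\<theta>, \<phi>)) * indicator {0..pi} \<theta> \<partial>lborel)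
    * indicator {0<..<2 * pi} \<phi> \<partial>lborel)"
proof -
  have "(\<integral>\<^sup>+x. F x \<partial>dV) = (\<integral>\<^sup>+\<phi>. \<integral>\<^sup>+\<theta>. ennreal (sin \<theta>) * F (sph_coord (\<theta>, \<phi>)) * indicator coord_box (\<theta>, \<phi>) \<partial>lborel \<partial>lborel)"
  proof -
    have "(\<lambda>p. ennreal (sin (fst p)) * F (sph_coord p) * indicator coord_box p) \<in> borel_measurable borel"
      by (intro borel_measurable_times_ennreal borel_measurable_indicator coord_box_sets
          measurable_sin_fst measurable_comp_sph_coord F)
    then have "(\<lambda>p. ennreal (sin (fst p)) * F (sph_coord p) * indicator coord_box p)
        \<in> borel_measurable (lborel \<Otimes>\<^sub>M lborel)"
      by (simp add: lborel_prod)
    from lborel_pair.nn_integral_snd[OF this] show ?thesis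
      unfolding nn_integral_dV_box[OF F] lborel_prod[symmetric] by simp
  qed
  also have "\<dots> = (\<integral>\<^sup>+\<phi>. (\<integral>\<^sup>+\<theta>. ennreal (sin \<theta>) * F (sph_coord (\<theta>, \<phi>)) * indicator {0..pi} \<theta> 
      * indicator {0<..<2 * pi} \<phi> \<partial>lborel) \<partial>lborel)"
    proof (rule nn_integral_cong, rule nn_integral_cong_AE)
    fix \<phi> :: real
    \<comment> \<open>The end points are added so that the fundamental theorem and the substitution
      rule on closed intervals apply to the inner integral.\<close>
    have "AE \<theta> in lborel. \<theta> \<notin> {0, pi}"
      by (rule AE_not_in) (simp add: finite_imp_null_set_lborel)
    then show "AE \<theta> in lborel. ennreal (sin \<theta>) * F (sph_coord (\<theta>, \<phi>)) * indicator coord_box (\<theta>, \<phi>) =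
        ennreal (sin \<theta>) * F (sph_coord (\<theta>, \<phi>)) * indicator {0..pi} \<theta> * indicator {0<..<2 * pi} \<phi>"
      by eventually_elim (auto simp: indicator_def)
  qed
  also have "\<dots> = (\<integral>\<^sup>+\<phi>. (\<integral>\<^sup>+\<theta>. ennreal (sin \<theta>) * F (sph_coord (\<theta>, \<phi>)) * indicator {0..pi} \<theta> \<partial>lborel)
      * indicator {0<..<2 * pi} \<phi> \<partial>lborel)"
    by (intro nn_integral_cong nn_integral_multc) measurable
  finally show ?thesis .
qed


lemma emeasure_dV: "emeasure dV S2 = 4 * pi"
proof -
  have "(\<integral>\<^sup>+\<theta>. ennreal (sin \<theta>) * indicator {0..pi} \<theta> \<partial>lborel) = ennreal (- cos pi - (- cos 0))"
    by (rule nn_integral_FTC_Icc) (auto intro!: derivative_eq_intros sin_ge_zero simp: has_real_derivative_iff_has_vector_derivative[symmetric])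
  then have "(\<integral>\<^sup>+x. 1 \<partial>dV) = (\<integral>\<^sup>+\<phi>. ennreal 2 * indicator {0<..<2 * pi} \<phi> \<partial>lborel)"
    by (subst nn_integral_dV) auto
  also have "\<dots> = ennreal 2 * ennreal (2 * pi)"
    by (subst nn_integral_cmult) auto
  also have "\<dots> = 4 * pi" by (subst ennreal_mult[symmetric]) auto
  finally show ?thesis by simp
qed

interpretation dV: finite_measure dV
  by (rule finite_measureI) (simp add: emeasure_dV)

lemma measure_dV: "measure dV S2 = 4 * pi"
  by (simp add: measure_def emeasure_dV)

lemma area_S2_eq: "area_S2 = 4 * pi"
  by (simp add: area_S2_def measure_dV)

text \<open>The gauge integral on the closed box gives access to iterated integrals in either order
  and to the fundamental theorem of calculus, on which the moment recursion rests.\<close>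

lemma integral_dV_continuous:
  assumes F: "continuous_on UNIV (F :: real ^ 3 \<Rightarrow> real)"
  shows "(\<integral>x. F x \<partial>dV) = integral (cbox (0, 0) (pi, 2 * pi)) (\<lambda>p. sin (fst p) * F (sph_coord p))"
proof -
  let ?g = "\<lambda>p. sin (fst p) * F (sph_coord p)"
  have gc: "continuous_on A ?g" for A
    by (intro continuous_intros continuous_on_compose2[OF F] continuous_sph_coord) auto
  have box: "coord_box = box (0, 0) (pi, 2 * pi)"
    by (auto simp: box_def Basis_prod_def)
  have cb: "set_integrable lborel coord_box ?g"
  proof (rule set_integrable_subset)
    show "set_integrable lborel (cbox (0, 0) (pi, 2 * pi)) ?g"
      unfolding set_integrable_def by (intro borel_integrable_compact compact_cbox gc)
    show "coord_box \<subseteq> cbox (0, 0) (pi, 2 * pi)" unfolding box by (rule box_subset_cbox)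
  qed simp
  have Fm: "F \<in> borel_measurable borel" by (rule borel_measurable_continuous_onI[OF F])
  have "(\<integral>x. F x \<partial>dV) = (\<integral>p. F (sph_coord p) \<partial>density (restrict_space lborel coord_box) (\<lambda>p. ennreal (sin (fst p))))"
    unfolding dV_def case_prod_beta
    by (rule integral_distr) (auto intro!: measurable_restrict_space1 Fm)
  also have "\<dots> = (\<integral>p. ?g p \<partial>restrict_space lborel coord_box)"
  proof (subst integral_density)
    show "(\<lambda>p. F (sph_coord p)) \<in> borel_measurable (restrict_space lborel coord_box)"
      by (intro measurable_restrict_space1)
        (simp add: borel_measurable_continuous_onI continuous_on_compose2[OF F] continuous_sph_coord)
    show "(\<lambda>p::real \<times> real. sin (fst p)) \<in> borel_measurable (restrict_space lborel coord_box)"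
      by (intro measurable_restrict_space1)
        (simp, intro borel_measurable_continuous_onI continuous_intros)
    show "AE p in restrict_space lborel coord_box. 0 \<le> sin (fst p)"
      by (intro AE_I2) (auto simp: space_restrict_space intro!: sin_ge_zero)
  qed simp
  also have "\<dots> = (LINT p:coord_box|lborel. ?g p)"
    unfolding set_lebesgue_integral_def by (rule integral_restrict_space) simp
  also have "\<dots> = integral coord_box ?g"
    by (rule set_borel_integral_eq_integral[OF cb])
  also have "\<dots> = integral (cbox (0, 0) (pi, 2 * pi)) ?g"
    unfolding box by (rule integral_open_interval)
  finally show ?thesis .
qed

section \<open>The law of \<open>x \<bullet> a\<close>\<close>

text \<open>For \<open>f' (t) = t\<^sup>k\<close> the density \<open>sin \<theta> \<Delta>(f (x \<bullet> a))\<close> is a sum of derivatives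
  in \<open>\<theta>\<close> and \<open>\<phi>\<close>, so its integral vanishes.\<close>

lemma dV_moment_rec:
  assumes a: "a \<in> S2"
  shows "real k * (\<integral>x. (x \<bullet> a) ^ (k - 1) \<partial>dV) = real (k + 2) * (\<integral>x. (x \<bullet> a) ^ (k + 1) \<partial>dV)"
proof -
  \<comment> \<open>\<open>\<tau>\<close> is \<open>x \<bullet> a\<close> in coordinates,
    \<open>\<sigma>\<close> its derivative in \<open>\<theta>\<close>, and
    \<open>sin \<theta> * c' \<phi>\<close> its derivative in \<open>\<phi>\<close>.
    \<open>A\<close> and \<open>B\<close> are the derivatives of
    \<open>sin \<theta> * \<tau> ^ k * \<sigma>\<close> in \<open>\<theta>\<close> and of
    \<open>\<tau> ^ k * c'\<close> in \<open>\<phi>\<close>; the first primitive vanishes at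
    \<open>0\<close> and \<open>pi\<close>, the second is periodic.\<close>
  define c c' where "c \<phi> = a $ 1 * cos \<phi> + a $ 2 * sin \<phi>"
    and "c' \<phi> = - a $ 1 * sin \<phi> + a $ 2 * cos \<phi>" for \<phi>
  define \<tau> \<sigma> where "\<tau> \<theta> \<phi> = sin \<theta> * c \<phi> + cos \<theta> * a $ 3"
    and "\<sigma> \<theta> \<phi> = cos \<theta> * c \<phi> - sin \<theta> * a $ 3" for \<theta> \<phi>
  define A where "A \<theta> \<phi> = cos \<theta> * \<tau> \<theta> \<phi> ^ k * \<sigma> \<theta> \<phi>
    + sin \<theta> * (real k * \<tau> \<theta> \<phi> ^ (k - 1) * \<sigma> \<theta> \<phi>) * \<sigma> \<theta> \<phi> - sin \<theta> * \<tau> \<theta> \<phi> ^ k * \<tau> \<theta> \<phi>" for \<theta> \<phi>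
  define B where "B \<theta> \<phi> = real k * \<tau> \<theta> \<phi> ^ (k - 1) * (sin \<theta> * c' \<phi>) * c' \<phi> - \<tau> \<theta> \<phi> ^ k * c \<phi>" for \<theta> \<phi>
  have dc: "(c has_real_derivative c' \<phi>) (at \<phi>)" "(c' has_real_derivative - c \<phi>) (at \<phi>)" for \<phi>
    unfolding c_def c'_def by (auto intro!: derivative_eq_intros simp: algebra_simps)
  have d\<theta>: "((\<lambda>\<theta>. \<tau> \<theta> \<phi>) has_real_derivative \<sigma> \<theta> \<phi>) (at \<theta>)"
    "((\<lambda>\<theta>. \<sigma> \<theta> \<phi>) has_real_derivative - \<tau> \<theta> \<phi>) (at \<theta>)" for \<theta> \<phi>
    unfolding \<tau>_def \<sigma>_def by (auto intro!: derivative_eq_intros simp: algebra_simps)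
  have d\<phi>: "((\<lambda>\<phi>. \<tau> \<theta> \<phi>) has_real_derivative sin \<theta> * c' \<phi>) (at \<phi>)" for \<theta> \<phi>
    unfolding \<tau>_def by (auto intro!: derivative_eq_intros dc simp: algebra_simps)
  have dA: "((\<lambda>\<theta>. sin \<theta> * \<tau> \<theta> \<phi> ^ k * \<sigma> \<theta> \<phi>) has_real_derivative A \<theta> \<phi>) (at \<theta>)" for \<theta> \<phi>
    unfolding A_def by (auto intro!: derivative_eq_intros d\<theta> simp: algebra_simps)
  have dB: "((\<lambda>\<phi>. \<tau> \<theta> \<phi> ^ k * c' \<phi>) has_real_derivative B \<theta> \<phi>) (at \<phi>)" for \<theta> \<phi>
    unfolding B_def by (auto intro!: derivative_eq_intros d\<phi> dc simp: algebra_simps)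
  have iA: "integral {0..pi} (\<lambda>\<theta>. A \<theta> \<phi>) = 0" for \<phi>
  proof -
    have "((\<lambda>\<theta>. A \<theta> \<phi>) has_integral (sin pi * \<tau> pi \<phi> ^ k * \<sigma> pi \<phi> - sin 0 * \<tau> 0 \<phi> ^ k * \<sigma> 0 \<phi>)) {0..pi}"
      by (rule fundamental_theorem_of_calculus)
        (auto intro: DERIV_subset[OF dA] simp: has_real_derivative_iff_has_vector_derivative[symmetric])
    then show ?thesis by (simp add: integral_unique)
  qed
  have iB: "integral {0..2 * pi} (B \<theta>) = 0" for \<theta>
  proof -
    have "(B \<theta> has_integral (\<tau> \<theta> (2 * pi) ^ k * c' (2 * pi) - \<tau> \<theta> 0 ^ k * c' 0)) {0..2 * pi}"
      by (rule fundamental_theorem_of_calculus)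
        (auto intro: DERIV_subset[OF dB] simp: has_real_derivative_iff_has_vector_derivative[symmetric])
    then show ?thesis by (simp add: integral_unique \<tau>_def c_def c'_def)
  qed
  have cA: "continuous_on S (\<lambda>(\<theta>, \<phi>). A \<theta> \<phi>)" for S
    unfolding A_def \<tau>_def \<sigma>_def c_def by (auto simp: case_prod_beta intro!: continuous_intros)
  have cB: "continuous_on S (\<lambda>(\<theta>, \<phi>). B \<theta> \<phi>)" for S
    unfolding B_def \<tau>_def c_def c'_def by (auto simp: case_prod_beta intro!: continuous_intros)
  have IA: "integral (cbox (0, 0) (pi, 2 * pi)) (\<lambda>(\<theta>, \<phi>). A \<theta> \<phi>) = 0"
    by (subst integral_prod_continuous[OF cA], simp only: prod.case,
      subst integral_swap_continuous[OF cA]) (simp add: iA)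
  have IB: "integral (cbox (0, 0) (pi, 2 * pi)) (\<lambda>(\<theta>, \<phi>). B \<theta> \<phi>) = 0"
    by (subst integral_prod_continuous[OF cB], simp only: prod.case) (simp add: iB)
  have c2: "c \<phi> ^ 2 + c' \<phi> ^ 2 = a $ 1 ^ 2 + a $ 2 ^ 2" for \<phi>
  proof -
    have "c \<phi> ^ 2 + c' \<phi> ^ 2 = (a $ 1 ^ 2 + a $ 2 ^ 2) * ((sin \<phi>)\<^sup>2 + (cos \<phi>)\<^sup>2)"
      unfolding c_def c'_def by (simp only: power2_eq_square) algebra
    then show ?thesis by simp
  qed
  \<comment> \<open>The squared length of the gradient of \<open>x \<bullet> a\<close> is
    \<open>\<sigma>\<^sup>2 + c'\<^sup>2\<close>, and on the sphere it must be
    \<open>1 - (x \<bullet> a)\<^sup>2\<close>.\<close>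
  have ts: "\<tau> \<theta> \<phi> ^ 2 + \<sigma> \<theta> \<phi> ^ 2 + c' \<phi> ^ 2 = 1" for \<theta> \<phi>
  proof -
    have "\<tau> \<theta> \<phi> ^ 2 + \<sigma> \<theta> \<phi> ^ 2 = (c \<phi> ^ 2 + a $ 3 ^ 2) * ((sin \<theta>)\<^sup>2 + (cos \<theta>)\<^sup>2)"
      unfolding \<tau>_def \<sigma>_def by (simp only: power2_eq_square) algebra
    then show ?thesis using c2[of \<phi>] a by (simp add: in_S2_nth)
  qed
  have st: "cos \<theta> * \<sigma> \<theta> \<phi> - c \<phi> = - sin \<theta> * \<tau> \<theta> \<phi>" for \<theta> \<phi>
  proof -
    have "cos \<theta> * \<sigma> \<theta> \<phi> - c \<phi> + sin \<theta> * \<tau> \<theta> \<phi> = c \<phi> * ((sin \<theta>)\<^sup>2 + (cos \<theta>)\<^sup>2 - 1)"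
      unfolding \<tau>_def \<sigma>_def by (simp only: power2_eq_square) algebra
    then show ?thesis by simp
  qed
  have AB: "A \<theta> \<phi> + B \<theta> \<phi> = sin \<theta> * (real k * \<tau> \<theta> \<phi> ^ (k - 1) - real (k + 2) * \<tau> \<theta> \<phi> ^ (k + 1))" for \<theta> \<phi>
  proof -
    have "A \<theta> \<phi> + B \<theta> \<phi> = \<tau> \<theta> \<phi> ^ k * (cos \<theta> * \<sigma> \<theta> \<phi> - c \<phi>) - sin \<theta> * \<tau> \<theta> \<phi> ^ k * \<tau> \<theta> \<phi>
      + sin \<theta> * real k * \<tau> \<theta> \<phi> ^ (k - 1) * (\<sigma> \<theta> \<phi> ^ 2 + c' \<phi> ^ 2)"
      unfolding A_def B_def power2_eq_square by (simp add: algebra_simps)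
    also have "\<sigma> \<theta> \<phi> ^ 2 + c' \<phi> ^ 2 = 1 - \<tau> \<theta> \<phi> ^ 2" using ts[of \<theta> \<phi>] by simp
    also have "sin \<theta> * real k * \<tau> \<theta> \<phi> ^ (k - 1) * (1 - \<tau> \<theta> \<phi> ^ 2)
      = sin \<theta> * real k * (\<tau> \<theta> \<phi> ^ (k - 1) - \<tau> \<theta> \<phi> ^ (k + 1))"
      by (cases k) (simp_all add: algebra_simps power2_eq_square)
    finally show ?thesis unfolding st by (simp add: algebra_simps)
  qed
  have \<tau>: "sph_coord (\<theta>, \<phi>) \<bullet> a = \<tau> \<theta> \<phi>" for \<theta> \<phi>
    by (simp add: inner_vec_def sum_3 sph_coord_nth \<tau>_def c_def algebra_simps)
  have cint: "integrable dV (\<lambda>x. (x \<bullet> a) ^ j)" for j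
  proof (rule dV.integrable_const_bound[where B = 1])
    show "AE x in dV. norm ((x \<bullet> a) ^ j) \<le> 1"
      using inner_S2_le[OF _ a] by (intro AE_I2) (auto simp: power_abs intro!: power_le_one)
  qed simp
  have "real k * (\<integral>x. (x \<bullet> a) ^ (k - 1) \<partial>dV) - real (k + 2) * (\<integral>x. (x \<bullet> a) ^ (k + 1) \<partial>dV)
     = (\<integral>x. real k * (x \<bullet> a) ^ (k - 1) - real (k + 2) * (x \<bullet> a) ^ (k + 1) \<partial>dV)"
    by (subst Bochner_Integration.integral_diff) (intro integrable_mult_right cint | simp)+
  also have "\<dots> = integral (cbox (0, 0) (pi, 2 * pi)) (\<lambda>p. (case p of (\<theta>, \<phi>) \<Rightarrow> A \<theta> \<phi>) + (case p of (\<theta>, \<phi>) \<Rightarrow> B \<theta> \<phi>))"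
    by (subst integral_dV_continuous)
      (auto intro!: continuous_intros integral_cong simp: \<tau> AB simp del: of_nat_add)
  also have "\<dots> = 0"
    by (subst integral_add) (auto intro!: integrable_continuous cA cB simp: IA IB)
  finally show ?thesis by simp
qed

text \<open>The value is \<open>2 * pi\<close> times the integral of \<open>t ^ k\<close> over
  \<open>[-1, 1]\<close>. The recursion climbs in steps of two, from the area for
  \<open>k = 0\<close> and, for \<open>k = 1\<close>, from its instance with vanishing left-hand
  side.\<close>

lemma dV_moment:
  assumes a: "a \<in> S2"
  shows "(\<integral>x. (x \<bullet> a) ^ k \<partial>dV) = 2 * pi * (1 - (- 1) ^ (k + 1)) / (k + 1)"
proof (induction k rule: less_induct)
  case (less k)
  consider "k = 0" | "k = 1" | j where "k = j + 2"
    by (metis One_nat_def add_2_eq_Suc' not0_implies_Suc)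
  then show ?case
  proof cases
    case 1
    then show ?thesis by (simp add: measure_dV)
  next
    case 2
    then show ?thesis using dV_moment_rec[OF a, of 0] by simp
  next
    case 3
    have "real (j + 3) * (\<integral>x. (x \<bullet> a) ^ k \<partial>dV) = real (j + 1) * (\<integral>x. (x \<bullet> a) ^ j \<partial>dV)"
      using dV_moment_rec[OF a, of "j + 1"] by (simp add: 3)
    also have "(\<integral>x. (x \<bullet> a) ^ j \<partial>dV) = 2 * pi * (1 - (- 1) ^ (j + 1)) / (j + 1)"
      by (rule less) (simp add: 3)
    finally have "real (j + 3) * (\<integral>x. (x \<bullet> a) ^ k \<partial>dV) = 2 * pi * (1 - (- 1) ^ (j + 1))"
      by (simp del: of_nat_add)
    then show ?thesis by (simp add: 3 eq_divide_eq algebra_simps)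
  qed
qed


text \<open>Archimedes' hat-box theorem for an arbitrary axis. The coordinates are adapted only to
  the polar axis; instead of rotating them, the proof compares moments with those of the uniform
  density and passes to continuous functions by Weierstrass approximation.\<close>

lemma dV_inner:
  assumes a: "a \<in> S2"
  shows "distr dV borel (\<lambda>x. x \<bullet> a) = density lborel (\<lambda>t. ennreal (2 * pi * indicator {-1..1} t))"
    (is "?M = ?N")
proof (rule measure_eqI_continuous)
  show "finite_measure ?M" by (intro dV.finite_measure_distr) simp
  have N: "emeasure ?N UNIV = 4 * pi"
    by (simp add: emeasure_density ennreal_mult' ennreal_indicator nn_integral_cmult)
      (simp flip: ennreal_mult' ennreal_numeral)
  then show "finite_measure ?N" by (intro finite_measureI) simp
  fix \<eta> :: "real \<Rightarrow> real"
  assume c: "continuous_on UNIV \<eta>" and b: "\<And>x. 0 \<le> \<eta> x \<and> \<eta> x \<le> 1"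
  have m[measurable]: "\<eta> \<in> borel_measurable borel" by (rule borel_measurable_continuous_onI[OF c])
  have inner: "x \<bullet> a \<in> {-1..1}" if "x \<in> S2" for x
    using inner_S2_le[OF that a] by auto
  have li: "integrable lborel (\<lambda>t. f t * indicator {-1..1} t)" if "continuous_on UNIV f" for f :: "real \<Rightarrow> real"
    using borel_integrable_compact[OF compact_Icc continuous_on_subset[OF that subset_UNIV], of "-1" 1]
    by (simp add: mult.commute)
  have vi: "integrable dV (\<lambda>x. f (x \<bullet> a))" if "continuous_on UNIV f" for f :: "real \<Rightarrow> real"
  proof -
    have "bounded (f ` {-1..1})"
      using that by (intro compact_imp_bounded compact_continuous_image) (auto intro: continuous_on_subset)
    then obtain B where "\<forall>t\<in>{-1..1}. \<bar>f t\<bar> \<le> B" unfolding bounded_iff by auto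
    then show ?thesis
      using inner borel_measurable_continuous_onI[OF that]
      by (intro dV.integrable_const_bound[where B = B]) (auto intro!: AE_I2 simp del: atLeastAtMost_iff)
  qed
  define L where "L f = (\<integral>t. f t * indicator {-1..1} t \<partial>lborel)" for f :: "real \<Rightarrow> real"
  have poly: "(\<integral>x. (\<Sum>i\<le>n. w i * (x \<bullet> a) ^ i) \<partial>dV) = 2 * pi * L (\<lambda>t. \<Sum>i\<le>n. w i * t ^ i)" for w :: "nat \<Rightarrow> real" and n
  proof -
    have "(\<integral>x. (\<Sum>i\<le>n. w i * (x \<bullet> a) ^ i) \<partial>dV) = (\<Sum>i\<le>n. w i * (\<integral>x. (x \<bullet> a) ^ i \<partial>dV))"
      by (subst Bochner_Integration.integral_sum) (auto intro!: vi continuous_intros integrable_mult_right)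
    also have "\<dots> = (\<Sum>i\<le>n. 2 * pi * (w i * (\<integral>t. t ^ i * indicator {-1..1} t \<partial>lborel)))"
      by (intro sum.cong refl, subst integral_power) (simp_all add: dV_moment[OF a])
    also have "\<dots> = 2 * pi * L (\<lambda>t. \<Sum>i\<le>n. w i * t ^ i)"
      unfolding L_def sum_distrib_right sum_distrib_left[symmetric]
      by (subst Bochner_Integration.integral_sum)
        (auto simp: mult.assoc intro!: integrable_mult_right li continuous_intros)
    finally show ?thesis .
  qed
  have "\<bar>(\<integral>x. \<eta> (x \<bullet> a) \<partial>dV) - 2 * pi * L \<eta>\<bar> \<le> e" if e: "e > 0" for e
  proof -
    \<comment> \<open>Both measures have mass \<open>4 * pi\<close>, so an approximation within
      \<open>d\<close> costs \<open>e / 2\<close> on each side.\<close>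
    define d where "d = e / (8 * pi)"
    have d: "d > 0" using e by (simp add: d_def)
    obtain g where g: "real_polynomial_function g" "\<And>t. t \<in> {-1..1} \<Longrightarrow> \<bar>\<eta> t - g t\<bar> < d"
      using Stone_Weierstrass_real_polynomial_function[OF compact_Icc continuous_on_subset[OF c subset_UNIV] d]
      by metis
    obtain w n where gw: "g = (\<lambda>t. \<Sum>i\<le>n. w i * t ^ i)"
      using g(1) unfolding real_polynomial_function_iff_sum by blast
    have gc: "continuous_on UNIV g" unfolding gw by (intro continuous_intros)
    have "\<bar>(\<integral>x. \<eta> (x \<bullet> a) \<partial>dV) - (\<integral>x. g (x \<bullet> a) \<partial>dV)\<bar> = \<bar>\<integral>x. \<eta> (x \<bullet> a) - g (x \<bullet> a) \<partial>dV\<bar>"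
      using vi[OF c] vi[OF gc] by simp
    also have "\<dots> \<le> (\<integral>x. \<bar>\<eta> (x \<bullet> a) - g (x \<bullet> a)\<bar> \<partial>dV)" by (rule integral_abs_bound)
    also have "\<dots> \<le> (\<integral>x. d \<partial>dV)"
      using vi[OF c] vi[OF gc] g(2)[OF inner] by (intro integral_mono) (auto intro: less_imp_le)
    also have "\<dots> = e / 2" by (simp add: measure_dV d_def)
    finally have 1: "\<bar>(\<integral>x. \<eta> (x \<bullet> a) \<partial>dV) - 2 * pi * L g\<bar> \<le> e / 2"
      using poly[of w n] by (simp add: gw)
    have "\<bar>L \<eta> - L g\<bar> = \<bar>\<integral>t. \<eta> t * indicator {-1..1} t - g t * indicator {-1..1} t \<partial>lborel\<bar>"
      unfolding L_def using li[OF c] li[OF gc] by simp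
    also have "\<dots> \<le> (\<integral>t. \<bar>\<eta> t * indicator {-1..1} t - g t * indicator {-1..1} t\<bar> \<partial>lborel)"
      by (rule integral_abs_bound)
    also have "\<dots> \<le> (\<integral>t. d * indicator {-1..1::real} t \<partial>lborel)"
    proof (rule Bochner_Integration.integral_mono)
      show "integrable lborel (\<lambda>t. d * indicator {-1..1::real} t)" by (rule li) simp
      show "integrable lborel (\<lambda>t::real. \<bar>\<eta> t * indicator {-1..1} t - g t * indicator {-1..1} t\<bar>)"
        using li[OF c] li[OF gc] by simp
      show "\<bar>\<eta> t * indicator {-1..1} t - g t * indicator {-1..1} t\<bar> \<le> d * indicator {-1..1} t" for t
        using g(2)[of t] by (auto simp: indicator_def)
    qed
    also have "\<dots> = d * 2" by simp
    finally have "2 * pi * \<bar>L \<eta> - L g\<bar> \<le> 2 * pi * (d * 2)" by (intro mult_left_mono) auto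
    also have "\<dots> = e / 2" by (simp add: d_def)
    finally have "\<bar>2 * pi * L \<eta> - 2 * pi * L g\<bar> \<le> e / 2"
      by (simp add: abs_mult flip: right_diff_distrib)
    then show ?thesis using 1 by linarith
  qed
  then have "(\<integral>x. \<eta> (x \<bullet> a) \<partial>dV) = 2 * pi * L \<eta>"
    by (metis abs_le_zero_iff eq_iff_diff_eq_0 field_le_epsilon add_0)
  moreover have "(\<integral>t. \<eta> t \<partial>?M) = (\<integral>x. \<eta> (x \<bullet> a) \<partial>dV)"
    by (rule integral_distr) simp_all
  moreover have "(\<integral>t. \<eta> t \<partial>?N) = 2 * pi * L \<eta>"
    unfolding L_def by (subst integral_density) (auto simp: ac_simps simp flip: Bochner_Integration.integral_mult_right_zero)
  ultimately show "(\<integral>t. \<eta> t \<partial>?M) = (\<integral>t. \<eta> t \<partial>?N)" by simp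
qed simp_all

lemma nn_integral_dV_inner:
  assumes a: "a \<in> S2" and [measurable]: "f \<in> borel_measurable borel"
  shows "(\<integral>\<^sup>+x. f (x \<bullet> a) \<partial>dV) = (\<integral>\<^sup>+t. ennreal (2 * pi) * (f t * indicator {-1..1} t) \<partial>lborel)"
proof -
  have "(\<integral>\<^sup>+x. f (x \<bullet> a) \<partial>dV) = (\<integral>\<^sup>+t. f t \<partial>distr dV borel (\<lambda>x. x \<bullet> a))"
    by (subst nn_integral_distr) auto
  also have "\<dots> = (\<integral>\<^sup>+t. ennreal (2 * pi * indicator {-1..1} t) * f t \<partial>lborel)"
    unfolding dV_inner[OF a] by (subst nn_integral_density) auto
  also have "\<dots> = (\<integral>\<^sup>+t. ennreal (2 * pi) * (f t * indicator {-1..1} t) \<partial>lborel)"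
    by (intro nn_integral_cong) (simp add: indicator_def)
  finally show ?thesis .
qed

section \<open>Height coordinates and the conformal flow\<close>

lemma measurable_sph_coord_arccos:
  assumes "F \<in> borel_measurable dV"
  shows "(\<lambda>w. F (sph_coord (arccos (- w), \<phi>)) * indicator {-1..1} w :: ennreal) \<in> borel_measurable borel"
proof -
  have "(\<lambda>w. if w \<in> {-1..1} then F (sph_coord (arccos (- w), \<phi>)) else 0) \<in> borel_measurable borel"
  proof (subst measurable_If_restrict_space_iff)
    have "continuous_on {-1..1} (\<lambda>w. sph_coord (arccos (- w), \<phi>))"
      by (intro continuous_on_compose2[OF continuous_sph_coord] continuous_intros) auto
    then have "(\<lambda>w. sph_coord (arccos (- w), \<phi>)) \<in> restrict_space borel {-1..1} \<rightarrow>\<^sub>M dV"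
      unfolding measurable_cong_sets[OF refl sets_dV]
      by (intro measurable_restrict_space2 borel_measurable_continuous_on_restrict) (auto simp: sph_coord_S2)
    from measurable_compose[OF this assms]
    show "(\<lambda>w. F (sph_coord (arccos (- w), \<phi>))) \<in> borel_measurable (restrict_space borel {w. w \<in> {-1..1}}) \<and>
        (\<lambda>w. 0 :: ennreal) \<in> borel_measurable (restrict_space borel {w. w \<notin> {-1..1}})"
      by (simp only: Collect_mem_eq) simp
  qed simp
  then show ?thesis by (rule back_subst[of "\<lambda>f. f \<in> borel_measurable borel"]) (auto simp: indicator_def)
qed

text \<open>The substitution \<open>w = - cos \<theta>\<close> absorbs the density
  \<open>sin \<theta>\<close>; the sign makes \<open>w\<close> increasing in
  \<open>\<theta>\<close>, as the substitution rule requires. Hence \<open>w\<close> is minus the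
  height.\<close>

lemma nn_integral_dV_height:
  assumes F[measurable]: "F \<in> borel_measurable dV"
  shows "(\<integral>\<^sup>+x. F x \<partial>dV) = (\<integral>\<^sup>+\<phi>. (\<integral>\<^sup>+w. F (sph_coord (arccos (- w), \<phi>)) * indicator {-1..1} w \<partial>lborel)
    * indicator {0<..<2 * pi} \<phi> \<partial>lborel)"
proof -
  have "(\<integral>\<^sup>+\<theta>. ennreal (sin \<theta>) * F (sph_coord (\<theta>, \<phi>)) * indicator {0..pi} \<theta> \<partial>lborel)
     = (\<integral>\<^sup>+w. F (sph_coord (arccos (- w), \<phi>)) * indicator {-1..1} w \<partial>lborel)" for \<phi>
  proof -
    have "(\<integral>\<^sup>+w. (F (sph_coord (arccos (- w), \<phi>)) * indicator {-1..1} w) * indicator {- cos 0..- cos pi} w \<partial>lborel)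
      = (\<integral>\<^sup>+\<theta>. (F (sph_coord (arccos (- (- cos \<theta>)), \<phi>)) * indicator {-1..1} (- cos \<theta>)) * ennreal (sin \<theta>) * indicator {0..pi} \<theta> \<partial>lborel)"
      by (rule nn_integral_substitution_aux[OF measurable_sph_coord_arccos[OF F]])
        (auto intro!: derivative_eq_intros continuous_intros sin_ge_zero)
    also have "\<dots> = (\<integral>\<^sup>+\<theta>. ennreal (sin \<theta>) * F (sph_coord (\<theta>, \<phi>)) * indicator {0..pi} \<theta> \<partial>lborel)"
      by (intro nn_integral_cong) (auto simp: indicator_def arccos_cos mult.commute)
    finally show ?thesis by (simp add: mult.assoc flip: indicator_inter_arith)
  qed
  then show ?thesis unfolding nn_integral_dV[OF F] by simp
qed

text \<open>The flow of the conformal field \<open>grad x\<^sub>3\<close>, with parameter \<open>T = tanh s\<close>.\<close>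

definition mobius :: "real \<Rightarrow> real ^ 3 \<Rightarrow> real ^ 3" where
  "mobius T x = (1 / (1 + T * x $ 3)) *\<^sub>R
     (sqrt (1 - T\<^sup>2) *\<^sub>R x + ((1 - sqrt (1 - T\<^sup>2)) * x $ 3 + T) *\<^sub>R axis 3 1)"

lemma mobius_nth:
  "mobius T x $ 1 = sqrt (1 - T\<^sup>2) * x $ 1 / (1 + T * x $ 3)"
  "mobius T x $ 2 = sqrt (1 - T\<^sup>2) * x $ 2 / (1 + T * x $ 3)"
  "mobius T x $ 3 = (x $ 3 + T) / (1 + T * x $ 3)"
  by (simp_all add: mobius_def axis_def algebra_simps add_divide_distrib)

lemma S2_height: "x \<in> S2 \<Longrightarrow> \<bar>x $ 3\<bar> \<le> 1"
  using component_le_norm_cart[of x 3] by (simp add: S2_def)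

lemma mobius_denom_pos: "x \<in> S2 \<Longrightarrow> \<bar>T\<bar> < 1 \<Longrightarrow> 1 + T * x $ 3 > 0"
proof -
  assume x: "x \<in> S2" and T: "\<bar>T\<bar> < 1"
  have "\<bar>T * x $ 3\<bar> \<le> \<bar>T\<bar> * 1"
    unfolding abs_mult using S2_height[OF x] by (intro mult_left_mono) auto
  then show ?thesis using T by linarith
qed

lemma mobius_S2:
  assumes x: "x \<in> S2" and T: "\<bar>T\<bar> < 1"
  shows "mobius T x \<in> S2"
proof -
  define d where "d = 1 + T * x $ 3"
  have d: "d > 0" using mobius_denom_pos[OF x T] by (simp add: d_def)
  have k: "(sqrt (1 - T\<^sup>2))\<^sup>2 = 1 - T\<^sup>2" using T by (simp add: abs_square_less_1 less_imp_le)
  have x2: "(x $ 1)\<^sup>2 + (x $ 2)\<^sup>2 = 1 - (x $ 3)\<^sup>2" using x by (simp add: in_S2_nth)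
  have "(mobius T x $ 1)\<^sup>2 + (mobius T x $ 2)\<^sup>2 + (mobius T x $ 3)\<^sup>2
    = ((1 - T\<^sup>2) * ((x $ 1)\<^sup>2 + (x $ 2)\<^sup>2) + (x $ 3 + T)\<^sup>2) / d\<^sup>2"
    unfolding mobius_nth d_def[symmetric] by (simp only: power_divide power_mult_distrib k add_divide_distrib[symmetric] distrib_left)
  also have "(1 - T\<^sup>2) * ((x $ 1)\<^sup>2 + (x $ 2)\<^sup>2) + (x $ 3 + T)\<^sup>2 = d\<^sup>2"
    unfolding x2 d_def by (simp add: power2_eq_square algebra_simps)
  finally show ?thesis using d by (simp add: in_S2_nth)
qed

lemma measurable_mobius [measurable]: "mobius T \<in> borel_measurable borel"
  unfolding mobius_def by measurable

lemma measurable_mobius_dV: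
  assumes "\<bar>T\<bar> < 1"
  shows "mobius T \<in> dV \<rightarrow>\<^sub>M dV"
  unfolding measurable_cong_sets[OF refl sets_dV]
  by (rule measurable_restrict_space2) (use mobius_S2[OF _ assms] in auto)

text \<open>The flow keeps the longitude and moves \<open>w = - x $ 3\<close> by a fractional linear
  map of the interval, which reduces its change of variables to one dimension.\<close>

lemma sph_coord_mobius:
  assumes T: "\<bar>T\<bar> < 1" and w: "w \<in> {-1..1}"
  shows "sph_coord (arccos (- ((w - T) / (1 - T * w))), \<phi>) = mobius T (sph_coord (arccos (- w), \<phi>))"
proof -
  let ?d = "1 - T * w" and ?v = "(w - T) / (1 - T * w)"
  have "\<bar>T * w\<bar> \<le> \<bar>T\<bar> * 1" unfolding abs_mult using w by (intro mult_left_mono) auto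
  then have d: "?d > 0" using T by linarith
  have T2: "T\<^sup>2 \<le> 1" using T by (simp add: abs_square_less_1 less_imp_le)
  have w2: "w\<^sup>2 \<le> 1" using w by (simp add: abs_square_le_1 abs_le_iff)
  have *: "1 - ?v\<^sup>2 = (1 - T\<^sup>2) * (1 - w\<^sup>2) / ?d\<^sup>2"
    using d by (simp add: power_divide field_simps) (simp add: power2_eq_square algebra_simps)
  have "1 - ?v\<^sup>2 \<ge> 0" unfolding * using T2 w2 by (intro divide_nonneg_nonneg mult_nonneg_nonneg) auto
  then have v: "\<bar>?v\<bar> \<le> 1" by (simp add: abs_square_le_1)
  have s: "sin (arccos (- ?v)) = sqrt (1 - T\<^sup>2) * sin (arccos (- w)) / ?d"
    using v w d by (simp add: sin_arccos_abs abs_le_iff * real_sqrt_divide real_sqrt_mult)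
  have c: "cos (arccos (- ?v)) = - ?v" "cos (arccos (- w)) = - w"
    using v w by (simp_all add: cos_arccos_abs abs_le_iff)
  show ?thesis
    unfolding vec_eq_iff forall_3 mobius_nth sph_coord_nth s c using d
    by (simp add: field_simps)
qed

text \<open>The weight is the Jacobian of the flow, the square of the conformal factor
  \<open>sqrt (1 - T\<^sup>2) / (1 + T * x $ 3)\<close>. In height coordinates it is the derivative
  of the map of \<open>w\<close>, so a substitution on each meridian suffices.\<close>

lemma nn_integral_mobius:
  assumes F[measurable]: "F \<in> borel_measurable dV" and T: "\<bar>T\<bar> < 1"
  shows "(\<integral>\<^sup>+x. F (mobius T x) * ennreal ((1 - T\<^sup>2) / (1 + T * x $ 3)\<^sup>2) \<partial>dV) = (\<integral>\<^sup>+x. F x \<partial>dV)"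
proof -
  have [measurable]: "(\<lambda>x. F (mobius T x)) \<in> borel_measurable dV"
    by (rule measurable_compose[OF measurable_mobius_dV[OF T] F])
  have pos: "1 - T * w > 0" if "w \<in> {-1..1}" for w
  proof -
    have "\<bar>T * w\<bar> \<le> \<bar>T\<bar> * 1" unfolding abs_mult using that by (intro mult_left_mono) auto
    then show ?thesis using T by linarith
  qed
  have T2: "T\<^sup>2 \<le> 1" using T by (simp add: abs_square_less_1 less_imp_le)
  have "(\<integral>\<^sup>+w. F (sph_coord (arccos (- w), \<phi>)) * indicator {-1..1} w \<partial>lborel)
     = (\<integral>\<^sup>+w. F (mobius T (sph_coord (arccos (- w), \<phi>))) *
         ennreal ((1 - T\<^sup>2) / (1 + T * sph_coord (arccos (- w), \<phi>) $ 3)\<^sup>2) * indicator {-1..1} w \<partial>lborel)" for \<phi>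
  proof -
    let ?g = "\<lambda>w. (w - T) / (1 - T * w)"
    have e: "?g (-1) = -1" "?g 1 = 1" using T by (auto simp: field_simps)
    have "(\<integral>\<^sup>+w. (F (sph_coord (arccos (- w), \<phi>)) * indicator {-1..1} w) * indicator {?g (-1)..?g 1} w \<partial>lborel)
      = (\<integral>\<^sup>+w. (F (sph_coord (arccos (- ?g w), \<phi>)) * indicator {-1..1} (?g w)) * ennreal ((1 - T\<^sup>2) / (1 - T * w)\<^sup>2) * indicator {-1..1} w \<partial>lborel)"
    proof (rule nn_integral_substitution_aux[OF measurable_sph_coord_arccos[OF F]])
      fix w :: real assume "w \<in> {-1..1}"
      from pos[OF this] show "(?g has_real_derivative (1 - T\<^sup>2) / (1 - T * w)\<^sup>2) (at w)"
        by (auto intro!: derivative_eq_intros simp: power2_eq_square algebra_simps)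
    next
      show "continuous_on {-1..1} (\<lambda>w. (1 - T\<^sup>2) / (1 - T * w)\<^sup>2)"
        using pos by (auto intro!: continuous_intros simp: less_imp_neq[symmetric])
    qed (use T2 in auto)
    also have "\<dots> = (\<integral>\<^sup>+w. F (mobius T (sph_coord (arccos (- w), \<phi>))) *
         ennreal ((1 - T\<^sup>2) / (1 + T * sph_coord (arccos (- w), \<phi>) $ 3)\<^sup>2) * indicator {-1..1} w \<partial>lborel)"
    proof (intro nn_integral_cong)
      fix w :: real
      show "(F (sph_coord (arccos (- ?g w), \<phi>)) * indicator {-1..1} (?g w)) * ennreal ((1 - T\<^sup>2) / (1 - T * w)\<^sup>2) * indicator {-1..1} w
        = F (mobius T (sph_coord (arccos (- w), \<phi>))) *
         ennreal ((1 - T\<^sup>2) / (1 + T * sph_coord (arccos (- w), \<phi>) $ 3)\<^sup>2) * indicator {-1..1} w"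
      proof (cases "w \<in> {-1..1}")
        case True
        then have "cos (arccos (- w)) = - w" by simp
        moreover have "?g w \<in> {-1..1}"
        proof -
          have "(1 - T) * (1 + w) \<ge> 0" "(1 + T) * (1 - w) \<ge> 0" using T True by auto
          then show ?thesis using pos[OF True] by (auto simp: field_simps)
        qed
        ultimately show ?thesis unfolding sph_coord_mobius[OF T True] sph_coord_nth by simp
      qed simp
    qed
    finally show ?thesis unfolding e by (simp add: mult.assoc flip: indicator_inter_arith)
  qed
  then show ?thesis by (subst (1 2) nn_integral_dV_height) simp_all
qed

section \<open>Powers, logarithms and Poisson-type kernels of \<open>x \<bullet> a\<close>\<close>

lemma nn_integral_dV_powr:
  assumes a: "a \<in> S2" and p: "p > -1"
  shows "(\<integral>\<^sup>+x. ennreal ((1 - x \<bullet> a) powr p) \<partial>dV) = ennreal (2 * pi * (2 powr (p + 1) / (p + 1)))"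
proof -
  have "(\<integral>\<^sup>+t. ennreal ((1 - t) powr p) * indicator {-1..1} t \<partial>lborel)
    = (\<integral>\<^sup>+t. ennreal (t powr p) * indicator {0..2} t \<partial>lborel)"
    by (subst nn_integral_real_affine[where c = "-1" and t = 1])
      (auto intro!: nn_integral_cong simp: indicator_def)
  also have "\<dots> = ennreal (2 powr (p + 1) / (p + 1))"
    by (rule nn_integral_has_integral_lebesgue'[OF _ has_integral_powr_from_0[OF p]]) auto
  finally have *: "(\<integral>\<^sup>+t. ennreal ((1 - t) powr p) * indicator {-1..1} t \<partial>lborel) = ennreal (2 powr (p + 1) / (p + 1))" .
  have "(\<integral>\<^sup>+x. ennreal ((1 - x \<bullet> a) powr p) \<partial>dV)
      = ennreal (2 * pi) * (\<integral>\<^sup>+t. ennreal ((1 - t) powr p) * indicator {-1..1} t \<partial>lborel)"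
    by (subst nn_integral_dV_inner[OF a, of "\<lambda>t. ennreal ((1 - t) powr p)"]) (auto intro!: nn_integral_cmult)
  then show ?thesis unfolding * using p by (subst ennreal_mult) auto
qed

text \<open>\<open>4 * pi * poisson \<epsilon> t\<close> equals
  \<open>(1 - T\<^sup>2) / (1 + T * t)\<^sup>2\<close> for
  \<open>T = - 1 / (1 + \<epsilon>)\<close>, the Jacobian of a conformal flow along the axis. This
  explains the mass 1 and the concentration at \<open>t = 1\<close> as \<open>\<epsilon>\<close>
  tends to 0.\<close>

definition poisson :: "real \<Rightarrow> real \<Rightarrow> real" where
  "poisson \<epsilon> t = \<epsilon> * (2 + \<epsilon>) / (4 * pi) / (1 + \<epsilon> - t)\<^sup>2"

lemma nn_integral_poisson:
  assumes a: "a \<in> S2" and e: "\<epsilon> > 0"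
  shows "(\<integral>\<^sup>+x. ennreal (poisson \<epsilon> (x \<bullet> a)) \<partial>dV) = 1"
proof -
  let ?F = "\<lambda>t. \<epsilon> * (2 + \<epsilon>) / (4 * pi) / (1 + \<epsilon> - t)"
  have "(\<integral>\<^sup>+t. ennreal (poisson \<epsilon> t) * indicator {-1..1} t \<partial>lborel) = ennreal (?F 1 - ?F (-1))"
  proof (rule nn_integral_FTC_Icc)
    fix t :: real assume t: "t \<in> {-1..1}"
    then have "1 + \<epsilon> - t > 0" using e by simp
    then have "((\<lambda>t. c / (1 + \<epsilon> - t)) has_real_derivative c / (1 + \<epsilon> - t)\<^sup>2) (at t)" for c
      by (auto intro!: derivative_eq_intros simp: power2_eq_square)
    then show "(?F has_real_derivative poisson \<epsilon> t) (at t)" unfolding poisson_def .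
    show "0 \<le> poisson \<epsilon> t" unfolding poisson_def using e by simp
  qed (simp_all add: poisson_def)
  also have "?F 1 - ?F (-1) = 1 / (2 * pi)"
  proof -
    have "?F 1 = (2 + \<epsilon>) / (4 * pi)" "?F (-1) = \<epsilon> / (4 * pi)" using e by (simp_all add: divide_simps)
    then show ?thesis by (simp add: diff_divide_distrib[symmetric])
  qed
  finally have *: "(\<integral>\<^sup>+t. ennreal (poisson \<epsilon> t) * indicator {-1..1} t \<partial>lborel) = ennreal (1 / (2 * pi))" .
  have "(\<integral>\<^sup>+x. ennreal (poisson \<epsilon> (x \<bullet> a)) \<partial>dV)
      = ennreal (2 * pi) * (\<integral>\<^sup>+t. ennreal (poisson \<epsilon> t) * indicator {-1..1} t \<partial>lborel)"
    unfolding poisson_def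
    by (subst nn_integral_dV_inner[OF a, of "\<lambda>t. ennreal (\<epsilon> * (2 + \<epsilon>) / (4 * pi) / (1 + \<epsilon> - t)\<^sup>2)"])
      (auto intro!: nn_integral_cmult)
  also have "\<dots> = 1" unfolding * by (simp flip: ennreal_mult')
  finally show ?thesis .
qed


interpretation dVdV: pair_sigma_finite dV dV ..

text \<open>The uniform law of \<open>x \<bullet> a\<close> has no atom at 1. This keeps the
  conventional value \<open>ln 0 = 0\<close> out of the later identities between logarithms.\<close>

lemma AE_dV_inner_less:
  assumes a: "a \<in> S2"
  shows "AE x in dV. x \<bullet> a < 1"
proof -
  have "(\<integral>\<^sup>+x. indicator {1} (x \<bullet> a) \<partial>dV) = (\<integral>\<^sup>+t. ennreal (2 * pi) * (indicator {1} t * indicator {-1..1::real} t) \<partial>lborel)"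
    by (rule nn_integral_dV_inner[OF a]) simp
  also have "\<dots> = (\<integral>\<^sup>+t. ennreal (2 * pi) * indicator {1::real} t \<partial>lborel)"
    by (intro nn_integral_cong) (auto simp: indicator_def)
  also have "\<dots> = 0" by (subst nn_integral_cmult) auto
  finally have "AE x in dV. indicator {1} (x \<bullet> a) = (0 :: ennreal)"
    by (subst (asm) nn_integral_0_iff_AE) auto
  moreover have "AE x in dV. x \<in> S2" by (rule AE_I2) simp
  ultimately show ?thesis
    by eventually_elim (use inner_S2_le[OF _ a] in \<open>force simp: indicator_def split: if_splits\<close>)
qed

text \<open>Tonelli with the inner integral over the variable on which \<open>f\<close> does not
  depend: a kernel bound uniform in the other variable is enough, even if the kernel is singular on
  the diagonal.\<close>

lemma kernel_integrable:
  fixes k :: "real \<Rightarrow> real"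
  assumes f: "integrable dV f" and k[measurable]: "k \<in> borel_measurable borel"
    and C: "\<And>x. x \<in> S2 \<Longrightarrow> (\<integral>\<^sup>+y. ennreal \<bar>k (y \<bullet> x)\<bar> \<partial>dV) \<le> ennreal C"
  shows "integrable (dV \<Otimes>\<^sub>M dV) (\<lambda>(x, y). f x * k (x \<bullet> y))"
proof (rule integrableI_bounded)
  have [measurable]: "f \<in> borel_measurable dV" using f by auto
  show m: "(\<lambda>(x, y). f x * k (x \<bullet> y)) \<in> borel_measurable (dV \<Otimes>\<^sub>M dV)" by measurable
  have "(\<integral>\<^sup>+p. ennreal (norm (case p of (x, y) \<Rightarrow> f x * k (x \<bullet> y))) \<partial>(dV \<Otimes>\<^sub>M dV))
     = (\<integral>\<^sup>+x. \<integral>\<^sup>+y. ennreal \<bar>f x\<bar> * ennreal \<bar>k (x \<bullet> y)\<bar> \<partial>dV \<partial>dV)"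
    by (subst dV.nn_integral_fst[symmetric]) (auto simp: abs_mult ennreal_mult)
  also have "\<dots> = (\<integral>\<^sup>+x. ennreal \<bar>f x\<bar> * (\<integral>\<^sup>+y. ennreal \<bar>k (y \<bullet> x)\<bar> \<partial>dV) \<partial>dV)"
    by (intro nn_integral_cong, subst nn_integral_cmult) (auto simp: inner_commute)
  also have "\<dots> \<le> (\<integral>\<^sup>+x. ennreal \<bar>f x\<bar> * ennreal C \<partial>dV)"
    by (intro nn_integral_mono mult_left_mono) (auto simp: C)
  also have "\<dots> = (\<integral>\<^sup>+x. ennreal \<bar>f x\<bar> \<partial>dV) * ennreal C" by (rule nn_integral_multc) simp
  also have "\<dots> < \<infinity>" using f unfolding integrable_iff_bounded
    by (auto simp: ennreal_mult_less_top)
  finally show "(\<integral>\<^sup>+p. ennreal (norm (case p of (x, y) \<Rightarrow> f x * k (x \<bullet> y))) \<partial>(dV \<Otimes>\<^sub>M dV)) < \<infinity>" .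
qed

text \<open>The power \<open>1/4\<close> is chosen for its square:
  \<open>(1 - x \<bullet> y) powr (- (1/2))\<close> is still integrable and will dominate the
  squared logarithm. At \<open>s = 0\<close> both sides are 0 by convention.\<close>

lemma abs_ln_le_powr:
  assumes "0 \<le> s" "s \<le> (2::real)"
  shows "\<bar>ln s\<bar> \<le> 4 * s powr (- (1/4))"
proof (cases "s \<le> 1")
  case True
  show ?thesis
  proof (cases "s = 0")
    case False
    then have s: "s > 0" using assms by simp
    have "4 * ln (s powr (- (1/4))) \<le> 4 * (s powr (- (1/4)) - 1)"
      using s by (intro mult_left_mono ln_le_minus_one) auto
    then show ?thesis using s True by (simp add: ln_powr)
  qed simp
next
  case False
  have "ln s \<le> s - 1" using False by (intro ln_le_minus_one) auto
  moreover have "1 / 2 \<le> s powr (- (1/4))"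
  proof -
    have "1 / 2 \<le> 1 / s" using False assms by (simp add: field_simps)
    also have "\<dots> = s powr (- 1)" using False by (simp add: powr_minus field_simps)
    also have "\<dots> \<le> s powr (- (1/4))" using False by (intro powr_mono) auto
    finally show ?thesis .
  qed
  moreover have "ln s \<ge> 0" using False by simp
  ultimately show ?thesis using assms by linarith
qed

lemma inner_S2_diff: "x \<in> S2 \<Longrightarrow> y \<in> S2 \<Longrightarrow> 0 \<le> 1 - x \<bullet> y \<and> 1 - x \<bullet> y \<le> 2"
  using inner_S2_le[of x y] by linarith

lemma nn_integral_abs_ln:
  assumes a: "a \<in> S2"
  shows "(\<integral>\<^sup>+x. ennreal \<bar>ln (1 - x \<bullet> a)\<bar> \<partial>dV) \<le> ennreal (32 * pi)"
proof -
  have "(\<integral>\<^sup>+x. ennreal \<bar>ln (1 - x \<bullet> a)\<bar> \<partial>dV) \<le> (\<integral>\<^sup>+x. ennreal 4 * ennreal ((1 - x \<bullet> a) powr (- (1/4))) \<partial>dV)"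
  proof (rule nn_integral_mono)
    fix x assume "x \<in> space dV"
    then show "ennreal \<bar>ln (1 - x \<bullet> a)\<bar> \<le> ennreal 4 * ennreal ((1 - x \<bullet> a) powr (- (1/4)))"
      using inner_S2_diff[OF _ a, of x] abs_ln_le_powr[of "1 - x \<bullet> a"]
      by (subst ennreal_mult[symmetric]) (auto intro: ennreal_leI)
  qed
  also have "\<dots> = ennreal 4 * ennreal (2 * pi * (2 powr (3/4) / (3/4)))"
    by (subst nn_integral_cmult) (auto simp: nn_integral_dV_powr[OF a])
  also have "\<dots> = ennreal (4 * (2 * pi * (2 powr (3/4) / (3/4))))" by (rule ennreal_mult[symmetric]) auto
  also have "\<dots> \<le> ennreal (32 * pi)"
  proof (rule ennreal_leI)
    have "(2::real) powr (3/4) \<le> 2 powr 1" by (intro powr_mono) auto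
    then show "4 * (2 * pi * (2 powr (3/4) / (3/4))) \<le> 32 * pi" by (simp add: field_simps)
  qed
  finally show ?thesis .
qed

text \<open>The positive and negative parts of \<open>H\<close>, taken as densities, are finite
  measures with equal integrals of continuous functions, hence equal by
  \<open>measure_eqI_continuous\<close>.\<close>

lemma AE_dV_eq_zero:
  assumes H: "integrable dV H"
    and z: "\<And>\<eta>. continuous_on UNIV \<eta> \<Longrightarrow> (\<And>x. 0 \<le> \<eta> x \<and> \<eta> x \<le> (1::real)) \<Longrightarrow> (\<integral>x. H x * \<eta> x \<partial>dV) = 0"
  shows "AE x in dV. H x = 0"
proof -
  have [measurable]: "H \<in> borel_measurable dV" using H by auto
  \<comment> \<open>\<open>ennreal\<close> cuts negative values off to 0, so \<open>M 1\<close> and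
    \<open>M (- 1)\<close> carry the positive and the negative part of \<open>H\<close>.\<close>
  define M where "M s = distr (density dV (\<lambda>x. ennreal (s * H x))) borel (\<lambda>x. x)" for s
  have [measurable]: "(\<lambda>x. x) \<in> density dV w \<rightarrow>\<^sub>M borel" for w
    by (simp cong: measurable_cong_sets)
  have Hs: "(\<integral>\<^sup>+x. ennreal (s * H x) \<partial>dV) < \<infinity>" for s
  proof -
    have "(\<integral>\<^sup>+x. ennreal (s * H x) \<partial>dV) \<le> (\<integral>\<^sup>+x. ennreal (norm (s * H x)) \<partial>dV)"
      by (intro nn_integral_mono ennreal_leI) simp
    also have "\<dots> < \<infinity>"
      using integrable_mult_right[of s, OF H] unfolding integrable_iff_bounded by blast
    finally show ?thesis .
  qed
  have fin: "finite_measure (M s)" for s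
  proof (rule finite_measureI)
    have "emeasure (M s) (space (M s)) = emeasure (density dV (\<lambda>x. ennreal (s * H x))) (space dV)"
      unfolding M_def by (subst emeasure_distr) auto
    also have "\<dots> = (\<integral>\<^sup>+x. ennreal (s * H x) * indicator (space dV) x \<partial>dV)"
      by (rule emeasure_density) (simp, rule sets.top)
    also have "\<dots> = (\<integral>\<^sup>+x. ennreal (s * H x) \<partial>dV)" by (intro nn_integral_cong) simp
    finally show "emeasure (M s) (space (M s)) \<noteq> \<infinity>" using Hs[of s] by simp
  qed
  have int: "(\<integral>x. \<eta> x \<partial>M s) = (\<integral>x. max 0 (s * H x) * \<eta> x \<partial>dV)"
    if c: "continuous_on UNIV \<eta>" for \<eta> :: "real ^ 3 \<Rightarrow> real" and s
  proof -
    have [measurable]: "\<eta> \<in> borel_measurable borel" by (rule borel_measurable_continuous_onI[OF c])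
    have "(\<integral>x. \<eta> x \<partial>M s) = (\<integral>x. \<eta> x \<partial>density dV (\<lambda>x. ennreal (max 0 (s * H x))))"
      unfolding M_def by (subst integral_distr) (simp_all add: ennreal_max_0)
    also have "\<dots> = (\<integral>x. max 0 (s * H x) * \<eta> x \<partial>dV)"
      by (subst integral_density) auto
    finally show ?thesis .
  qed
  have "M 1 = M (- 1)"
  proof (rule measure_eqI_continuous)
    fix \<eta> :: "real ^ 3 \<Rightarrow> real" assume c: "continuous_on UNIV \<eta>" and b: "\<And>x. 0 \<le> \<eta> x \<and> \<eta> x \<le> 1"
    have [measurable]: "\<eta> \<in> borel_measurable borel" by (rule borel_measurable_continuous_onI[OF c])
    have i: "integrable dV (\<lambda>x. max 0 (s * H x) * \<eta> x)" for s
    proof (rule Bochner_Integration.integrable_bound)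
      show "integrable dV (\<lambda>x. s * H x)" using H by simp
      have "\<bar>max 0 (s * H x) * \<eta> x\<bar> \<le> \<bar>s * H x\<bar>" for x
      proof -
        have "\<bar>max 0 (s * H x)\<bar> * \<bar>\<eta> x\<bar> \<le> \<bar>s * H x\<bar> * 1"
          using b[of x] by (intro mult_mono) auto
        then show ?thesis by (simp add: abs_mult)
      qed
      then show "AE x in dV. norm (max 0 (s * H x) * \<eta> x) \<le> norm (s * H x)" by (intro AE_I2) simp
    qed simp
    have "(\<integral>x. \<eta> x \<partial>M 1) - (\<integral>x. \<eta> x \<partial>M (- 1)) = (\<integral>x. max 0 (1 * H x) * \<eta> x - max 0 (- 1 * H x) * \<eta> x \<partial>dV)"
      unfolding int[OF c] by (rule Bochner_Integration.integral_diff[OF i i, symmetric])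
    also have "\<dots> = (\<integral>x. H x * \<eta> x \<partial>dV)"
      by (intro Bochner_Integration.integral_cong) (auto simp: max_def)
    also have "\<dots> = 0" by (rule z[OF c b])
    finally show "(\<integral>x. \<eta> x \<partial>M 1) = (\<integral>x. \<eta> x \<partial>M (- 1))" by simp
  qed (auto simp: fin, simp_all add: M_def)
  have "(\<integral>\<^sup>+x. ennreal (H x) * indicator A x \<partial>dV) = (\<integral>\<^sup>+x. ennreal (- H x) * indicator A x \<partial>dV)"
    if A: "A \<in> sets dV" for A
  proof -
    obtain B where B: "B \<in> sets borel" "A = S2 \<inter> B"
      using A by (auto simp: sets_dV sets_restrict_space)
    have "emeasure (M s) B = (\<integral>\<^sup>+x. ennreal (s * H x) * indicator A x \<partial>dV)" for s
    proof -
      have "emeasure (M s) B = emeasure (density dV (\<lambda>x. ennreal (s * H x))) A"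
        unfolding M_def by (subst emeasure_distr) (use B in \<open>auto intro!: arg_cong2[of _ _ _ _ emeasure]\<close>)
      then show ?thesis using A by (simp add: emeasure_density)
    qed
    from this[of 1] this[of "-1"] show ?thesis unfolding \<open>M 1 = M (- 1)\<close> by simp
  qed
  note eq = this
  have "(LINT x:A|dV. H x) = 0" if A: "A \<in> sets dV" for A
  proof -
    have "ennreal (indicator A x *\<^sub>R H x) = ennreal (H x) * indicator A x"
      "ennreal (- (indicator A x *\<^sub>R H x)) = ennreal (- H x) * indicator A x" for x
      by (simp_all add: indicator_def)
    then show ?thesis
      unfolding set_lebesgue_integral_def real_lebesgue_integral_def[OF integrable_mult_indicator[OF A H]]
      by (simp only: eq[OF A])
  qed
  then show ?thesis by (rule dV.density_zero[OF H])
qed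

lemma poisson_nonneg: "\<epsilon> > 0 \<Longrightarrow> 0 \<le> poisson \<epsilon> t"
  by (simp add: poisson_def)

lemma measurable_poisson [measurable]: "poisson \<epsilon> \<in> borel_measurable borel"
  unfolding poisson_def by measurable

lemma integral_poisson:
  assumes a: "a \<in> S2" and e: "\<epsilon> > 0"
  shows "integrable dV (\<lambda>x. poisson \<epsilon> (x \<bullet> a))" "(\<integral>x. poisson \<epsilon> (x \<bullet> a) \<partial>dV) = 1"
proof -
  have "has_bochner_integral dV (\<lambda>x. poisson \<epsilon> (x \<bullet> a)) 1"
    using nn_integral_poisson[OF a e] poisson_nonneg[OF e]
    by (intro has_bochner_integral_nn_integral) auto
  then show "integrable dV (\<lambda>x. poisson \<epsilon> (x \<bullet> a))" "(\<integral>x. poisson \<epsilon> (x \<bullet> a) \<partial>dV) = 1"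
    by (auto simp: has_bochner_integral_iff)
qed

lemma integrable_mult_bounded:
  fixes f g :: "real ^ 3 \<Rightarrow> real"
  assumes f: "integrable dV f" and g[measurable]: "g \<in> borel_measurable dV"
    and B: "\<And>x. x \<in> S2 \<Longrightarrow> \<bar>g x\<bar> \<le> B"
  shows "integrable dV (\<lambda>x. f x * g x)"
proof (rule Bochner_Integration.integrable_bound)
  show "integrable dV (\<lambda>x. B * f x)" using f by simp
  have [measurable]: "f \<in> borel_measurable dV" using f by auto
  show "(\<lambda>x. f x * g x) \<in> borel_measurable dV" by measurable
  have "\<bar>f x\<bar> * \<bar>g x\<bar> \<le> \<bar>B\<bar> * \<bar>f x\<bar>" if "x \<in> S2" for x
    using B[OF that] by (subst mult.commute) (auto intro!: mult_right_mono)
  then show "AE x in dV. norm (f x * g x) \<le> norm (B * f x)" by (intro AE_I2) (simp add: abs_mult)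
qed

definition eps :: "nat \<Rightarrow> real" where "eps n = 1 / real (Suc n)"

lemma eps_pos: "eps n > 0" and eps_le: "eps n \<le> 1" and eps_tendsto: "eps \<longlonglongrightarrow> 0"
proof -
  show "eps n > 0" "eps n \<le> 1" by (simp_all add: eps_def)
  show "eps \<longlonglongrightarrow> 0" unfolding eps_def by (rule LIMSEQ_Suc[OF lim_1_over_n])
qed

lemma poisson_tendsto:
  fixes \<eta> :: "real ^ 3 \<Rightarrow> real"
  assumes c: "continuous_on UNIV \<eta>" and b: "\<And>x. 0 \<le> \<eta> x \<and> \<eta> x \<le> 1" and a: "a \<in> S2"
  shows "(\<lambda>n. \<integral>x. poisson (eps n) (x \<bullet> a) * \<eta> x \<partial>dV) \<longlonglongrightarrow> \<eta> a"
proof (rule LIMSEQ_I)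
  fix r :: real assume r: "r > 0"
  have [measurable]: "\<eta> \<in> borel_measurable borel" by (rule borel_measurable_continuous_onI[OF c])
  obtain d where d: "d > 0" "\<And>x. dist x a < d \<Longrightarrow> dist (\<eta> x) (\<eta> a) < r / 2"
    using c r unfolding continuous_on_iff by (metis UNIV_I half_gt_zero)
  \<comment> \<open>On the sphere \<open>dist x a \<ge> d\<close> means
    \<open>1 - x \<bullet> a \<ge> d\<^sup>2 / 2\<close>.\<close>
  define e where "e = d\<^sup>2 / 2"
  have e: "e > 0" using d by (simp add: e_def)
  have far: "1 - x \<bullet> a \<ge> e" if x: "x \<in> S2" and dx: "dist x a \<ge> d" for x
  proof -
    have "(dist x a)\<^sup>2 = 2 - 2 * (x \<bullet> a)"
      using x a by (simp add: dist_norm power2_norm_eq_inner in_S2 inner_diff_left inner_diff_right inner_commute)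
    moreover have "d\<^sup>2 \<le> (dist x a)\<^sup>2" using dx d(1) by (intro power_mono) auto
    ultimately show ?thesis by (simp add: e_def)
  qed
  \<comment> \<open>One bound for both regions: near \<open>a\<close> continuity yields the first
    summand; far from \<open>a\<close> the kernel itself is at most the second, with 3 as a bound
    for \<open>2 + eps n\<close>.\<close>
  have pt: "poisson (eps n) (x \<bullet> a) * \<bar>\<eta> x - \<eta> a\<bar> \<le> poisson (eps n) (x \<bullet> a) * (r / 2) + 3 * eps n / (4 * pi * e\<^sup>2)"
    if x: "x \<in> S2" for x n
  proof (cases "dist x a < d")
    case True
    then have "\<bar>\<eta> x - \<eta> a\<bar> \<le> r / 2" using d(2)[of x] by (simp add: dist_real_def)
    then have "poisson (eps n) (x \<bullet> a) * \<bar>\<eta> x - \<eta> a\<bar> \<le> poisson (eps n) (x \<bullet> a) * (r / 2)"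
      by (intro mult_left_mono poisson_nonneg eps_pos)
    moreover have "0 \<le> 3 * eps n / (4 * pi * e\<^sup>2)" using eps_pos[of n] by simp
    ultimately show ?thesis by linarith
  next
    case False
    then have f: "1 - x \<bullet> a \<ge> e" using far[OF x] by simp
    have "poisson (eps n) (x \<bullet> a) * \<bar>\<eta> x - \<eta> a\<bar> \<le> poisson (eps n) (x \<bullet> a) * 1"
      using b[of x] b[of a] by (intro mult_left_mono poisson_nonneg eps_pos) auto
    also have "\<dots> \<le> (eps n * 3 / (4 * pi)) / e\<^sup>2"
      unfolding poisson_def mult_1_right
    proof (rule frac_le)
      show "e\<^sup>2 \<le> (1 + eps n - x \<bullet> a)\<^sup>2" using f e eps_pos[of n] by (intro power_mono) auto
      show "eps n * (2 + eps n) / (4 * pi) \<le> eps n * 3 / (4 * pi)"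
        using eps_le[of n] eps_pos[of n] by (intro divide_right_mono mult_left_mono) auto
      show "0 \<le> eps n * 3 / (4 * pi)" using eps_pos[of n] by simp
    qed (use e in auto)
    finally have "poisson (eps n) (x \<bullet> a) * \<bar>\<eta> x - \<eta> a\<bar> \<le> 3 * eps n / (4 * pi * e\<^sup>2)"
      by (simp add: mult.commute)
    moreover have "0 \<le> poisson (eps n) (x \<bullet> a) * (r / 2)" using r by (intro mult_nonneg_nonneg poisson_nonneg eps_pos) auto
    ultimately show ?thesis by linarith
  qed
  have "(\<lambda>n. 3 * eps n / (4 * pi * e\<^sup>2) * (4 * pi)) \<longlonglongrightarrow> 3 * 0 / (4 * pi * e\<^sup>2) * (4 * pi)"
    by (intro tendsto_intros eps_tendsto) (use e in auto)
  then have "eventually (\<lambda>n. 3 * eps n / (4 * pi * e\<^sup>2) * (4 * pi) < r / 2) sequentially"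
    by (rule order_tendstoD(2)) (use r in simp)
  then obtain N where N: "\<And>n. n \<ge> N \<Longrightarrow> 3 * eps n / (4 * pi * e\<^sup>2) * (4 * pi) < r / 2"
    unfolding eventually_sequentially by blast
  have "norm ((\<integral>x. poisson (eps n) (x \<bullet> a) * \<eta> x \<partial>dV) - \<eta> a) < r" if n: "n \<ge> N" for n
  proof -
    note P = integral_poisson[OF a eps_pos[of n]]
    have i: "integrable dV (\<lambda>x. poisson (eps n) (x \<bullet> a) * \<eta> x)"
      using b by (intro integrable_mult_bounded[OF P(1), where B = 1]) auto
    have i2: "integrable dV (\<lambda>x. poisson (eps n) (x \<bullet> a) * (\<eta> x - \<eta> a))"
      using i P(1) by (simp add: right_diff_distrib)
    have "(\<integral>x. poisson (eps n) (x \<bullet> a) * \<eta> x \<partial>dV) - \<eta> a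
        = (\<integral>x. poisson (eps n) (x \<bullet> a) * \<eta> x \<partial>dV) - (\<integral>x. poisson (eps n) (x \<bullet> a) * \<eta> a \<partial>dV)"
      using P by simp
    also have "\<dots> = (\<integral>x. poisson (eps n) (x \<bullet> a) * (\<eta> x - \<eta> a) \<partial>dV)"
      using i P(1) by (simp add: right_diff_distrib)
    finally have "norm ((\<integral>x. poisson (eps n) (x \<bullet> a) * \<eta> x \<partial>dV) - \<eta> a)
        \<le> (\<integral>x. \<bar>poisson (eps n) (x \<bullet> a) * (\<eta> x - \<eta> a)\<bar> \<partial>dV)"
      by (simp add: integral_abs_bound)
    also have "\<dots> \<le> (\<integral>x. poisson (eps n) (x \<bullet> a) * (r / 2) + 3 * eps n / (4 * pi * e\<^sup>2) \<partial>dV)"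
    proof (rule Bochner_Integration.integral_mono)
      show "integrable dV (\<lambda>x. poisson (eps n) (x \<bullet> a) * (r / 2) + 3 * eps n / (4 * pi * e\<^sup>2))"
        using P(1) by simp
      fix x assume "x \<in> space dV"
      then show "\<bar>poisson (eps n) (x \<bullet> a) * (\<eta> x - \<eta> a)\<bar> \<le> poisson (eps n) (x \<bullet> a) * (r / 2) + 3 * eps n / (4 * pi * e\<^sup>2)"
        using pt[of x n] poisson_nonneg[OF eps_pos[of n], of "x \<bullet> a"] by (simp add: abs_mult)
    qed (use i2 in simp)
    also have "\<dots> = r / 2 + 3 * eps n / (4 * pi * e\<^sup>2) * (4 * pi)"
      using P by (simp add: measure_dV)
    also have "\<dots> < r" using N[OF n] by simp
    finally show ?thesis .
  qed
  then show "\<exists>N. \<forall>n\<ge>N. norm ((\<integral>x. poisson (eps n) (x \<bullet> a) * \<eta> x \<partial>dV) - \<eta> a) < r" by blast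
qed

text \<open>The value \<open>ln 0 = 0\<close> on the diagonal is harmless: for each \<open>a\<close> it concerns a null set.\<close>

lemma integrable_ln_inner:
  assumes a: "a \<in> S2"
  shows "integrable dV (\<lambda>x. ln (1 - x \<bullet> a))"
  using nn_integral_abs_ln[OF a] by (intro integrableI_bounded) (auto simp: le_less_trans[OF _ ennreal_less_top])

text \<open>The bound is free of \<open>\<epsilon>\<close>, so it serves as a majorant while
  \<open>\<epsilon>\<close> tends to 0.\<close>

lemma abs_ln_shift:
  assumes "0 < s" "s \<le> 2" "0 < \<epsilon>" "\<epsilon> \<le> (1::real)"
  shows "\<bar>ln (s + \<epsilon>)\<bar> \<le> 2 + \<bar>ln s\<bar>"
proof -
  have "ln (s + \<epsilon>) \<le> s + \<epsilon> - 1" using assms by (intro ln_le_minus_one) auto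
  moreover have "ln s \<le> ln (s + \<epsilon>)" using assms by simp
  ultimately show ?thesis using assms by linarith
qed

text \<open>The second estimate is uniform in \<open>n\<close>; its right-hand side, as a function
  of \<open>a\<close>, later dominates the smoothed potentials when they are integrated over the
  sphere.\<close>

lemma log_integral_tendsto:
  assumes f: "integrable dV (\<lambda>x. f x * ln (1 - x \<bullet> a))" "integrable dV f" and a: "a \<in> S2"
  shows "(\<lambda>n. \<integral>x. f x * ln (1 + eps n - x \<bullet> a) \<partial>dV) \<longlonglongrightarrow> (\<integral>x. f x * ln (1 - x \<bullet> a) \<partial>dV)"
    and "\<bar>\<integral>x. f x * ln (1 + eps n - x \<bullet> a) \<partial>dV\<bar> \<le> (\<integral>x. 2 * \<bar>f x\<bar> + \<bar>f x * ln (1 - x \<bullet> a)\<bar> \<partial>dV)"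
proof -
  have [measurable]: "f \<in> borel_measurable dV" using f by auto
  have S: "AE x in dV. x \<in> S2" by (rule AE_I2) simp
  have i: "integrable dV (\<lambda>x. 2 * \<bar>f x\<bar> + \<bar>f x * ln (1 - x \<bullet> a)\<bar>)" using f by simp
  have bd: "AE x in dV. norm (f x * ln (1 + eps n - x \<bullet> a)) \<le> 2 * \<bar>f x\<bar> + \<bar>f x * ln (1 - x \<bullet> a)\<bar>" for n
    using S AE_dV_inner_less[OF a]
  proof eventually_elim
    case (elim x)
    have "\<bar>ln (1 - x \<bullet> a + eps n)\<bar> \<le> 2 + \<bar>ln (1 - x \<bullet> a)\<bar>"
      using elim inner_S2_diff[OF elim(1) a] by (intro abs_ln_shift eps_pos eps_le) auto
    then have "\<bar>f x\<bar> * \<bar>ln (1 - x \<bullet> a + eps n)\<bar> \<le> \<bar>f x\<bar> * (2 + \<bar>ln (1 - x \<bullet> a)\<bar>)"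
      by (intro mult_left_mono) auto
    then show ?case by (simp add: abs_mult algebra_simps)
  qed
  show "(\<lambda>n. \<integral>x. f x * ln (1 + eps n - x \<bullet> a) \<partial>dV) \<longlonglongrightarrow> (\<integral>x. f x * ln (1 - x \<bullet> a) \<partial>dV)"
  proof (rule integral_dominated_convergence[OF _ _ i _ bd])
    show "AE x in dV. (\<lambda>n. f x * ln (1 + eps n - x \<bullet> a)) \<longlonglongrightarrow> f x * ln (1 - x \<bullet> a)"
      using AE_dV_inner_less[OF a]
    proof eventually_elim
      case (elim x)
      have "(\<lambda>n. f x * ln (1 + eps n - x \<bullet> a)) \<longlonglongrightarrow> f x * ln (1 + 0 - x \<bullet> a)"
        by (intro tendsto_intros eps_tendsto) (use elim in auto)
      then show ?case by simp
    qed
  qed measurable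
  have "\<bar>\<integral>x. f x * ln (1 + eps n - x \<bullet> a) \<partial>dV\<bar> \<le> (\<integral>x. \<bar>f x * ln (1 + eps n - x \<bullet> a)\<bar> \<partial>dV)"
    by (rule integral_abs_bound)
  also have "\<dots> \<le> (\<integral>x. 2 * \<bar>f x\<bar> + \<bar>f x * ln (1 - x \<bullet> a)\<bar> \<partial>dV)"
    using bd by (intro integral_mono_AE i Bochner_Integration.integrable_bound[OF i]) auto
  finally show "\<bar>\<integral>x. f x * ln (1 + eps n - x \<bullet> a) \<partial>dV\<bar> \<le> (\<integral>x. 2 * \<bar>f x\<bar> + \<bar>f x * ln (1 - x \<bullet> a)\<bar> \<partial>dV)" .
qed

section \<open>The integral representation of a solution\<close>

lemma integral_dV_inner_cong:
  fixes k :: "real \<Rightarrow> real"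
  assumes "a \<in> S2" "b \<in> S2" and [measurable]: "k \<in> borel_measurable borel"
  shows "(\<integral>x. k (x \<bullet> a) \<partial>dV) = (\<integral>x. k (x \<bullet> b) \<partial>dV)"
proof -
  have "(\<integral>x. k (x \<bullet> c) \<partial>dV) = (\<integral>t. k t \<partial>distr dV borel (\<lambda>x. x \<bullet> c))" for c
    by (subst integral_distr) auto
  then show ?thesis using assms by (simp add: dV_inner)
qed

lemma poles: "north_pole \<in> S2" "south_pole \<in> S2" "x \<bullet> north_pole = x $ 3" "x \<bullet> south_pole = - x $ 3"
  by (simp_all add: in_S2 inner_vec_def sum_3 north_pole_def south_pole_def)

text \<open>\<open>P\<close> stands for the Poisson mean of \<open>u\<close> at a point,
  \<open>U\<close> for the integral of \<open>u\<close>, \<open>V\<close> and \<open>I\<close> for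
  the integrals of the kernel with and without the weight \<open>W\<close>, \<open>S\<close> and
  \<open>N\<close> for its values at the poles. The tested equation is solved for
  \<open>P\<close>.\<close>

lemma mollified_algebra:
  fixes P :: real
  assumes "- (4 * pi * P - U) = \<rho> * (V - I / (4 * pi)) - 2 * pi * (aS * (S - I / (4 * pi)) + aN * (N - I / (4 * pi)))"
  shows "P = (U + (\<rho> / (4 * pi) - (aS + aN) / 2) * I) / (4 * pi) - \<rho> / (4 * pi) * V + aS / 2 * S + aN / 2 * N"
proof -
  define J where "J = I / (4 * pi)"
  have I: "I = 4 * pi * J" by (simp add: J_def)
  have "4 * pi * P = U - \<rho> * V + \<rho> * J + 2 * pi * (aS * (S - J) + aN * (N - J))"
    using assms unfolding J_def[symmetric] by (simp add: right_diff_distrib)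
  then have "P = (U - \<rho> * V + \<rho> * J + 2 * pi * (aS * (S - J) + aN * (N - J))) / (4 * pi)"
    by (simp add: eq_divide_eq mult.commute)
  then show ?thesis unfolding I by (simp add: divide_simps) (simp add: algebra_simps)
qed

text \<open>\<open>Z\<close> is the total integral of \<open>exp (2 * u x)\<close>, since
  \<open>W\<close> has mass 1, and \<open>4 * pi\<close> is inserted for the area. The order of
  \<open>aS\<close> and \<open>aN\<close> enters only in \<open>mass_range\<close>.\<close>

locale liouville_weak =
  fixes u W :: "real ^ 3 \<Rightarrow> real" and \<rho> Z aS aN :: real
  assumes pos: "0 < \<rho>" "0 < Z" "0 < aS" "0 < aN"
    and u: "integrable dV u" and W: "integrable dV W" and W1: "(\<integral>x. W x \<partial>dV) = 1"
    and W_eq: "\<And>x. W x = exp (2 * u x) / Z"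
    and eqn: "\<And>\<phi>. \<phi> \<in> smooth_S2 \<Longrightarrow> - (\<integral>x. u x * laplacian_S2 \<phi> x \<partial>dV)
      = \<rho> * (\<integral>x. (W x - 1 / (4 * pi)) * \<phi> x \<partial>dV)
        - 2 * pi * (aS * (\<phi> south_pole - (\<integral>x. 1 / (4 * pi) * \<phi> x \<partial>dV))
          + aN * (\<phi> north_pole - (\<integral>x. 1 / (4 * pi) * \<phi> x \<partial>dV)))"
begin

lemma W_pos: "W x > 0"
  using pos by (simp add: W_eq)

lemma measurable_uW [measurable]: "u \<in> borel_measurable dV" "W \<in> borel_measurable dV"
  using u W by auto

text \<open>Collects what does not depend on \<open>y\<close> in \<open>mollified\<close>. The
  integral of the kernel is the same for every pole, so \<open>north_pole\<close> stands for all of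
  them.\<close>

definition mean :: "real \<Rightarrow> real" where
  "mean \<epsilon> = ((\<integral>x. u x \<partial>dV) + (\<rho> / (4 * pi) - (aS + aN) / 2) * (\<integral>x. ln (1 + \<epsilon> - x \<bullet> north_pole) \<partial>dV)) / (4 * pi)"

text \<open>By \<open>laplacian_log_kernel\<close> the left side of the tested equation contains the
  Poisson mean of \<open>u\<close> at \<open>y\<close>. For fixed \<open>\<epsilon>\<close> both
  kernels are bounded on the sphere, so all integrals converge.\<close>

lemma mollified:
  assumes e: "\<epsilon> > 0" and y: "y \<in> S2"
  shows "(\<integral>x. u x * poisson \<epsilon> (x \<bullet> y) \<partial>dV) = mean \<epsilon> - \<rho> / (4 * pi) * (\<integral>x. W x * ln (1 + \<epsilon> - x \<bullet> y) \<partial>dV)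
    + aS / 2 * ln (1 + \<epsilon> - south_pole \<bullet> y) + aN / 2 * ln (1 + \<epsilon> - north_pole \<bullet> y)"
proof -
  let ?\<phi> = "\<lambda>x. ln (1 + \<epsilon> - x \<bullet> y)"
  have bd: "\<epsilon> \<le> 1 + \<epsilon> - x \<bullet> y" "1 + \<epsilon> - x \<bullet> y \<le> 2 + \<epsilon>" if "x \<in> S2" for x
    using inner_S2_diff[OF that y] by auto
  have bl: "\<bar>?\<phi> x\<bar> \<le> \<bar>ln \<epsilon>\<bar> + \<bar>ln (2 + \<epsilon>)\<bar>" if "x \<in> S2" for x
  proof -
    have "ln \<epsilon> \<le> ?\<phi> x" "?\<phi> x \<le> ln (2 + \<epsilon>)" using bd[OF that] e by (auto intro!: ln_mono)
    then show ?thesis by linarith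
  qed
  have bp: "\<bar>poisson \<epsilon> (x \<bullet> y)\<bar> \<le> \<epsilon> * (2 + \<epsilon>) / (4 * pi) / \<epsilon>\<^sup>2" if "x \<in> S2" for x
  proof -
    have "\<epsilon>\<^sup>2 \<le> (1 + \<epsilon> - x \<bullet> y)\<^sup>2" using bd[OF that] e by (intro power_mono) auto
    then have "poisson \<epsilon> (x \<bullet> y) \<le> \<epsilon> * (2 + \<epsilon>) / (4 * pi) / \<epsilon>\<^sup>2"
      unfolding poisson_def using e by (intro frac_le) auto
    then show ?thesis using poisson_nonneg[OF e, of "x \<bullet> y"] by simp
  qed
  have iW: "integrable dV (\<lambda>x. W x * ?\<phi> x)"
    by (rule integrable_mult_bounded[OF W _ bl]) measurable
  have i1: "integrable dV ?\<phi>"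
  proof (rule dV.integrable_const_bound)
    show "AE x in dV. norm (?\<phi> x) \<le> \<bar>ln \<epsilon>\<bar> + \<bar>ln (2 + \<epsilon>)\<bar>" using bl by (intro AE_I2) simp
  qed measurable
  have iP: "integrable dV (\<lambda>x. u x * poisson \<epsilon> (x \<bullet> y))"
    by (rule integrable_mult_bounded[OF u _ bp]) measurable
  define I where "I = (\<integral>x. ?\<phi> x \<partial>dV)"
  have I: "I = (\<integral>x. ln (1 + \<epsilon> - x \<bullet> north_pole) \<partial>dV)"
    unfolding I_def by (rule integral_dV_inner_cong[OF y poles(1), of "\<lambda>t. ln (1 + \<epsilon> - t)"]) measurable
  have "(\<integral>x. u x * laplacian_S2 (log_kernel \<epsilon> y) x \<partial>dV) = (\<integral>x. 4 * pi * (u x * poisson \<epsilon> (x \<bullet> y)) - u x \<partial>dV)"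
  proof (intro Bochner_Integration.integral_cong refl)
    fix x assume "x \<in> space dV"
    moreover have "\<epsilon> * (2 + \<epsilon>) / (1 + \<epsilon> - x \<bullet> y)\<^sup>2 = 4 * pi * poisson \<epsilon> (x \<bullet> y)" by (simp add: poisson_def)
    ultimately show "u x * laplacian_S2 (log_kernel \<epsilon> y) x = 4 * pi * (u x * poisson \<epsilon> (x \<bullet> y)) - u x"
      by (simp add: laplacian_log_kernel[OF e y] algebra_simps)
  qed
  also have "\<dots> = 4 * pi * (\<integral>x. u x * poisson \<epsilon> (x \<bullet> y) \<partial>dV) - (\<integral>x. u x \<partial>dV)"
    using iP u by simp
  finally have L: "(\<integral>x. u x * laplacian_S2 (log_kernel \<epsilon> y) x \<partial>dV) = \<dots>" .
  have "(\<integral>x. (W x - 1 / (4 * pi)) * log_kernel \<epsilon> y x \<partial>dV) = (\<integral>x. W x * ?\<phi> x - 1 / (4 * pi) * ?\<phi> x \<partial>dV)"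
    by (simp add: log_kernel_def left_diff_distrib)
  also have "\<dots> = (\<integral>x. W x * ?\<phi> x \<partial>dV) - I / (4 * pi)"
    unfolding I_def using iW i1 by simp
  finally have R: "(\<integral>x. (W x - 1 / (4 * pi)) * log_kernel \<epsilon> y x \<partial>dV) = \<dots>" .
  have K: "(\<integral>x. 1 / (4 * pi) * log_kernel \<epsilon> y x \<partial>dV) = I / (4 * pi)"
    unfolding I_def log_kernel_def by simp
  have "- (4 * pi * (\<integral>x. u x * poisson \<epsilon> (x \<bullet> y) \<partial>dV) - (\<integral>x. u x \<partial>dV))
    = \<rho> * ((\<integral>x. W x * ?\<phi> x \<partial>dV) - I / (4 * pi)) - 2 * pi * (aS * (?\<phi> south_pole - I / (4 * pi)) + aN * (?\<phi> north_pole - I / (4 * pi)))"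
    using eqn[OF log_kernel_smooth[OF e y]] unfolding L R K by (simp add: log_kernel_def)
  from mollified_algebra[OF this] show ?thesis unfolding mean_def I .
qed

definition pot :: "real ^ 3 \<Rightarrow> real" where
  "pot y = (\<integral>x. W x * ln (1 - x \<bullet> y) \<partial>dV)"

text \<open>The limit of \<open>mollified\<close> as \<open>\<epsilon>\<close> tends to 0, with
  \<open>1 + y $ 3 = 1 - y \<bullet> south_pole\<close>. The last two terms are the conical points:
  they give \<open>exp (2 * rep y)\<close> the factors \<open>(1 + y $ 3) powr aS\<close> and
  \<open>(1 - y $ 3) powr aN\<close>.\<close>

definition rep :: "real ^ 3 \<Rightarrow> real" where
  "rep y = mean 0 - \<rho> / (4 * pi) * pot y + aS / 2 * ln (1 + y $ 3) + aN / 2 * ln (1 - y $ 3)"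

lemma W_ln_integrable:
  "integrable (dV \<Otimes>\<^sub>M dV) (\<lambda>(x, y). W x * ln (1 - x \<bullet> y))"
  using kernel_integrable[OF W, of "\<lambda>t. ln (1 - t)" "32 * pi"] nn_integral_abs_ln by simp

lemma AE_W_ln: "AE y in dV. integrable dV (\<lambda>x. W x * ln (1 - x \<bullet> y))"
  using dVdV.AE_integrable_snd[of "\<lambda>x y. W x * ln (1 - x \<bullet> y)"] W_ln_integrable by simp

lemma measurable_pot [measurable]: "pot \<in> borel_measurable dV"
  unfolding pot_def by measurable

lemma measurable_rep [measurable]: "rep \<in> borel_measurable dV"
  unfolding rep_def by measurable

lemma mean_tendsto: "(\<lambda>n. mean (eps n)) \<longlonglongrightarrow> mean 0"
proof -
  have "(\<lambda>n. \<integral>x. ln (1 + eps n - x \<bullet> north_pole) \<partial>dV) \<longlonglongrightarrow> (\<integral>x. ln (1 - x \<bullet> north_pole) \<partial>dV)"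
    using log_integral_tendsto(1)[of "\<lambda>_. 1" north_pole] integrable_ln_inner[OF poles(1)] poles(1) by simp
  then show ?thesis unfolding mean_def by (auto intro!: tendsto_intros)
qed

text \<open>Pointwise convergence of the Poisson means of \<open>u\<close> is avoided by passing to
  the limit weakly: against a continuous \<open>\<eta>\<close> the symmetric kernel moves from
  \<open>u\<close> to \<open>\<eta>\<close>, where convergence holds at every point, while the
  explicit right-hand sides converge under a common majorant.\<close>

lemma AE_rep: "AE y in dV. u y = rep y"
proof -
  define V where "V n y = (\<integral>x. W x * ln (1 + eps n - x \<bullet> y) \<partial>dV)" for n y
  define B where "B y = (\<integral>x. 2 * \<bar>W x\<bar> + \<bar>W x * ln (1 - x \<bullet> y)\<bar> \<partial>dV)" for y
  define Rn where "Rn n y = mean (eps n) - \<rho> / (4 * pi) * V n y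
    + aS / 2 * ln (1 + eps n - south_pole \<bullet> y) + aN / 2 * ln (1 + eps n - north_pole \<bullet> y)" for n y
  have S: "AE x in dV. x \<in> S2" by (rule AE_I2) simp
  have Rn: "(\<integral>x. u x * poisson (eps n) (x \<bullet> y) \<partial>dV) = Rn n y" if "y \<in> S2" for n y
    unfolding Rn_def V_def by (rule mollified[OF eps_pos that])
  have [measurable]: "V n \<in> borel_measurable dV" "Rn n \<in> borel_measurable dV" for n
    unfolding V_def Rn_def by measurable
  obtain m where m: "\<And>n. \<bar>mean (eps n)\<bar> \<le> m"
    using convergent_imp_Bseq[OF convergentI[OF mean_tendsto]] unfolding Bseq_def by auto
  have lnp: "ln (1 + y $ 3) = ln (1 - y \<bullet> south_pole)" "ln (1 - y $ 3) = ln (1 - y \<bullet> north_pole)" for y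
    by (simp_all add: poles)
  have less: "AE y in dV. y \<bullet> south_pole < 1 \<and> y \<bullet> north_pole < 1"
    using AE_dV_inner_less[OF poles(1)] AE_dV_inner_less[OF poles(2)] by eventually_elim simp
  have lim: "AE y in dV. (\<lambda>n. Rn n y) \<longlonglongrightarrow> rep y"
    using AE_W_ln less S
  proof eventually_elim
    case (elim y)
    have V: "(\<lambda>n. V n y) \<longlonglongrightarrow> pot y"
      unfolding V_def pot_def by (rule log_integral_tendsto(1)[OF elim(1) W elim(3)])
    have l: "(\<lambda>n. ln (1 + eps n - p \<bullet> y)) \<longlonglongrightarrow> ln (1 - y \<bullet> p)" if "y \<bullet> p < 1" for p
    proof -
      have "(\<lambda>n. ln (1 + eps n - p \<bullet> y)) \<longlonglongrightarrow> ln (1 + 0 - p \<bullet> y)"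
        by (intro tendsto_intros eps_tendsto) (use that in \<open>auto simp: inner_commute\<close>)
      then show ?thesis by (simp add: inner_commute)
    qed
    show ?case
      unfolding Rn_def rep_def lnp using elim
      by (intro tendsto_add tendsto_diff tendsto_mult tendsto_const mean_tendsto V l) auto
  qed
  \<comment> \<open>Majorant of all \<open>Rn n\<close>, assembled term by term from bounds uniform
    in \<open>n\<close>; its integrability also yields that of \<open>rep\<close>.\<close>
  define D where "D y = m + \<rho> / (4 * pi) * B y + aS / 2 * (2 + \<bar>ln (1 - y \<bullet> south_pole)\<bar>)
    + aN / 2 * (2 + \<bar>ln (1 - y \<bullet> north_pole)\<bar>)" for y
  have iB: "integrable dV B"
  proof -
    have "integrable (dV \<Otimes>\<^sub>M dV) (\<lambda>(x, y). W x * 1)"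
      by (rule kernel_integrable[OF W, of "\<lambda>_. 1" "4 * pi"]) (auto simp: emeasure_dV)
    then have "integrable (dV \<Otimes>\<^sub>M dV) (\<lambda>p. 2 * \<bar>case p of (x, y) \<Rightarrow> W x * 1\<bar>
        + \<bar>case p of (x, y) \<Rightarrow> W x * ln (1 - x \<bullet> y)\<bar>)"
      using W_ln_integrable
      by (intro Bochner_Integration.integrable_add integrable_mult_right integrable_abs)
    then have "integrable (dV \<Otimes>\<^sub>M dV) (\<lambda>(x, y). 2 * \<bar>W x\<bar> + \<bar>W x * ln (1 - x \<bullet> y)\<bar>)"
      by (rule back_subst[of "integrable _"]) (auto simp: fun_eq_iff)
    from dVdV.integrable_snd[OF this] show ?thesis unfolding B_def .
  qed
  have iD: "integrable dV D"
    unfolding D_def using iB integrable_ln_inner poles(1,2) by simp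
  have bd: "AE y in dV. norm (Rn n y) \<le> D y" for n
    using AE_W_ln less S
  proof eventually_elim
    case (elim y)
    have V: "\<bar>V n y\<bar> \<le> B y"
      unfolding V_def B_def by (rule log_integral_tendsto(2)[OF elim(1) W elim(3)])
    have l: "\<bar>ln (1 + eps n - p \<bullet> y)\<bar> \<le> 2 + \<bar>ln (1 - y \<bullet> p)\<bar>" if "y \<bullet> p < 1" "p \<in> S2" for p
      using abs_ln_shift[of "1 - y \<bullet> p" "eps n"] inner_S2_diff[OF elim(3) that(2)] that eps_pos[of n] eps_le[of n]
      by (simp add: inner_commute add.commute add_diff_eq)
    have "\<bar>Rn n y\<bar> \<le> \<bar>mean (eps n)\<bar> + \<bar>\<rho> / (4 * pi) * V n y\<bar>
      + \<bar>aS / 2 * ln (1 + eps n - south_pole \<bullet> y)\<bar> + \<bar>aN / 2 * ln (1 + eps n - north_pole \<bullet> y)\<bar>"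
      unfolding Rn_def by linarith
    also have "\<dots> = \<bar>mean (eps n)\<bar> + \<rho> / (4 * pi) * \<bar>V n y\<bar>
      + aS / 2 * \<bar>ln (1 + eps n - south_pole \<bullet> y)\<bar> + aN / 2 * \<bar>ln (1 + eps n - north_pole \<bullet> y)\<bar>"
      using pos by (simp add: abs_mult)
    also have "\<dots> \<le> D y"
      unfolding D_def using pos elim poles(1,2)
      by (intro add_mono mult_left_mono m V l) auto
    finally show ?case by simp
  qed
  have irep: "integrable dV rep"
    by (rule integrable_dominated_convergence[OF _ _ iD lim bd]) measurable
  have "AE y in dV. u y - rep y = 0"
  proof (rule AE_dV_eq_zero)
    fix \<eta> :: "real ^ 3 \<Rightarrow> real"
    assume c: "continuous_on UNIV \<eta>" and b: "\<And>x. 0 \<le> \<eta> x \<and> \<eta> x \<le> 1"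
    have [measurable]: "\<eta> \<in> borel_measurable borel" by (rule borel_measurable_continuous_onI[OF c])
    define T where "T n x = (\<integral>y. poisson (eps n) (x \<bullet> y) * \<eta> y \<partial>dV)" for n x
    have [measurable]: "T n \<in> borel_measurable dV" for n unfolding T_def by measurable
    have Tl: "(\<lambda>n. T n x) \<longlonglongrightarrow> \<eta> x" if "x \<in> S2" for x
      unfolding T_def using poisson_tendsto[OF c b that] by (simp add: inner_commute)
    have Tb: "\<bar>T n x\<bar> \<le> 1" if x: "x \<in> S2" for n x
    proof -
      note P = integral_poisson[OF x eps_pos[of n]]
      have "\<bar>T n x\<bar> \<le> (\<integral>y. \<bar>poisson (eps n) (y \<bullet> x) * \<eta> y\<bar> \<partial>dV)"
        unfolding T_def inner_commute[of x] by (rule integral_abs_bound)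
      also have "\<dots> \<le> (\<integral>y. poisson (eps n) (y \<bullet> x) \<partial>dV)"
      proof (rule integral_mono_AE)
        show "integrable dV (\<lambda>y. \<bar>poisson (eps n) (y \<bullet> x) * \<eta> y\<bar>)"
          using b by (intro integrable_abs integrable_mult_bounded[OF P(1), where B = 1]) auto
        show "AE y in dV. \<bar>poisson (eps n) (y \<bullet> x) * \<eta> y\<bar> \<le> poisson (eps n) (y \<bullet> x)"
          using b poisson_nonneg[OF eps_pos[of n]]
          by (intro AE_I2) (auto simp: abs_mult intro!: mult_left_le)
      qed (rule P(1))
      finally show ?thesis using P(2) by simp
    qed
    have 1: "(\<lambda>n. \<integral>x. u x * T n x \<partial>dV) \<longlonglongrightarrow> (\<integral>x. u x * \<eta> x \<partial>dV)"
    proof (rule integral_dominated_convergence[where w = "\<lambda>x. \<bar>u x\<bar>"])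
      show "AE x in dV. (\<lambda>n. u x * T n x) \<longlonglongrightarrow> u x * \<eta> x"
        using Tl by (intro AE_I2 tendsto_intros) simp
      show "AE x in dV. norm (u x * T n x) \<le> \<bar>u x\<bar>" for n
        using Tb by (intro AE_I2) (auto simp: abs_mult intro!: mult_left_le)
    qed (use u in \<open>simp_all\<close>)
    have eq: "(\<integral>x. u x * T n x \<partial>dV) = (\<integral>y. Rn n y * \<eta> y \<partial>dV)" for n
    proof -
      have "integrable (dV \<Otimes>\<^sub>M dV) (\<lambda>(x, y). u x * poisson (eps n) (x \<bullet> y))"
        using kernel_integrable[OF u measurable_poisson, of "eps n" 1] nn_integral_poisson[OF _ eps_pos[of n]]
          poisson_nonneg[OF eps_pos[of n]] by simp
      then have "integrable (dV \<Otimes>\<^sub>M dV) (\<lambda>(x, y). u x * poisson (eps n) (x \<bullet> y) * \<eta> y)"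
      proof (rule Bochner_Integration.integrable_bound)
        show "(\<lambda>(x, y). u x * poisson (eps n) (x \<bullet> y) * \<eta> y) \<in> borel_measurable (dV \<Otimes>\<^sub>M dV)" by measurable
        show "AE p in dV \<Otimes>\<^sub>M dV. norm (case p of (x, y) \<Rightarrow> u x * poisson (eps n) (x \<bullet> y) * \<eta> y)
          \<le> norm (case p of (x, y) \<Rightarrow> u x * poisson (eps n) (x \<bullet> y))"
          using b by (intro AE_I2) (auto simp: abs_mult intro!: mult_left_le)
      qed
      from dVdV.Fubini_integral[OF this] 
      have "(\<integral>y. \<integral>x. u x * poisson (eps n) (x \<bullet> y) * \<eta> y \<partial>dV \<partial>dV) = (\<integral>x. \<integral>y. u x * poisson (eps n) (x \<bullet> y) * \<eta> y \<partial>dV \<partial>dV)" .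
      also have "\<dots> = (\<integral>x. u x * T n x \<partial>dV)"
        unfolding T_def mult.assoc by simp
      finally have "(\<integral>x. u x * T n x \<partial>dV) = (\<integral>y. \<integral>x. u x * poisson (eps n) (x \<bullet> y) * \<eta> y \<partial>dV \<partial>dV)" by simp
      also have "\<dots> = (\<integral>y. Rn n y * \<eta> y \<partial>dV)"
        by (intro Bochner_Integration.integral_cong refl) (simp add: Rn)
      finally show ?thesis .
    qed
    have 2: "(\<lambda>n. \<integral>y. Rn n y * \<eta> y \<partial>dV) \<longlonglongrightarrow> (\<integral>y. rep y * \<eta> y \<partial>dV)"
    proof (rule integral_dominated_convergence[OF _ _ iD])
      show "AE y in dV. (\<lambda>n. Rn n y * \<eta> y) \<longlonglongrightarrow> rep y * \<eta> y"
        using lim by eventually_elim (intro tendsto_intros)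
      show "AE y in dV. norm (Rn n y * \<eta> y) \<le> D y" for n
        using bd[of n]
      proof eventually_elim
        case (elim y)
        have "norm (Rn n y * \<eta> y) \<le> norm (Rn n y)" using b[of y] by (auto simp: abs_mult intro!: mult_left_le)
        with elim show ?case by linarith
      qed
    qed measurable
    have "(\<integral>x. u x * \<eta> x \<partial>dV) = (\<integral>y. rep y * \<eta> y \<partial>dV)"
      using LIMSEQ_unique[OF 1] 2 unfolding eq by blast
    moreover have "integrable dV (\<lambda>x. u x * \<eta> x)" "integrable dV (\<lambda>x. rep x * \<eta> x)"
      using b u irep by (auto intro!: integrable_mult_bounded[where B = 1])
    ultimately show "(\<integral>x. (u x - rep x) * \<eta> x \<partial>dV) = 0" by (simp add: left_diff_distrib)
  qed (use u irep in simp)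
  then show ?thesis by eventually_elim simp
qed

end

section \<open>Square integrability of the density\<close>

text \<open>Jensen's inequality with the missing mass \<open>1 - \<integral>w\<close> placed at \<open>g = 0\<close>, hence the summand 1.\<close>

lemma exp_integral_le:
  assumes w: "integrable M w" "\<And>x. 0 \<le> w x" "(\<integral>x. w x \<partial>M) \<le> 1"
    and g: "g \<in> borel_measurable M" "integrable M (\<lambda>x. w x * g x)"
  shows "ennreal (exp (\<integral>x. w x * g x \<partial>M)) \<le> (\<integral>\<^sup>+x. ennreal (w x * exp (g x)) \<partial>M) + 1"
proof (cases "(\<integral>\<^sup>+x. ennreal (w x * exp (g x)) \<partial>M) = \<infinity>")
  case False
  define s where "s = (\<integral>x. w x * g x \<partial>M)"
  define \<mu> where "\<mu> = (\<integral>x. w x \<partial>M)"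
  have [measurable]: "w \<in> borel_measurable M" "g \<in> borel_measurable M" using w g by auto
  have i: "integrable M (\<lambda>x. w x * exp (g x))"
    using False w(2) by (intro integrableI_bounded) (auto simp: top.not_eq_extremum)
  have "exp s * (\<mu> + s - s * \<mu>) = (\<integral>x. exp s * (w x + w x * g x - s * w x) \<partial>M)"
    unfolding s_def \<mu>_def using w(1) g(2) by simp
  also have "\<dots> \<le> (\<integral>x. w x * exp (g x) \<partial>M)"
  proof (rule integral_mono_AE)
    show "AE x in M. exp s * (w x + w x * g x - s * w x) \<le> w x * exp (g x)"
    proof (rule AE_I2)
      fix x
      \<comment> \<open>The tangent to \<open>exp\<close> at \<open>s\<close>, to be averaged over
        the mass \<open>\<mu>\<close>.\<close>
      have "exp s * (1 + (g x - s)) \<le> exp s * exp (g x - s)"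
        by (intro mult_left_mono exp_ge_add_one_self) auto
      also have "\<dots> = exp (g x)" by (simp flip: exp_add)
      finally have "w x * (exp s * (1 + (g x - s))) \<le> w x * exp (g x)" using w(2) by (intro mult_left_mono)
      then show "exp s * (w x + w x * g x - s * w x) \<le> w x * exp (g x)" by (simp add: algebra_simps)
    qed
  qed (use i w(1) g(2) in auto)
  finally have 1: "exp s * (\<mu> + s - s * \<mu>) \<le> (\<integral>x. w x * exp (g x) \<partial>M)" .
  have \<mu>: "0 \<le> \<mu>" "\<mu> \<le> 1" using w unfolding \<mu>_def by auto
  \<comment> \<open>The same tangent evaluated at \<open>g = 0\<close>, to be weighted with the
    missing mass \<open>1 - \<mu>\<close>.\<close>
  have "exp s * (1 + (- s)) \<le> exp s * exp (- s)" by (intro mult_left_mono exp_ge_add_one_self) auto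
  then have "exp s * (1 - s) \<le> 1" by (simp flip: exp_add)
  then have "(1 - \<mu>) * (exp s * (1 - s)) \<le> (1 - \<mu>) * 1" using \<mu> by (intro mult_left_mono) auto
  with 1 \<mu> have "exp s \<le> (\<integral>x. w x * exp (g x) \<partial>M) + 1" by (simp add: algebra_simps)
  moreover have "(\<integral>\<^sup>+x. ennreal (w x * exp (g x)) \<partial>M) = ennreal (\<integral>x. w x * exp (g x) \<partial>M)"
    using w(2) by (intro nn_integral_eq_integral i) auto
  moreover have "(\<integral>x. w x * exp (g x) \<partial>M) \<ge> 0" using w(2) by (intro integral_nonneg_AE) auto
  ultimately show ?thesis unfolding s_def[symmetric] by (simp add: ennreal_leI flip: ennreal_plus ennreal_1)
qed simp

text \<open>Adding \<open>ln 2\<close> makes the kernel nonnegative on the sphere, so that replacing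
  \<open>W\<close> by a smaller density can only lower its potential.\<close>

definition Lk :: "real \<Rightarrow> real" where "Lk t = ln 2 - ln (1 - t)"

lemma measurable_Lk [measurable]: "Lk \<in> borel_measurable borel"
  unfolding Lk_def by measurable

lemma ln_le_ln2: "0 \<le> s \<Longrightarrow> s \<le> 2 \<Longrightarrow> ln s \<le> ln (2::real)"
  by (cases "s = 0") (auto intro: ln_mono)

lemma Lk_nonneg: "x \<in> S2 \<Longrightarrow> y \<in> S2 \<Longrightarrow> 0 \<le> Lk (x \<bullet> y)"
  using inner_S2_diff[of x y] ln_le_ln2[of "1 - x \<bullet> y"] by (simp add: Lk_def)

lemma integral_Lk_cong:
  "a \<in> S2 \<Longrightarrow> integrable dV (\<lambda>x. Lk (x \<bullet> a))"
  "a \<in> S2 \<Longrightarrow> (\<integral>x. Lk (x \<bullet> a) \<partial>dV) = (\<integral>x. Lk (x \<bullet> north_pole) \<partial>dV)"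
  unfolding Lk_def using integrable_ln_inner
  by (simp, intro integral_dV_inner_cong[of _ _ "\<lambda>t. ln 2 - ln (1 - t)"]) (auto simp: poles(1))

lemma nn_integral_exp_Lk:
  assumes a: "a \<in> S2"
  shows "(\<integral>\<^sup>+x. ennreal (exp (Lk (x \<bullet> a) / 4)) \<partial>dV) = ennreal (2 powr (1/4)) * ennreal (2 * pi * (2 powr (3/4) / (3/4)))"
proof -
  have "(\<integral>\<^sup>+x. ennreal (exp (Lk (x \<bullet> a) / 4)) \<partial>dV)
      = (\<integral>\<^sup>+x. ennreal (2 powr (1/4)) * ennreal ((1 - x \<bullet> a) powr (- (1/4))) \<partial>dV)"
  proof (rule nn_integral_cong_AE)
    show "AE x in dV. ennreal (exp (Lk (x \<bullet> a) / 4)) = ennreal (2 powr (1/4)) * ennreal ((1 - x \<bullet> a) powr (- (1/4)))"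
      using AE_dV_inner_less[OF a]
    proof eventually_elim
      case (elim x)
      then have "exp (Lk (x \<bullet> a) / 4) = 2 powr (1/4) * (1 - x \<bullet> a) powr (- (1/4))"
        by (simp add: Lk_def powr_def diff_divide_distrib flip: exp_add)
      then show ?case by (simp add: ennreal_mult)
    qed
  qed
  also have "\<dots> = ennreal (2 powr (1/4)) * ennreal (2 * pi * (2 powr (3/4) / (3/4)))"
    by (subst nn_integral_cmult) (auto simp: nn_integral_dV_powr[OF a])
  finally show ?thesis .
qed

text \<open>Used with \<open>q = T\<^sup>2 / (1 - x \<bullet> y)\<close>. An exponent above
  \<open>1/2\<close> makes the bound \<open>o(T)\<close>, and one below 1 leaves an integrable power
  of \<open>1 - x \<bullet> y\<close>; \<open>3/4\<close> lies in between.\<close>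

lemma ln_one_plus_le_powr:
  assumes "0 \<le> (q::real)"
  shows "ln (1 + q) \<le> 2 * q powr (3/4)"
proof (cases "q \<le> 1")
  case True
  have "ln (1 + q) \<le> q" using assms by (rule ln_add_one_self_le_self)
  also have "q \<le> q powr (3/4)"
  proof (cases "q = 0")
    case False
    then have "q powr 1 \<le> q powr (3/4)" using assms True by (intro powr_mono') auto
    then show ?thesis using False assms by simp
  qed simp
  finally show ?thesis using powr_ge_zero[of q "3/4"] by linarith
next
  case False
  then have q: "q > 1" by simp
  have "ln (1 + q) \<le> ln (2 * q)" using q by (intro ln_mono) auto
  also have "\<dots> = ln 2 + ln q" using q by (simp add: ln_mult)
  also have "ln q = 4/3 * ln (q powr (3/4))" using q by (simp add: ln_powr)
  also have "\<dots> \<le> 4/3 * (q powr (3/4) - 1)" using q by (intro mult_left_mono ln_le_minus_one) auto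
  finally have "ln (1 + q) \<le> ln 2 + 4/3 * (q powr (3/4) - 1)" by simp
  moreover have "a \<le> l + 4/3 * (c - 1) \<Longrightarrow> l < 1 \<Longrightarrow> 0 \<le> c \<Longrightarrow> a \<le> 2 * c" for a l c :: real
    by argo
  ultimately show ?thesis using ln_2_less_1 powr_ge_zero by blast
qed

context liouville_weak
begin

text \<open>The truncation \<open>min (W x) n\<close> has an \<open>Lk\<close>-potential of at most
  \<open>n\<close> times the integral of \<open>Lk\<close>, the same for every \<open>y\<close>;
  only the tail of \<open>W\<close> stays in the exponent. The pole terms are bounded above because
  their weights are positive. The factor \<open>\<rho> / pi\<close> is
  \<open>4 * \<rho> / (4 * pi)\<close>, as \<open>W\<^sup>2\<close> is
  \<open>exp (4 * u) / Z\<^sup>2\<close>.\<close>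

lemma W_AE_le:
  "\<exists>K>0. \<forall>n::nat. AE y in dV. (W y)\<^sup>2 \<le> K * exp (\<rho> / pi * real n * (\<integral>x. Lk (x \<bullet> north_pole) \<partial>dV))
     * exp (\<rho> / pi * (\<integral>x. (W x - min (W x) (real n)) * Lk (x \<bullet> y) \<partial>dV))"
proof -
  define K where "K = exp (4 * mean 0 + 2 * aS * ln 2 + 2 * aN * ln 2) / Z\<^sup>2"
  have S: "AE x in dV. x \<in> S2" by (rule AE_I2) simp
  have "AE y in dV. (W y)\<^sup>2 \<le> K * exp (\<rho> / pi * real n * (\<integral>x. Lk (x \<bullet> north_pole) \<partial>dV))
     * exp (\<rho> / pi * (\<integral>x. (W x - min (W x) (real n)) * Lk (x \<bullet> y) \<partial>dV))" for n :: nat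
    using AE_W_ln AE_rep S
  proof eventually_elim
    case (elim y)
    let ?m = "\<lambda>x. min (W x) (real n)"
    have iL: "integrable dV (\<lambda>x. W x * Lk (x \<bullet> y))"
      unfolding Lk_def right_diff_distrib using elim(1) W by simp
    have b: "0 \<le> ?m x" "?m x \<le> W x" "?m x \<le> real n" for x using W_pos[of x] by auto
    have im: "integrable dV (\<lambda>x. ?m x * Lk (x \<bullet> y))"
    proof (rule Bochner_Integration.integrable_bound[OF iL])
      show "AE x in dV. norm (?m x * Lk (x \<bullet> y)) \<le> norm (W x * Lk (x \<bullet> y))"
        using b(1,2) by (intro AE_I2) (simp add: abs_mult, intro mult_right_mono, auto simp: less_imp_le[OF W_pos])
    qed measurable
    have "(\<integral>x. ?m x * Lk (x \<bullet> y) \<partial>dV) \<le> (\<integral>x. real n * Lk (x \<bullet> y) \<partial>dV)"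
      using b(3) Lk_nonneg[OF _ elim(3)] integral_Lk_cong(1)[OF elim(3)]
      by (intro integral_mono_AE im AE_I2 mult_right_mono) auto
    also have "\<dots> = real n * (\<integral>x. Lk (x \<bullet> north_pole) \<partial>dV)"
      using integral_Lk_cong(2)[OF elim(3)] by simp
    finally have 1: "(\<integral>x. ?m x * Lk (x \<bullet> y) \<partial>dV) \<le> real n * (\<integral>x. Lk (x \<bullet> north_pole) \<partial>dV)" .
    have "- pot y = (\<integral>x. W x * Lk (x \<bullet> y) \<partial>dV) - ln 2"
      unfolding Lk_def right_diff_distrib pot_def using elim(1) W W1 by simp
    moreover have "(\<integral>x. W x * Lk (x \<bullet> y) \<partial>dV)
       = (\<integral>x. ?m x * Lk (x \<bullet> y) \<partial>dV) + (\<integral>x. (W x - ?m x) * Lk (x \<bullet> y) \<partial>dV)"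
      unfolding left_diff_distrib using im iL by simp
    moreover have "ln 2 \<ge> (0::real)" by simp
    ultimately have 2: "- pot y \<le> real n * (\<integral>x. Lk (x \<bullet> north_pole) \<partial>dV) + (\<integral>x. (W x - ?m x) * Lk (x \<bullet> y) \<partial>dV)"
      using 1 by linarith
    have "ln (1 + y $ 3) \<le> ln 2" "ln (1 - y $ 3) \<le> ln 2"
      using S2_height[OF elim(3)] by (auto intro!: ln_le_ln2)
    then have l: "2 * aS * ln (1 + y $ 3) \<le> 2 * aS * ln 2" "2 * aN * ln (1 - y $ 3) \<le> 2 * aN * ln 2"
      using pos by auto
    have "4 * u y = 4 * mean 0 + \<rho> / pi * (- pot y) + 2 * aS * ln (1 + y $ 3) + 2 * aN * ln (1 - y $ 3)"
      unfolding elim(2) rep_def by simp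
    also have "\<dots> \<le> 4 * mean 0 + \<rho> / pi * (real n * (\<integral>x. Lk (x \<bullet> north_pole) \<partial>dV) + (\<integral>x. (W x - ?m x) * Lk (x \<bullet> y) \<partial>dV))
        + 2 * aS * ln 2 + 2 * aN * ln 2"
      using pos by (intro add_mono l mult_left_mono 2) auto
    finally have "exp (4 * u y) \<le> exp \<dots>" by simp
    moreover have "(W y)\<^sup>2 = exp (4 * u y) / Z\<^sup>2"
      by (simp add: W_eq power_divide flip: exp_double)
    ultimately have "(W y)\<^sup>2 \<le> exp (4 * mean 0 + \<rho> / pi * (real n * (\<integral>x. Lk (x \<bullet> north_pole) \<partial>dV) + (\<integral>x. (W x - ?m x) * Lk (x \<bullet> y) \<partial>dV))
        + 2 * aS * ln 2 + 2 * aN * ln 2) / Z\<^sup>2"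
      by (simp add: divide_right_mono)
    also have "\<dots> = K * exp (\<rho> / pi * real n * (\<integral>x. Lk (x \<bullet> north_pole) \<partial>dV))
     * exp (\<rho> / pi * (\<integral>x. (W x - ?m x) * Lk (x \<bullet> y) \<partial>dV))"
    proof -
      have "exp (a + r * (m * J + I) + b + c) / z = exp (a + b + c) / z * exp (r * m * J) * exp (r * I)"
        for a r m J I b c z :: real
        by (simp add: distrib_left add_ac mult.assoc flip: exp_add)
      then show ?thesis unfolding K_def .
    qed
    finally show ?case .
  qed
  moreover have "K > 0" using pos by (simp add: K_def)
  ultimately show ?thesis by blast
qed

lemma tail_tendsto: "(\<lambda>n. \<integral>x. W x - min (W x) (real n) \<partial>dV) \<longlonglongrightarrow> 0"
proof -
  have "(\<lambda>n. \<integral>x. W x - min (W x) (real n) \<partial>dV) \<longlonglongrightarrow> (\<integral>x. 0 \<partial>dV)"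
  proof (rule integral_dominated_convergence[OF _ _ W])
    show "AE x in dV. (\<lambda>n. W x - min (W x) (real n)) \<longlonglongrightarrow> 0"
    proof (rule AE_I2)
      fix x
      obtain m :: nat where m: "W x < m" using reals_Archimedean2 by blast
      have "W x - min (W x) (real n) = 0" if "n \<ge> m" for n
      proof -
        have "W x \<le> real n" using m that by linarith
        then show ?thesis by simp
      qed
      then have "eventually (\<lambda>n. 0 = W x - min (W x) (real n)) sequentially"
        unfolding eventually_sequentially by metis
      then show "(\<lambda>n. W x - min (W x) (real n)) \<longlonglongrightarrow> 0"
        by (rule Lim_transform_eventually[OF tendsto_const])
    qed
    show "AE x in dV. norm (W x - min (W x) (real n)) \<le> W x" for n
      using W_pos by (intro AE_I2) (simp add: less_imp_le)
  qed measurable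
  then show ?thesis by simp
qed

text \<open>The Brezis-Merle argument: only a part of \<open>W\<close> with small mass contributes an
  unbounded logarithmic potential.\<close>

lemma W2_integrable: "integrable dV (\<lambda>x. (W x)\<^sup>2)"
proof -
  \<comment> \<open>Chosen so that \<open>N * (Lk / 4)\<close> is \<open>\<rho> / pi * Lk\<close>. A
    tail of mass below \<open>1 / N\<close> turns \<open>N * W'\<close> into an admissible weight
    for \<open>exp_integral_le\<close>, and \<open>exp (Lk / 4)\<close> is only as singular as the
    power \<open>- (1/4)\<close> of \<open>1 - x \<bullet> y\<close>.\<close>
  define N where "N = 4 * \<rho> / pi"
  have N: "N > 0" using pos by (simp add: N_def)
  obtain n :: nat where n: "(\<integral>x. W x - min (W x) (real n) \<partial>dV) < 1 / N"
    using order_tendstoD(2)[OF tail_tendsto, of "1 / N"] N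
    unfolding eventually_sequentially by auto
  define W' where "W' x = W x - min (W x) (real n)" for x
  have n': "(\<integral>x. W' x \<partial>dV) < 1 / N" using n unfolding W'_def .
  have W': "0 \<le> W' x" "W' x \<le> W x" for x using W_pos[of x] by (auto simp: W'_def)
  have [measurable]: "W' \<in> borel_measurable dV" unfolding W'_def by measurable
  have iW': "integrable dV W'"
    by (rule Bochner_Integration.integrable_bound[OF W]) (use W' W_pos in \<open>auto simp: less_imp_le\<close>)
  obtain K where K: "K > 0" "AE y in dV. (W y)\<^sup>2 \<le> K * exp (\<rho> / pi * real n * (\<integral>x. Lk (x \<bullet> north_pole) \<partial>dV))
     * exp (\<rho> / pi * (\<integral>x. W' x * Lk (x \<bullet> y) \<partial>dV))"
    unfolding W'_def using W_AE_le by blast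
  define K' where "K' = K * exp (\<rho> / pi * real n * (\<integral>x. Lk (x \<bullet> north_pole) \<partial>dV))"
  have K': "K' > 0" using K by (simp add: K'_def)
  define c where "c = ennreal (2 powr (1/4)) * ennreal (2 * pi * (2 powr (3/4) / (3/4)))"
  have S: "AE x in dV. x \<in> S2" by (rule AE_I2) simp
  define h where "h y = (\<integral>\<^sup>+x. ennreal (N * W' x * exp (Lk (x \<bullet> y) / 4)) \<partial>dV)" for y
  have [measurable]: "h \<in> borel_measurable dV" unfolding h_def by measurable
  have bd: "AE y in dV. ennreal ((W y)\<^sup>2) \<le> ennreal K' * (h y + 1)"
    using AE_W_ln K(2) S
  proof eventually_elim
    case (elim y)
    have i: "integrable dV (\<lambda>x. W' x * Lk (x \<bullet> y))"
    proof (rule Bochner_Integration.integrable_bound)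
      show "integrable dV (\<lambda>x. W x * Lk (x \<bullet> y))"
        unfolding Lk_def right_diff_distrib using elim(1) W by simp
      show "AE x in dV. norm (W' x * Lk (x \<bullet> y)) \<le> norm (W x * Lk (x \<bullet> y))"
        using W' by (intro AE_I2) (simp add: abs_mult, intro mult_right_mono, auto simp: less_imp_le[OF W_pos])
    qed measurable
    have "(\<integral>x. N * W' x * (Lk (x \<bullet> y) / 4) \<partial>dV) = (\<integral>x. N / 4 * (W' x * Lk (x \<bullet> y)) \<partial>dV)"
      by (intro Bochner_Integration.integral_cong) auto
    also have "\<dots> = \<rho> / pi * (\<integral>x. W' x * Lk (x \<bullet> y) \<partial>dV)" by (simp add: N_def)
    finally have e: "(\<integral>x. N * W' x * (Lk (x \<bullet> y) / 4) \<partial>dV) = \<rho> / pi * (\<integral>x. W' x * Lk (x \<bullet> y) \<partial>dV)" .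
    have "ennreal (exp (\<integral>x. N * W' x * (Lk (x \<bullet> y) / 4) \<partial>dV)) \<le> h y + 1"
      unfolding h_def
    proof (rule exp_integral_le)
      show "(\<integral>x. N * W' x \<partial>dV) \<le> 1" using n' N by (simp add: field_simps)
      show "integrable dV (\<lambda>x. N * W' x * (Lk (x \<bullet> y) / 4))"
        using integrable_mult_right[OF i, of "N / 4"] by (simp add: mult.assoc)
    qed (use N W' iW' in auto)
    then have "ennreal K' * ennreal (exp (\<rho> / pi * (\<integral>x. W' x * Lk (x \<bullet> y) \<partial>dV))) \<le> ennreal K' * (h y + 1)"
      unfolding e by (intro mult_left_mono) auto
    moreover have "ennreal ((W y)\<^sup>2) \<le> ennreal K' * ennreal (exp (\<rho> / pi * (\<integral>x. W' x * Lk (x \<bullet> y) \<partial>dV)))"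
      using elim(2) K' unfolding K'_def by (subst ennreal_mult[symmetric]) (auto intro!: ennreal_leI)
    ultimately show ?case by (rule order_trans[rotated])
  qed
  \<comment> \<open>Tonelli: the \<open>y\<close>-integral of the kernel is the constant
    \<open>c\<close> for every \<open>x\<close>, which leaves the finite mass of
    \<open>N * W'\<close>.\<close>
  have "(\<integral>\<^sup>+y. h y \<partial>dV) = (\<integral>\<^sup>+x. \<integral>\<^sup>+y. ennreal (N * W' x * exp (Lk (x \<bullet> y) / 4)) \<partial>dV \<partial>dV)"
    unfolding h_def by (rule dVdV.Fubini') measurable
  also have "\<dots> = (\<integral>\<^sup>+x. ennreal (N * W' x) * (\<integral>\<^sup>+y. ennreal (exp (Lk (y \<bullet> x) / 4)) \<partial>dV) \<partial>dV)"
    using N W' by (intro nn_integral_cong, subst nn_integral_cmult[symmetric])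
      (auto simp: ennreal_mult' inner_commute intro!: nn_integral_cong)
  also have "\<dots> = (\<integral>\<^sup>+x. ennreal (N * W' x) * c \<partial>dV)"
    by (intro nn_integral_cong) (simp add: nn_integral_exp_Lk c_def)
  also have "\<dots> = (\<integral>\<^sup>+x. ennreal (N * W' x) \<partial>dV) * c" by (rule nn_integral_multc) measurable
  also have "(\<integral>\<^sup>+x. ennreal (N * W' x) \<partial>dV) = ennreal (\<integral>x. N * W' x \<partial>dV)"
    using N W' iW' by (intro nn_integral_eq_integral) auto
  finally have hf: "(\<integral>\<^sup>+y. h y \<partial>dV) < \<infinity>"
    by (simp add: c_def ennreal_mult_less_top)
  have "(\<integral>\<^sup>+y. ennreal ((W y)\<^sup>2) \<partial>dV) \<le> (\<integral>\<^sup>+y. ennreal K' * (h y + 1) \<partial>dV)"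
    using bd by (rule nn_integral_mono_AE)
  also have "\<dots> = ennreal K' * ((\<integral>\<^sup>+y. h y \<partial>dV) + emeasure dV S2)"
    by (subst nn_integral_cmult) (auto simp: nn_integral_add)
  also have "\<dots> < \<infinity>" using hf by (simp add: ennreal_mult_less_top emeasure_dV)
  finally show ?thesis by (intro integrableI_bounded) auto
qed

end

section \<open>The Kazdan-Warner identity\<close>

context liouville_weak
begin

text \<open>Splitting the product into \<open>W\<^sup>2\<close> and the squared logarithm controls
  the potential at every \<open>y\<close>, not merely at almost every one, by a constant free of
  \<open>y\<close>. This makes \<open>pot\<close> usable at the moved points
  \<open>mobius T x\<close>.\<close>

lemma W_ln_bound:
  assumes y: "y \<in> S2"
  shows "integrable dV (\<lambda>x. W x * ln (1 - x \<bullet> y))"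
    and "(\<integral>x. \<bar>W x * ln (1 - x \<bullet> y)\<bar> \<partial>dV) \<le> (\<integral>x. (W x)\<^sup>2 + 16 * (1 - x \<bullet> north_pole) powr (- (1/2)) \<partial>dV)"
proof -
  have nn: "(\<integral>\<^sup>+x. ennreal ((1 - x \<bullet> a) powr (- (1/2))) \<partial>dV) < \<infinity>" if "a \<in> S2" for a
    using nn_integral_dV_powr[OF that, of "- (1/2)"] by simp
  have ip: "integrable dV (\<lambda>x. (1 - x \<bullet> a) powr (- (1/2)))" if "a \<in> S2" for a
    using nn[OF that] by (intro integrableI_bounded) auto
  have i: "integrable dV (\<lambda>x. (W x)\<^sup>2 + 16 * (1 - x \<bullet> y) powr (- (1/2)))"
    using W2_integrable ip[OF y] by simp
  have b: "\<bar>W x * ln (1 - x \<bullet> y)\<bar> \<le> (W x)\<^sup>2 + 16 * (1 - x \<bullet> y) powr (- (1/2))" if x: "x \<in> S2" for x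
  proof -
    have "\<bar>W x * ln (1 - x \<bullet> y)\<bar> \<le> (W x)\<^sup>2 + (ln (1 - x \<bullet> y))\<^sup>2"
    proof -
      have "0 \<le> (\<bar>W x\<bar> - \<bar>ln (1 - x \<bullet> y)\<bar>)\<^sup>2" by simp
      then have "2 * (\<bar>W x\<bar> * \<bar>ln (1 - x \<bullet> y)\<bar>) \<le> (W x)\<^sup>2 + (ln (1 - x \<bullet> y))\<^sup>2"
        by (simp add: power2_diff)
      moreover have "0 \<le> \<bar>W x\<bar> * \<bar>ln (1 - x \<bullet> y)\<bar>" by simp
      ultimately show ?thesis unfolding abs_mult by linarith
    qed
    also have "(ln (1 - x \<bullet> y))\<^sup>2 \<le> (4 * (1 - x \<bullet> y) powr (- (1/4)))\<^sup>2"
      using abs_ln_le_powr[of "1 - x \<bullet> y"] inner_S2_diff[OF x y]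
      by (intro abs_le_square_iff[THEN iffD1]) auto
    also have "(4 * (1 - x \<bullet> y) powr (- (1/4)))\<^sup>2 = 16 * (1 - x \<bullet> y) powr (- (1/2))"
      by (simp add: power_mult_distrib power2_eq_square flip: powr_add)
    finally show ?thesis by simp
  qed
  show iW: "integrable dV (\<lambda>x. W x * ln (1 - x \<bullet> y))"
    by (rule Bochner_Integration.integrable_bound[OF i])
      (measurable, use b in \<open>intro AE_I2, force\<close>)
  have "(\<integral>x. \<bar>W x * ln (1 - x \<bullet> y)\<bar> \<partial>dV) \<le> (\<integral>x. (W x)\<^sup>2 + 16 * (1 - x \<bullet> y) powr (- (1/2)) \<partial>dV)"
    using b by (intro integral_mono_AE integrable_abs iW i AE_I2) auto
  also have "\<dots> = (\<integral>x. (W x)\<^sup>2 + 16 * (1 - x \<bullet> north_pole) powr (- (1/2)) \<partial>dV)"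
    using W2_integrable ip[OF y] ip[OF poles(1)]
      integral_dV_inner_cong[OF y poles(1), of "\<lambda>t. 16 * (1 - t) powr (- (1/2))"] by simp
  finally show "(\<integral>x. \<bar>W x * ln (1 - x \<bullet> y)\<bar> \<partial>dV) \<le> (\<integral>x. (W x)\<^sup>2 + 16 * (1 - x \<bullet> north_pole) powr (- (1/2)) \<partial>dV)" .
qed

definition pot_bound :: real where
  "pot_bound = (\<integral>x. (W x)\<^sup>2 + 16 * (1 - x \<bullet> north_pole) powr (- (1/2)) \<partial>dV)"

lemma pot_bounded: "y \<in> S2 \<Longrightarrow> \<bar>pot y\<bar> \<le> pot_bound"
  unfolding pot_def pot_bound_def
  by (rule order_trans[OF integral_abs_bound W_ln_bound(2)])

text \<open>After \<open>W x * W y \<le> (W x)\<^sup>2 + (W y)\<^sup>2\<close> each summand involves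
  \<open>W\<close> at one point only, and the exponent \<open>- (3/4)\<close> is above the
  integrability threshold \<open>- 1\<close>.\<close>

lemma WW_integrable:
  "integrable (dV \<Otimes>\<^sub>M dV) (\<lambda>(x, y). W x * W y * (1 - x \<bullet> y) powr (- (3/4)))"
proof -
  have *: "integrable (dV \<Otimes>\<^sub>M dV) (\<lambda>(x, y). (W x)\<^sup>2 * (1 - x \<bullet> y) powr (- (3/4)))"
    by (rule kernel_integrable[OF W2_integrable, of "\<lambda>t. (1 - t) powr (- (3/4))" "2 * pi * (2 powr (1/4) / (1/4))"])
      (auto simp: nn_integral_dV_powr)
  have "integrable (dV \<Otimes>\<^sub>M dV) (\<lambda>(x, y). (W y)\<^sup>2 * (1 - x \<bullet> y) powr (- (3/4)))"
    using dVdV.integrable_product_swap[OF *] by (simp add: case_prod_beta inner_commute)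
  with * have "integrable (dV \<Otimes>\<^sub>M dV) (\<lambda>p. (case p of (x, y) \<Rightarrow> (W x)\<^sup>2 * (1 - x \<bullet> y) powr (- (3/4)))
      + (case p of (x, y) \<Rightarrow> (W y)\<^sup>2 * (1 - x \<bullet> y) powr (- (3/4))))"
    by (rule Bochner_Integration.integrable_add)
  then show ?thesis
  proof (rule Bochner_Integration.integrable_bound)
    show "AE p in dV \<Otimes>\<^sub>M dV. norm (case p of (x, y) \<Rightarrow> W x * W y * (1 - x \<bullet> y) powr (- (3/4)))
      \<le> norm ((case p of (x, y) \<Rightarrow> (W x)\<^sup>2 * (1 - x \<bullet> y) powr (- (3/4)))
        + (case p of (x, y) \<Rightarrow> (W y)\<^sup>2 * (1 - x \<bullet> y) powr (- (3/4))))"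
    proof (rule AE_I2, clarify)
      fix x y
      have "0 \<le> (W x - W y)\<^sup>2" "0 \<le> W x * W y" using W_pos by (auto simp: less_imp_le)
      then have "W x * W y \<le> (W x)\<^sup>2 + (W y)\<^sup>2" unfolding power2_diff by linarith
      then have "W x * W y * (1 - x \<bullet> y) powr (- (3/4)) \<le> ((W x)\<^sup>2 + (W y)\<^sup>2) * (1 - x \<bullet> y) powr (- (3/4))"
        by (intro mult_right_mono) auto
      then show "norm (W x * W y * (1 - x \<bullet> y) powr (- (3/4)))
        \<le> norm ((W x)\<^sup>2 * (1 - x \<bullet> y) powr (- (3/4)) + (W y)\<^sup>2 * (1 - x \<bullet> y) powr (- (3/4)))"
        using \<open>0 \<le> W x * W y\<close> by (simp add: distrib_right)
    qed
  qed measurable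
qed

section \<open>The convexity inequality along the flow\<close>

definition energy :: real where
  "energy = (\<integral>p. (case p of (x, y) \<Rightarrow> W x * W y * (1 - x \<bullet> y) powr (- (3/4))) \<partial>(dV \<Otimes>\<^sub>M dV))"

text \<open>\<open>1 + T * x $ 3\<close> is the denominator of \<open>mobius\<close>. Its logarithm
  arises from the Jacobian, from the pole terms and from the kernel.\<close>

definition ell :: "real \<Rightarrow> real" where
  "ell T = (\<integral>x. W x * ln (1 + T * x $ 3) \<partial>dV)"

lemma measurable_height [measurable]: "(\<lambda>x::real ^ 3. x $ 3) \<in> borel_measurable dV"
  by measurable

lemma ln_height_bound:
  assumes T: "\<bar>T\<bar> < 1" and x: "x \<in> S2"
  shows "\<bar>ln (1 + T * x $ 3)\<bar> \<le> \<bar>ln (1 - \<bar>T\<bar>)\<bar> + ln 2"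
proof -
  have "\<bar>T * x $ 3\<bar> \<le> \<bar>T\<bar> * 1" unfolding abs_mult using S2_height[OF x] by (intro mult_left_mono) auto
  then have "1 - \<bar>T\<bar> \<le> 1 + T * x $ 3" "1 + T * x $ 3 \<le> 2" using T by linarith+
  then have "ln (1 - \<bar>T\<bar>) \<le> ln (1 + T * x $ 3)" "ln (1 + T * x $ 3) \<le> ln 2"
    using T by (auto intro!: ln_mono)
  moreover have "0 \<le> ln (2::real)" by simp
  ultimately show ?thesis by linarith
qed

lemma W_height_integrable:
  assumes T: "\<bar>T\<bar> < 1"
  shows "integrable dV (\<lambda>x. W x * ln (1 + T * x $ 3))"
  by (rule integrable_mult_bounded[OF W _ ln_height_bound[OF T]]) measurable

definition pot_diff :: "real \<Rightarrow> real" where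
  "pot_diff T = (\<integral>x. W x * (pot (mobius T x) - pot x) \<partial>dV)"

lemma W_pot_integrable:
  assumes T: "\<bar>T\<bar> < 1"
  shows "integrable dV (\<lambda>x. W x * pot (mobius T x))" "integrable dV (\<lambda>x. W x * pot x)"
proof -
  have [measurable]: "(\<lambda>x. pot (mobius T x)) \<in> borel_measurable dV"
    by (rule measurable_compose[OF measurable_mobius_dV[OF T] measurable_pot])
  show "integrable dV (\<lambda>x. W x * pot (mobius T x))" "integrable dV (\<lambda>x. W x * pot x)"
    by (rule integrable_mult_bounded[OF W, where B = pot_bound];
      use pot_bounded mobius_S2[OF _ T] in simp)+
qed

text \<open>\<open>b\<close> is the exponent of the convexity argument, written out through
  \<open>rep\<close>. The coefficient \<open>aS + aN + 2\<close> of \<open>ell T\<close> counts one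
  denominator for each pole term, with its weight, and two from the Jacobian.\<close>

lemma jensen_mobius:
  assumes T: "\<bar>T\<bar> < 1"
  shows "aS * ln (1 + T) + aN * ln (1 - T) + ln (1 - T\<^sup>2) - (aS + aN + 2) * ell T \<le> \<rho> / (2 * pi) * pot_diff T"
proof -
  \<comment> \<open>\<open>V\<close> is the version of \<open>W\<close> that \<open>rep\<close>
    defines at every point. It is \<open>V\<close> that gets composed with the flow, so equality
    almost everywhere is used only at unmoved points.\<close>
  define V where "V x = exp (2 * rep x) / Z" for x
  define b where "b x = - (\<rho> / (2 * pi)) * (pot (mobius T x) - pot x) + aS * (ln (1 + T) - ln (1 + T * x $ 3))
     + aN * (ln (1 - T) - ln (1 + T * x $ 3)) + ln (1 - T\<^sup>2) - 2 * ln (1 + T * x $ 3)" for x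
  have [measurable]: "V \<in> borel_measurable dV" unfolding V_def by measurable
  have [measurable]: "(\<lambda>x. pot (mobius T x)) \<in> borel_measurable dV"
    by (rule measurable_compose[OF measurable_mobius_dV[OF T] measurable_pot])
  have [measurable]: "b \<in> borel_measurable dV" unfolding b_def by measurable
  have WV: "AE x in dV. W x = V x"
    using AE_rep by eventually_elim (simp add: W_eq V_def)
  have S: "AE x in dV. x \<in> S2" by (rule AE_I2) simp
  have less: "AE x in dV. x \<bullet> south_pole < 1 \<and> x \<bullet> north_pole < 1"
    using AE_dV_inner_less[OF poles(1)] AE_dV_inner_less[OF poles(2)] by eventually_elim simp
  have T1: "0 < 1 + T" "0 < 1 - T" "0 < 1 - T\<^sup>2" using T by (auto simp: abs_square_less_1)
  have eq: "AE x in dV. V (mobius T x) * ((1 - T\<^sup>2) / (1 + T * x $ 3)\<^sup>2) = W x * exp (b x)"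
    using WV S less
  proof eventually_elim
    case (elim x)
    let ?z = "x $ 3" and ?d = "1 + T * x $ 3"
    have z: "0 < 1 + ?z" "0 < 1 - ?z" using elim by (auto simp: poles)
    have d: "0 < ?d" by (rule mobius_denom_pos[OF elim(2) T])
    \<comment> \<open>The flow fixes the poles, so each of \<open>1 + ?z\<close> and
      \<open>1 - ?z\<close> is merely multiplied by an explicit positive factor, and the singular
      logarithms cancel in the difference of \<open>rep\<close>.\<close>
    have e: "1 + (?z + T) / ?d = (1 + T) * (1 + ?z) / ?d" "1 - (?z + T) / ?d = (1 - T) * (1 - ?z) / ?d"
      using d by (simp_all add: field_simps)
    have l: "ln (1 + mobius T x $ 3) = ln (1 + T) + ln (1 + ?z) - ln ?d"
      "ln (1 - mobius T x $ 3) = ln (1 - T) + ln (1 - ?z) - ln ?d"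
      unfolding mobius_nth e using T1 z d by (simp_all add: ln_mult ln_div)
    have "ln ((1 - T\<^sup>2) / ?d\<^sup>2) = ln (1 - T\<^sup>2) - 2 * ln ?d"
      using T1 d by (simp add: ln_div ln_realpow)
    then have b: "b x = 2 * rep (mobius T x) - 2 * rep x + ln ((1 - T\<^sup>2) / ?d\<^sup>2)"
      unfolding b_def rep_def l by (simp add: algebra_simps)
    have "exp (b x) = exp (2 * rep (mobius T x)) / exp (2 * rep x) * ((1 - T\<^sup>2) / ?d\<^sup>2)"
      unfolding b exp_add exp_diff using T1 d by simp
    then show ?case unfolding elim(1) V_def by simp
  qed
  have "(\<integral>\<^sup>+x. ennreal (W x * exp (b x)) \<partial>dV) = (\<integral>\<^sup>+x. ennreal (V (mobius T x)) * ennreal ((1 - T\<^sup>2) / (1 + T * x $ 3)\<^sup>2) \<partial>dV)"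
  proof (rule nn_integral_cong_AE)
    show "AE x in dV. ennreal (W x * exp (b x)) = ennreal (V (mobius T x)) * ennreal ((1 - T\<^sup>2) / (1 + T * x $ 3)\<^sup>2)"
      using eq
    proof eventually_elim
      case (elim x)
      have "0 \<le> V (mobius T x)" using pos by (simp add: V_def)
      then show ?case unfolding elim[symmetric] by (rule ennreal_mult'[OF _])
    qed
  qed
  also have "\<dots> = (\<integral>\<^sup>+x. ennreal (V x) \<partial>dV)"
    by (rule nn_integral_mobius[OF _ T, of "\<lambda>x. ennreal (V x)"]) measurable
  also have "\<dots> = (\<integral>\<^sup>+x. ennreal (W x) \<partial>dV)"
    using WV by (intro nn_integral_cong_AE) auto
  also have "\<dots> = ennreal 1"
    using W W1 W_pos by (subst nn_integral_eq_integral) (auto simp: less_imp_le)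
  finally have "has_bochner_integral dV (\<lambda>x. W x * exp (b x)) 1"
    using W_pos by (intro has_bochner_integral_nn_integral) (auto simp: less_imp_le)
  then have ie: "integrable dV (\<lambda>x. W x * exp (b x))" "(\<integral>x. W x * exp (b x) \<partial>dV) = 1"
    by (auto simp: has_bochner_integral_iff)
  note ints = W W_pot_integrable[OF T] W_height_integrable[OF T]
  have Wb: "W x * b x = - (\<rho> / (2 * pi)) * (W x * (pot (mobius T x) - pot x))
     + (aS * ln (1 + T) + aN * ln (1 - T) + ln (1 - T\<^sup>2)) * W x - (aS + aN + 2) * (W x * ln (1 + T * x $ 3))" for x
    unfolding b_def by (simp add: algebra_simps)
  have ip: "integrable dV (\<lambda>x. W x * (pot (mobius T x) - pot x))"
    unfolding right_diff_distrib using ints by simp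
  have ib: "integrable dV (\<lambda>x. W x * b x)"
    unfolding Wb using ints ip by simp
  have "(\<integral>x. W x * b x \<partial>dV) + 1 = (\<integral>x. W x * b x + W x \<partial>dV)"
    using ib W W1 by simp
  also have "\<dots> \<le> (\<integral>x. W x * exp (b x) \<partial>dV)"
  proof (rule integral_mono_AE)
    show "AE x in dV. W x * b x + W x \<le> W x * exp (b x)"
    proof (rule AE_I2)
      fix x
      have "W x * (1 + b x) \<le> W x * exp (b x)" using W_pos[of x] by (intro mult_left_mono exp_ge_add_one_self) auto
      then show "W x * b x + W x \<le> W x * exp (b x)" by (simp add: algebra_simps)
    qed
  qed (use ib W ie in auto)
  finally have "(\<integral>x. W x * b x \<partial>dV) \<le> 0" using ie by simp
  also have "(\<integral>x. W x * b x \<partial>dV) = - (\<rho> / (2 * pi)) * pot_diff T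
     + (aS * ln (1 + T) + aN * ln (1 - T) + ln (1 - T\<^sup>2)) - (aS + aN + 2) * ell T"
    unfolding Wb pot_diff_def ell_def using ints ip W1 by simp
  finally show ?thesis by simp
qed

text \<open>Cleared of its denominator, the moved kernel is symmetric in \<open>x\<close> and
  \<open>y\<close> except for the last term, which changes sign under exchange; this is what makes
  symmetrisation effective.\<close>

lemma mobius_inner:
  assumes x: "x \<in> S2" and T: "\<bar>T\<bar> < 1"
  shows "(1 - y \<bullet> mobius T x) * (1 + T * x $ 3)
    = 1 - sqrt (1 - T\<^sup>2) * (x \<bullet> y - x $ 3 * y $ 3) - x $ 3 * y $ 3 + T * (x $ 3 - y $ 3)"
proof -
  define d where "d = 1 + T * x $ 3"
  have d: "d > 0" using mobius_denom_pos[OF x T] by (simp add: d_def)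
  have "(y \<bullet> mobius T x) * d = sqrt (1 - T\<^sup>2) * (x \<bullet> y - x $ 3 * y $ 3) + (x $ 3 + T) * y $ 3"
    unfolding inner_vec_def sum_3 inner_real_def mobius_nth d_def[symmetric]
    using d by (simp add: field_simps)
  then have "(1 - y \<bullet> mobius T x) * d = d - (sqrt (1 - T\<^sup>2) * (x \<bullet> y - x $ 3 * y $ 3) + (x $ 3 + T) * y $ 3)"
    by (simp add: left_diff_distrib)
  then show ?thesis unfolding d_def by (simp add: algebra_simps)
qed

text \<open>The second difference of the logarithmic kernel along the flow. Only an upper bound
  that is \<open>o(T)\<close> and integrable is needed.\<close>

lemma second_difference:
  assumes x: "x \<in> S2" and y: "y \<in> S2" and T: "\<bar>T\<bar> < 1"
    and less: "x \<bullet> y < 1" "y \<bullet> mobius T x < 1" "x \<bullet> mobius T y < 1"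
  shows "ln (1 - y \<bullet> mobius T x) + ln (1 - x \<bullet> mobius T y) - 2 * ln (1 - x \<bullet> y)
    \<le> 4 * (\<bar>T\<bar> powr (3/2) * (1 - x \<bullet> y) powr (- (3/4))) - ln (1 + T * x $ 3) - ln (1 + T * y $ 3)"
proof -
  define \<kappa> where "\<kappa> = sqrt (1 - T\<^sup>2)"
  define c where "c = x \<bullet> y - x $ 3 * y $ 3"
  \<comment> \<open>\<open>A\<close> and \<open>B\<close> are the symmetric and the antisymmetric
    part, so the two moved kernels multiply to \<open>A\<^sup>2 - B\<^sup>2\<close>; the first-order
    quantity \<open>B\<close> enters with a favourable sign and is dropped.\<close>
  define A where "A = 1 - \<kappa> * c - x $ 3 * y $ 3"
  define B where "B = T * (x $ 3 - y $ 3)"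
  define D where "D = 1 - x \<bullet> y"
  have D: "D > 0" using less by (simp add: D_def)
  have dx: "0 < 1 + T * x $ 3" and dy: "0 < 1 + T * y $ 3"
    using mobius_denom_pos x y T by auto
  have mx: "(1 - y \<bullet> mobius T x) * (1 + T * x $ 3) = A + B"
    using mobius_inner[OF x T, of y] by (simp add: A_def B_def c_def \<kappa>_def)
  have my: "(1 - x \<bullet> mobius T y) * (1 + T * y $ 3) = A - B"
    using mobius_inner[OF y T, of x] by (simp add: A_def B_def c_def \<kappa>_def inner_commute algebra_simps)
  have AB: "0 < A + B" "0 < A - B"
    unfolding mx[symmetric] my[symmetric] using less dx dy by auto
  have A: "A > 0" using AB by linarith
  have T2: "0 < 1 - T\<^sup>2" using T by (simp add: abs_square_less_1)
  have "1 - T\<^sup>2 \<le> \<kappa>"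
  proof -
    have "(1 - T\<^sup>2)\<^sup>2 \<le> 1 - T\<^sup>2" using T2 by (simp add: power2_eq_square mult_left_le)
    then show ?thesis unfolding \<kappa>_def by (rule real_le_rsqrt)
  qed
  then have k3: "1 - \<kappa> \<le> T\<^sup>2" by (simp add: algebra_simps)
  have k2: "\<kappa> \<le> 1" unfolding \<kappa>_def by simp
  have c1: "c \<le> 1"
  proof -
    have "c = x $ 1 * y $ 1 + x $ 2 * y $ 2" by (simp add: c_def inner_vec_def sum_3)
    moreover have "0 \<le> (x $ 1 - y $ 1)\<^sup>2 + (x $ 2 - y $ 2)\<^sup>2" by simp
    moreover have "(x $ 1)\<^sup>2 + (x $ 2)\<^sup>2 + (x $ 3)\<^sup>2 = 1" "(y $ 1)\<^sup>2 + (y $ 2)\<^sup>2 + (y $ 3)\<^sup>2 = 1"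
      using x y by (auto simp: in_S2_nth)
    moreover have "0 \<le> (x $ 3)\<^sup>2" "0 \<le> (y $ 3)\<^sup>2" by auto
    ultimately show ?thesis unfolding power2_diff by linarith
  qed
  have "(1 - \<kappa>) * c \<le> (1 - \<kappa>) * 1" using k2 c1 by (intro mult_left_mono) auto
  \<comment> \<open>\<open>A\<close> differs from the unmoved kernel \<open>D\<close> only through
    \<open>1 - \<kappa>\<close>, which is of second order in \<open>T\<close>.\<close>
  moreover have "A = D + (1 - \<kappa>) * c" by (simp add: A_def D_def c_def algebra_simps)
  ultimately have AD: "A \<le> D + T\<^sup>2" using k3 by simp
  have "ln (1 - y \<bullet> mobius T x) + ln (1 + T * x $ 3) + (ln (1 - x \<bullet> mobius T y) + ln (1 + T * y $ 3)) = ln (A + B) + ln (A - B)"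
    unfolding mx[symmetric] my[symmetric] using less dx dy by (simp add: ln_mult)
  also have "\<dots> = ln (A\<^sup>2 - B\<^sup>2)"
    using AB by (subst ln_mult_pos[symmetric]) (auto simp: power2_eq_square algebra_simps)
  also have "\<dots> \<le> ln ((D + T\<^sup>2)\<^sup>2)"
  proof (rule ln_mono)
    show "0 < A\<^sup>2 - B\<^sup>2" using mult_pos_pos[OF AB] by (simp add: power2_eq_square algebra_simps)
    have "A\<^sup>2 \<le> (D + T\<^sup>2)\<^sup>2" using A AD by (intro power_mono) auto
    then show "A\<^sup>2 - B\<^sup>2 \<le> (D + T\<^sup>2)\<^sup>2" using zero_le_power2[of B] by linarith
  qed
  also have "\<dots> = 2 * ln (D * (1 + T\<^sup>2 / D))"
    using D by (simp add: ln_realpow add_pos_nonneg distrib_left)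
  also have "\<dots> = 2 * ln D + 2 * ln (1 + T\<^sup>2 / D)"
    using D by (subst ln_mult_pos) (auto simp: add_pos_nonneg)
  also have "ln (1 + T\<^sup>2 / D) \<le> 2 * (T\<^sup>2 / D) powr (3/4)"
    using D by (intro ln_one_plus_le_powr) auto
  also have "(T\<^sup>2 / D) powr (3/4) = \<bar>T\<bar> powr (3/2) * D powr (- (3/4))"
  proof (cases "T = 0")
    case False
    have "(T\<^sup>2 / D) powr (3/4) = T\<^sup>2 powr (3/4) * D powr (- (3/4))"
      using D by (simp add: powr_divide powr_minus_divide)
    also have "T\<^sup>2 powr (3/4) = (\<bar>T\<bar> powr 2) powr (3/4)" using False by (simp add: powr_numeral)
    also have "\<dots> = \<bar>T\<bar> powr (3/2)" by (simp only: powr_powr) simp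
    finally show ?thesis .
  qed simp
  finally show ?thesis unfolding D_def by simp
qed

text \<open>\<open>pot_diff T\<close> is the double integral of \<open>q\<close>, hence also that of
  its average with exchanged variables, to which \<open>second_difference\<close> applies. The
  logarithms there integrate to \<open>ell T\<close> because the other factor of \<open>W\<close>
  has mass 1.\<close>

lemma pot_diff_le:
  assumes T: "\<bar>T\<bar> < 1"
  shows "pot_diff T \<le> 2 * \<bar>T\<bar> powr (3/2) * energy - ell T"
proof -
  have [measurable]: "mobius T \<in> borel_measurable dV" by measurable
  define q where "q x y = W x * W y * (ln (1 - y \<bullet> mobius T x) - ln (1 - x \<bullet> y))" for x y
  have [measurable]: "(\<lambda>(x, y). q x y) \<in> borel_measurable (dV \<Otimes>\<^sub>M dV)" unfolding q_def by measurable
  have q_int: "integrable dV (q x)" and q_eq: "(\<integral>y. q x y \<partial>dV) = W x * (pot (mobius T x) - pot x)"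
    and q_bd: "(\<integral>y. \<bar>q x y\<bar> \<partial>dV) \<le> W x * (2 * pot_bound)" if x: "x \<in> S2" for x
  proof -
    note i1 = W_ln_bound[OF mobius_S2[OF x T], folded pot_bound_def]
    note i2 = W_ln_bound[OF x, folded pot_bound_def]
    have q: "q x y = W x * (W y * ln (1 - y \<bullet> mobius T x) - W y * ln (1 - y \<bullet> x))" for y
      unfolding q_def by (simp add: algebra_simps inner_commute)
    show "integrable dV (q x)" unfolding q using i1(1) i2(1) by simp
    show "(\<integral>y. q x y \<partial>dV) = W x * (pot (mobius T x) - pot x)"
      unfolding q pot_def using i1(1) i2(1) by simp
    have "(\<integral>y. \<bar>q x y\<bar> \<partial>dV) \<le> (\<integral>y. W x * (\<bar>W y * ln (1 - y \<bullet> mobius T x)\<bar> + \<bar>W y * ln (1 - y \<bullet> x)\<bar>) \<partial>dV)"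
    proof (rule integral_mono_AE)
      show "integrable dV (\<lambda>y. \<bar>q x y\<bar>)" unfolding q using i1(1) i2(1) by simp
      show "integrable dV (\<lambda>y. W x * (\<bar>W y * ln (1 - y \<bullet> mobius T x)\<bar> + \<bar>W y * ln (1 - y \<bullet> x)\<bar>))"
        using i1(1) i2(1) by simp
      show "AE y in dV. \<bar>q x y\<bar> \<le> W x * (\<bar>W y * ln (1 - y \<bullet> mobius T x)\<bar> + \<bar>W y * ln (1 - y \<bullet> x)\<bar>)"
        unfolding q using W_pos[of x] by (intro AE_I2) (simp add: abs_mult[of "W x"] abs_triangle_ineq4)
    qed
    also have "\<dots> \<le> W x * (2 * pot_bound)"
      using i1 i2 W_pos[of x] by simp
    finally show "(\<integral>y. \<bar>q x y\<bar> \<partial>dV) \<le> W x * (2 * pot_bound)" .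
  qed
  \<comment> \<open>Absolute integrability, needed to exchange the variables, comes from the bound
    of the inner integrals by \<open>pot_bound\<close>, uniform in \<open>x\<close> up to the factor
    \<open>W x\<close>.\<close>
  have iq: "integrable (dV \<Otimes>\<^sub>M dV) (\<lambda>(x, y). q x y)"
  proof (rule dVdV.Fubini_integrable)
    show "integrable dV (\<lambda>x. \<integral>y. norm (case (x, y) of (x, y) \<Rightarrow> q x y) \<partial>dV)"
    proof (rule Bochner_Integration.integrable_bound)
      show "integrable dV (\<lambda>x. W x * (2 * pot_bound))" using W by simp
      show "AE x in dV. norm (\<integral>y. norm (case (x, y) of (x, y) \<Rightarrow> q x y) \<partial>dV) \<le> norm (W x * (2 * pot_bound))"
        using q_bd by (intro AE_I2) (force simp: abs_of_nonneg)
    qed measurable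
    show "AE x in dV. integrable dV (\<lambda>y. case (x, y) of (x, y) \<Rightarrow> q x y)"
      using q_int by (intro AE_I2) simp
  qed measurable
  have iq': "integrable (dV \<Otimes>\<^sub>M dV) (\<lambda>(x, y). q y x)"
    using dVdV.integrable_product_swap[OF iq] by (simp add: case_prod_beta)
  have Q: "pot_diff T = (\<integral>p. (case p of (x, y) \<Rightarrow> q x y) \<partial>(dV \<Otimes>\<^sub>M dV))"
    unfolding pot_diff_def dVdV.integral_fst'[OF iq, symmetric]
    by (intro Bochner_Integration.integral_cong) (auto simp: q_eq)
  have Q': "(\<integral>p. (case p of (x, y) \<Rightarrow> q y x) \<partial>(dV \<Otimes>\<^sub>M dV)) = pot_diff T"
    unfolding Q using dVdV.integral_product_swap[of "\<lambda>(x, y). q x y"] iq by simp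
  define E where "E x y = W x * W y * (1 - x \<bullet> y) powr (- (3/4))" for x y
  define l where "l x y = W y * (W x * ln (1 + T * x $ 3))" for x y
  have iE: "integrable (dV \<Otimes>\<^sub>M dV) (\<lambda>(x, y). E x y)"
    unfolding E_def by (rule WW_integrable)
  have il: "integrable (dV \<Otimes>\<^sub>M dV) (\<lambda>(x, y). l x y)"
    unfolding l_def
  proof (rule dVdV.Fubini_integrable)
    show "integrable dV (\<lambda>x. \<integral>y. norm (case (x, y) of (x, y) \<Rightarrow> W y * (W x * ln (1 + T * x $ 3))) \<partial>dV)"
    proof -
      have "(\<integral>y. \<bar>W y * c\<bar> \<partial>dV) = \<bar>c\<bar>" for c
        using W W1 W_pos by (simp add: abs_mult abs_of_pos)
      then show ?thesis using W_height_integrable[OF T] by simp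
    qed
    show "AE x in dV. integrable dV (\<lambda>y. case (x, y) of (x, y) \<Rightarrow> W y * (W x * ln (1 + T * x $ 3)))"
      using W by simp
  qed measurable
  have L: "(\<integral>p. (case p of (x, y) \<Rightarrow> l x y) \<partial>(dV \<Otimes>\<^sub>M dV)) = ell T"
    unfolding dVdV.integral_fst'[OF il, symmetric] unfolding l_def ell_def using W W1 by simp
  have il': "integrable (dV \<Otimes>\<^sub>M dV) (\<lambda>(x, y). l y x)"
    using dVdV.integrable_product_swap[OF il] by (simp add: case_prod_beta)
  have L': "(\<integral>p. (case p of (x, y) \<Rightarrow> l y x) \<partial>(dV \<Otimes>\<^sub>M dV)) = ell T"
    unfolding L[symmetric] using dVdV.integral_product_swap[of "\<lambda>(x, y). l x y"] il by simp
  have fm: "(\<lambda>p. fst p) \<in> borel_measurable (dV \<Otimes>\<^sub>M dV)" "(\<lambda>p. snd p) \<in> borel_measurable (dV \<Otimes>\<^sub>M dV)"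
    by (rule measurable_compose[OF measurable_fst measurable_ident_dV]
        measurable_compose[OF measurable_snd measurable_ident_dV])+
  note mm = measurable_compose[OF _ measurable_mobius]
  have meas: "{p \<in> space (dV \<Otimes>\<^sub>M dV). fst p \<bullet> snd p < 1} \<in> sets (dV \<Otimes>\<^sub>M dV)"
    "{p \<in> space (dV \<Otimes>\<^sub>M dV). snd p \<bullet> mobius T (fst p) < 1} \<in> sets (dV \<Otimes>\<^sub>M dV)"
    "{p \<in> space (dV \<Otimes>\<^sub>M dV). fst p \<bullet> mobius T (snd p) < 1} \<in> sets (dV \<Otimes>\<^sub>M dV)"
    by (intro borel_measurable_less borel_measurable_inner fm mm borel_measurable_const)+
  \<comment> \<open>The three exceptional sets, on which a logarithm would take the value
    \<open>ln 0 = 0\<close>, are null because their sections are; for the third the sections are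
    taken in the first variable.\<close>
  have AE1: "AE p in dV \<Otimes>\<^sub>M dV. fst p \<bullet> snd p < 1"
  proof (rule dVdV.AE_pair_measure[OF meas(1)], rule AE_I2)
    fix x assume "x \<in> space dV"
    then show "AE y in dV. fst (x, y) \<bullet> snd (x, y) < 1"
      using AE_dV_inner_less[of x] by (simp add: inner_commute)
  qed
  have AE2: "AE p in dV \<Otimes>\<^sub>M dV. snd p \<bullet> mobius T (fst p) < 1"
  proof (rule dVdV.AE_pair_measure[OF meas(2)], rule AE_I2)
    fix x assume "x \<in> space dV"
    then show "AE y in dV. snd (x, y) \<bullet> mobius T (fst (x, y)) < 1"
      using AE_dV_inner_less[OF mobius_S2[OF _ T], of x] by simp
  qed
  have AE3: "AE p in dV \<Otimes>\<^sub>M dV. fst p \<bullet> mobius T (snd p) < 1"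
  proof (rule dVdV.AE_pair_measure[OF meas(3)], subst dVdV.AE_commute)
    show "AE y in dV. AE x in dV. fst (x, y) \<bullet> mobius T (snd (x, y)) < 1"
      by (rule AE_I2) (use AE_dV_inner_less[OF mobius_S2[OF _ T]] in simp)
  qed (use meas(3) in simp)
  have S: "AE p in dV \<Otimes>\<^sub>M dV. p \<in> S2 \<times> S2" by (rule AE_I2) (simp add: space_pair_measure)
  have "2 * pot_diff T = (\<integral>p. (case p of (x, y) \<Rightarrow> q x y) + (case p of (x, y) \<Rightarrow> q y x) \<partial>(dV \<Otimes>\<^sub>M dV))"
    using Q Q' iq iq' by simp
  also have "\<dots> \<le> (\<integral>p. 4 * \<bar>T\<bar> powr (3/2) * (case p of (x, y) \<Rightarrow> E x y) - (case p of (x, y) \<Rightarrow> l x y) - (case p of (x, y) \<Rightarrow> l y x) \<partial>(dV \<Otimes>\<^sub>M dV))"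
  proof (rule integral_mono_AE)
    show "AE p in dV \<Otimes>\<^sub>M dV. (case p of (x, y) \<Rightarrow> q x y) + (case p of (x, y) \<Rightarrow> q y x)
      \<le> 4 * \<bar>T\<bar> powr (3/2) * (case p of (x, y) \<Rightarrow> E x y) - (case p of (x, y) \<Rightarrow> l x y) - (case p of (x, y) \<Rightarrow> l y x)"
      using AE1 AE2 AE3 S
    proof eventually_elim
      case (elim p)
      obtain x y where p: "p = (x, y)" by (cases p)
      have "W x * W y * (ln (1 - y \<bullet> mobius T x) + ln (1 - x \<bullet> mobius T y) - 2 * ln (1 - x \<bullet> y))
        \<le> W x * W y * (4 * (\<bar>T\<bar> powr (3/2) * (1 - x \<bullet> y) powr (- (3/4))) - ln (1 + T * x $ 3) - ln (1 + T * y $ 3))"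
        using elim W_pos T unfolding p by (intro mult_left_mono second_difference) (auto simp: less_imp_le)
      then show ?case unfolding p q_def E_def l_def by (simp add: algebra_simps inner_commute)
    qed
  qed (use iq iq' iE il il' in simp_all)
  also have "\<dots> = 4 * \<bar>T\<bar> powr (3/2) * energy - ell T - ell T"
    using iE il il' L L' unfolding energy_def E_def[symmetric] by simp
  finally show ?thesis by simp
qed

text \<open>The \<open>ell T\<close> of the kernel joins the one of the Jacobian and the poles.
  Every term on the left vanishes at \<open>T = 0\<close> while the right side is smaller than
  linear, so only the slope of the left side at 0 remains to be computed.\<close>

lemma pinched:
  assumes T: "\<bar>T\<bar> < 1"
  shows "aS * ln (1 + T) + aN * ln (1 - T) + ln (1 - T\<^sup>2) + (\<rho> / (2 * pi) - (aS + aN + 2)) * ell T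
    \<le> \<rho> / pi * energy * \<bar>T\<bar> powr (3/2)"
proof -
  have "\<rho> / (2 * pi) * pot_diff T \<le> \<rho> / (2 * pi) * (2 * \<bar>T\<bar> powr (3/2) * energy - ell T)"
    using pos by (intro mult_left_mono pot_diff_le[OF T]) auto
  with jensen_mobius[OF T] show ?thesis by (simp add: algebra_simps)
qed


section \<open>Expansion at \<open>T = 0\<close> and the range of \<open>\<rho>\<close>\<close>

lemma W_height: "integrable dV (\<lambda>x. W x * x $ 3)"
  by (rule integrable_mult_bounded[OF W _ S2_height]) measurable

definition center :: real where "center = (\<integral>x. W x * x $ 3 \<partial>dV)"

lemma ell_expansion:
  assumes T: "\<bar>T\<bar> \<le> 1/2"
  shows "\<bar>ell T - T * center\<bar> \<le> 2 * T\<^sup>2"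
proof -
  have T1: "\<bar>T\<bar> < 1" using T by simp
  note i = W_height_integrable[OF T1] W_height
  have "ell T - T * center = (\<integral>x. W x * ln (1 + T * x $ 3) - T * (W x * x $ 3) \<partial>dV)"
    unfolding ell_def center_def using i by simp
  also have "\<bar>\<dots>\<bar> \<le> (\<integral>x. \<bar>W x * ln (1 + T * x $ 3) - T * (W x * x $ 3)\<bar> \<partial>dV)" by (rule integral_abs_bound)
  also have "\<dots> \<le> (\<integral>x. 2 * T\<^sup>2 * W x \<partial>dV)"
  proof (rule Bochner_Integration.integral_mono)
    fix x assume "x \<in> space dV"
    then have z: "\<bar>x $ 3\<bar> \<le> 1" using S2_height by simp
    then have Tz: "\<bar>T * x $ 3\<bar> \<le> \<bar>T\<bar> * 1" unfolding abs_mult by (intro mult_left_mono) auto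
    then have "\<bar>ln (1 + T * x $ 3) - T * x $ 3\<bar> \<le> 2 * (T * x $ 3)\<^sup>2"
      using T by (intro abs_ln_one_plus_x_minus_x_bound) simp
    also have "(T * x $ 3)\<^sup>2 \<le> T\<^sup>2" using Tz by (simp add: abs_le_square_iff[symmetric])
    finally have "W x * \<bar>ln (1 + T * x $ 3) - T * x $ 3\<bar> \<le> W x * (2 * T\<^sup>2)"
      using W_pos[of x] by (intro mult_left_mono) auto
    moreover have "\<bar>W x * ln (1 + T * x $ 3) - T * (W x * x $ 3)\<bar> = W x * \<bar>ln (1 + T * x $ 3) - T * x $ 3\<bar>"
    proof -
      have "W x * ln (1 + T * x $ 3) - T * (W x * x $ 3) = W x * (ln (1 + T * x $ 3) - T * x $ 3)"
        by (simp add: algebra_simps)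
      then show ?thesis using W_pos[of x] by (simp add: abs_mult)
    qed
    ultimately show "\<bar>W x * ln (1 + T * x $ 3) - T * (W x * x $ 3)\<bar> \<le> 2 * T\<^sup>2 * W x"
      by (simp add: mult.commute)
  qed (use i W in auto)
  also have "\<dots> = 2 * T\<^sup>2" using W1 by simp
  finally show ?thesis .
qed

text \<open>A Kazdan-Warner identity: the first-order term of \<open>pinched\<close> vanishes because \<open>T\<close> may have
  either sign.\<close>

lemma kazdan_warner: "aS - aN + (\<rho> / (2 * pi) - (aS + aN + 2)) * center = 0"
proof -
  define \<mu> where "\<mu> = \<rho> / (2 * pi) - (aS + aN + 2)"
  \<comment> \<open>\<open>E\<close> is the slope at \<open>T = 0\<close> of the left side of
    \<open>pinched\<close>. \<open>C'\<close> below adds up the quadratic errors: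
    \<open>2 * aS\<close> and \<open>2 * aN\<close> from the pole logarithms, 3 from
    \<open>ln (1 - T\<^sup>2)\<close>, and \<open>2 * \<bar>\<mu>\<bar>\<close> from
    \<open>ell_expansion\<close>.\<close>
  define E where "E = aS - aN + \<mu> * center"
  define C where "C = \<rho> / pi * energy"
  define C' where "C' = 2 * aS + 2 * aN + 3 + 2 * \<bar>\<mu>\<bar>"
  have low: "T * E \<le> C * \<bar>T\<bar> powr (3/2) + C' * T\<^sup>2" if T: "\<bar>T\<bar> \<le> 1/2" for T
  proof -
    have "\<bar>ln (1 + T) - T\<bar> \<le> 2 * T\<^sup>2" "\<bar>ln (1 + (- T)) - (- T)\<bar> \<le> 2 * (- T)\<^sup>2"
      using T by (intro abs_ln_one_plus_x_minus_x_bound; simp)+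
    then have 1: "T - 2 * T\<^sup>2 \<le> ln (1 + T)" "- T - 2 * T\<^sup>2 \<le> ln (1 - T)" by auto
    have T4: "T\<^sup>2 \<le> (1/2)\<^sup>2" using T by (simp add: abs_le_square_iff[symmetric])
    then have "\<bar>ln (1 + (- T\<^sup>2)) - (- T\<^sup>2)\<bar> \<le> 2 * (- T\<^sup>2)\<^sup>2"
      by (intro abs_ln_one_plus_x_minus_x_bound) (simp add: power2_eq_square)
    moreover have "(- T\<^sup>2)\<^sup>2 \<le> T\<^sup>2 * 1"
      unfolding power2_minus power2_eq_square[of "T\<^sup>2"] using T4 by (intro mult_left_mono) (auto simp: power2_eq_square)
    ultimately have 2: "- 3 * T\<^sup>2 \<le> ln (1 - T\<^sup>2)" by auto
    have "\<mu> * (T * center - ell T) \<le> \<bar>\<mu>\<bar> * \<bar>T * center - ell T\<bar>"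
      by (metis abs_ge_self abs_mult)
    also have "\<dots> \<le> \<bar>\<mu>\<bar> * (2 * T\<^sup>2)"
      using ell_expansion[OF T] by (intro mult_left_mono) (auto simp: abs_minus_commute)
    finally have 3: "\<mu> * (T * center) - \<bar>\<mu>\<bar> * (2 * T\<^sup>2) \<le> \<mu> * ell T" by (simp add: right_diff_distrib)
    have "aS * (T - 2 * T\<^sup>2) + aN * (- T - 2 * T\<^sup>2) + (- 3 * T\<^sup>2) + (\<mu> * (T * center) - \<bar>\<mu>\<bar> * (2 * T\<^sup>2))
      \<le> aS * ln (1 + T) + aN * ln (1 - T) + ln (1 - T\<^sup>2) + \<mu> * ell T"
      using pos by (intro add_mono mult_left_mono 1 2 3) auto
    also have "\<dots> \<le> C * \<bar>T\<bar> powr (3/2)"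
      unfolding \<mu>_def C_def using T by (intro pinched) simp
    finally show ?thesis unfolding E_def C'_def by (simp add: algebra_simps)
  qed
  \<comment> \<open>\<open>low\<close> at \<open>eps n\<close> or at \<open>- eps n\<close>,
    according to the sign of \<open>E\<close>, with one factor \<open>eps n\<close> divided out;
    \<open>n \<ge> 1\<close> ensures \<open>eps n \<le> 1/2\<close>.\<close>
  have bd: "\<bar>E\<bar> \<le> C * eps n powr (1/2) + C' * eps n" if n: "n \<ge> 1" for n
  proof -
    have t: "0 < eps n" "eps n \<le> 1/2" using n by (auto simp: eps_def field_simps)
    have "eps n * \<bar>E\<bar> \<le> C * eps n powr (3/2) + C' * (eps n)\<^sup>2"
      using low[of "eps n"] low[of "- eps n"] t by (cases "E \<ge> 0") auto
    also have "eps n powr (3/2) = eps n * eps n powr (1/2)"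
      using t powr_add[of "eps n" 1 "1/2"] by simp
    finally have "eps n * \<bar>E\<bar> \<le> eps n * (C * eps n powr (1/2) + C' * eps n)"
      by (simp add: algebra_simps power2_eq_square)
    then show ?thesis using t by simp
  qed
  have "(\<lambda>n. C * eps n powr (1/2) + C' * eps n) \<longlonglongrightarrow> C * 0 powr (1/2) + C' * 0"
    using eps_pos by (intro tendsto_intros eps_tendsto tendsto_powr2) (auto simp: less_imp_le)
  then have "\<bar>E\<bar> \<le> C * 0 powr (1/2) + C' * 0"
    by (rule LIMSEQ_le_const) (use bd in blast)
  then show ?thesis unfolding E_def \<mu>_def by simp
qed

text \<open>\<open>1 - center\<close> and \<open>1 + center\<close> are the integrals of
  \<open>W x * (1 - x \<bullet> p)\<close> for the two poles \<open>p\<close>, of functions positive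
  almost everywhere on a sphere of positive area.\<close>

lemma center_less: "\<bar>center\<bar> < 1"
proof -
  have "(\<integral>x. W x * (1 - x \<bullet> p) \<partial>dV) > 0" if p: "p \<in> S2" for p
  proof -
    have i: "integrable dV (\<lambda>x. W x * (1 - x \<bullet> p))"
      using inner_S2_diff[OF _ p] by (intro integrable_mult_bounded[OF W, where B = 2]) auto
    have n: "AE x in dV. 0 \<le> W x * (1 - x \<bullet> p)"
      using inner_S2_diff[OF _ p] W_pos by (intro AE_I2 mult_nonneg_nonneg) (auto simp: less_imp_le)
    have "(\<integral>x. W x * (1 - x \<bullet> p) \<partial>dV) \<noteq> 0"
    proof
      assume "(\<integral>x. W x * (1 - x \<bullet> p) \<partial>dV) = 0"
      then have "AE x in dV. W x * (1 - x \<bullet> p) = 0"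
        using integral_nonneg_eq_0_iff_AE[OF i n] by simp
      with AE_dV_inner_less[OF p] have "AE x in dV. False"
        by eventually_elim (use W_pos in \<open>auto simp: less_imp_neq[symmetric]\<close>)
      then have "emeasure dV (space dV) = 0" by (simp only: eventually_False ae_filter_eq_bot_iff)
      then show False by (simp add: emeasure_dV)
    qed
    moreover have "(\<integral>x. W x * (1 - x \<bullet> p) \<partial>dV) \<ge> 0" using n by (rule integral_nonneg_AE)
    ultimately show ?thesis by simp
  qed
  note this[OF poles(1)] this[OF poles(2)]
  moreover have "(\<integral>x. W x * (1 - x \<bullet> north_pole) \<partial>dV) = 1 - center"
    "(\<integral>x. W x * (1 - x \<bullet> south_pole) \<partial>dV) = 1 + center"
    unfolding center_def poles right_diff_distrib using W W1 W_height by simp_all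
  ultimately show ?thesis by simp
qed

text \<open>The identity reads \<open>\<mu> * center = aN - aS\<close>, so
  \<open>\<bar>center\<bar> < 1\<close> forces \<open>\<bar>\<mu>\<bar> > aN - aS\<close>. As
  \<open>\<rho> / (2 * pi)\<close> is \<open>\<mu> + aS + aN + 2\<close>, the two signs of
  \<open>\<mu>\<close> are the two alternatives.\<close>

lemma mass_range:
  assumes "aS < aN"
  shows "\<rho> < 4 * pi * (1 + aS) \<or> 4 * pi * (1 + aN) < \<rho>"
proof -
  define \<mu> where "\<mu> = \<rho> / (2 * pi) - (aS + aN + 2)"
  have \<rho>: "\<rho> = 2 * pi * (\<mu> + aS + aN + 2)" by (simp add: \<mu>_def)
  have e: "\<mu> * center = aN - aS" using kazdan_warner by (simp add: \<mu>_def)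
  then have "\<mu> \<noteq> 0" using assms by auto
  then have "\<bar>\<mu>\<bar> * \<bar>center\<bar> < \<bar>\<mu>\<bar> * 1" using center_less by (intro mult_strict_left_mono) auto
  then have "aN - aS < \<bar>\<mu>\<bar>" using e assms by (simp flip: abs_mult)
  then consider "2 + 2 * aN < \<mu> + aS + aN + 2" | "\<mu> + aS + aN + 2 < 2 + 2 * aS" by linarith
  then show ?thesis
  proof cases
    case 1
    then have "2 * pi * (2 + 2 * aN) < \<rho>" unfolding \<rho> by (intro mult_strict_left_mono) auto
    then show ?thesis by (simp add: algebra_simps)
  next
    case 2
    then have "\<rho> < 2 * pi * (2 + 2 * aS)" unfolding \<rho> by (intro mult_strict_left_mono) auto
    then show ?thesis by (simp add: algebra_simps)
  qed
qed

end

section \<open>From the distributional equation to the theorem\<close>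

lemma liouville_solution_weak:
  assumes sol: "liouville_solution \<rho> 2 p \<alpha> u" and p: "p 1 = south_pole" "p 2 = north_pole"
    and pos: "0 < \<rho>" "0 < \<alpha> 1" "0 < \<alpha> 2"
  shows "liouville_weak u (\<lambda>x. exp (2 * u x) / (\<integral>y. exp (2 * u y) \<partial>dV)) \<rho> (\<integral>y. exp (2 * u y) \<partial>dV) (\<alpha> 1) (\<alpha> 2)"
proof -
  let ?Z = "\<integral>y. exp (2 * u y) \<partial>dV"
  have u: "integrable dV u" and ie: "integrable dV (\<lambda>x. exp (2 * u x))"
    and eqn: "\<And>\<phi>. \<phi> \<in> smooth_S2 \<Longrightarrow> - dist_laplacian (dist_of u) \<phi>
        = \<rho> * dist_of (\<lambda>x. exp (2 * u x) / ?Z - 1 / area_S2) \<phi>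
          - 2 * pi * (\<Sum>j=1..2. \<alpha> j * (dirac (p j) \<phi> - dist_of (\<lambda>_. 1 / area_S2) \<phi>))"
    using sol unfolding liouville_solution_def by auto
  \<comment> \<open>An everywhere positive function with integral 0 would make the whole sphere a
    null set.\<close>
  have "?Z \<noteq> 0"
  proof
    assume "?Z = 0"
    then have "AE x in dV. exp (2 * u x) = 0"
      using integral_nonneg_eq_0_iff_AE[OF ie] by simp
    then have "AE x in dV. False" by simp
    then have "emeasure dV (space dV) = 0" by (simp only: eventually_False ae_filter_eq_bot_iff)
    then show False by (simp add: emeasure_dV)
  qed
  moreover have "?Z \<ge> 0" by (rule integral_nonneg_AE) simp
  ultimately have Z: "?Z > 0" by (simp add: order_less_le)
  have sum: "(\<Sum>j=1..2. f j) = f 1 + f 2" for f :: "nat \<Rightarrow> real"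
    by (simp add: numeral_2_eq_2)
  show ?thesis
  proof (unfold_locales, goal_cases)
    case (9 \<phi>)
    then show ?case
      using eqn[unfolded sum p dist_laplacian_def dist_of_def dirac_def area_S2_eq] by blast
  qed (use pos u ie Z in simp_all)
qed

theorem proposition5p8:
  fixes \<rho> :: real and p :: "nat \<Rightarrow> real ^ 3" and \<alpha> :: "nat \<Rightarrow> real"
  assumes "p 1 = south_pole" and "p 2 = north_pole"
    and "0 < \<alpha> 1" and "\<alpha> 1 < \<alpha> 2"
    and "0 < \<rho>"
    and "\<exists>u. liouville_solution \<rho> 2 p \<alpha> u"
  shows "(0 < \<rho> \<and> \<rho> < 4 * pi * (1 + \<alpha> 1)) \<or> 4 * pi * (1 + \<alpha> 2) < \<rho>"
proof -
  obtain u where "liouville_solution \<rho> 2 p \<alpha> u" using assms(6) by blast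
  from liouville_solution_weak[OF this assms(1,2,5,3)]
  interpret liouville_weak u "\<lambda>x. exp (2 * u x) / (\<integral>y. exp (2 * u y) \<partial>dV)" \<rho>
    "\<integral>y. exp (2 * u y) \<partial>dV" "\<alpha> 1" "\<alpha> 2"
    using assms(3,4) by simp
  show ?thesis using mass_range[OF assms(4)] assms(5) by blast
qed

end
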